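(* Consider the exclusion process on $\mathbb{Z}^d$ with a tagged particle initially at the origin, and let $x_t$ be the position of the tagged particle at time $t$. Starting under $\nu'_\rho$, as $t\to\infty$, $$\frac1t\,x_t\ \to\ (1-\rho)\sum_vv\,p(v)\qquad\text{almost surely and in }L^1 .$$
   Context: $p$ is a finite-range translation-invariant jump probability on $\mathbb{Z}^d$ whose symmetrization $s(\cdot)=(p(\cdot)+p(-\cdot))/2$ is irreducible. The exclusion process $\eta_t$ on $\{0,1\}^{\mathbb{Z}^d}$ has generator $Lf(\eta)=\sum_{x,y\in\mathbb{Z}^d}\eta(x)(1-\eta(y))p(y-x)[f(\eta^{x,y})-f(\eta)]$ on local functions, where $\eta^{x,y}$ exchanges the values at $x$ and $y$. One particle, started at $x_0=0$, is tagged; the pair $(x_t,\eta_t)$ is the Markov process with generator $$\tilde Lf(x,\eta)=\sum_{u,v\ne x}p(v-u)\eta(u)(1-\eta(v))[f(x,\eta^{u,v})-f(x,\eta)]+\sum_vp(v)(1-\eta(x+v))[f(x+v,\eta^{x,x+v})-f(x,\eta)].$$ For $\rho\in[0,1]$, $\nu_\rho=\prod_{x\in\mathbb{Z}^d}\mathrm{Bern}(\rho)$, and $\nu'_\rho=\nu_\rho(\cdot\mid\eta(0)=1)$ is the Bernoulli product measure conditioned to have a particle at the origin (i.e. product Bernoulli($\rho$) off the origin, with $\eta(0)=1$). *)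

theory Defs
  imports "HOL-Probability.Probability"
begin

definition markov_semigroup :: "'s measure \<Rightarrow> (real \<Rightarrow> 's \<Rightarrow> 's measure) \<Rightarrow> bool" where
  "markov_semigroup S P \<longleftrightarrow>
     (\<forall>t\<ge>0. P t \<in> S \<rightarrow>\<^sub>M prob_algebra S) \<and>
     (\<forall>z\<in>space S. P 0 z = return S z) \<and>
     (\<forall>s\<ge>0. \<forall>t\<ge>0. \<forall>z\<in>space S. P (s + t) z = bind (P s z) (P t))"

text \<open>The infinitesimal generator, with the limit taken in the supremum norm, is defined on
  every function of the class \<open>D\<close> and coincides with \<open>L\<close> there. If \<open>D\<close> contains a core, as the
  local functions do below, this determines \<open>P\<close>.\<close>

definition has_generator_on ::
  "'s measure \<Rightarrow> (real \<Rightarrow> 's \<Rightarrow> 's measure) \<Rightarrow> ('s \<Rightarrow> real) set \<Rightarrow> (('s \<Rightarrow> real) \<Rightarrow> 's \<Rightarrow> real) \<Rightarrow> bool" where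
  "has_generator_on S P D L \<longleftrightarrow>
     (\<forall>f\<in>D. uniform_limit (space S)
        (\<lambda>t z. ((\<integral>z'. f z' \<partial>P t z) - f z) / t) (L f) (at_right 0))"

definition history :: "'w measure \<Rightarrow> 's measure \<Rightarrow> (real \<Rightarrow> 'w \<Rightarrow> 's) \<Rightarrow> real \<Rightarrow> 'w measure" where
  "history M S X s =
     sigma (space M) {X u -` A \<inter> space M |u A. 0 \<le> u \<and> u \<le> s \<and> A \<in> sets S}"

text \<open>Time is \<open>[0, \<infinity>)\<close>; the values of \<open>X\<close> and \<open>P\<close> at negative times are irrelevant.\<close>

definition markov_process ::
  "'w measure \<Rightarrow> 's measure \<Rightarrow> (real \<Rightarrow> 's \<Rightarrow> 's measure) \<Rightarrow> (real \<Rightarrow> 'w \<Rightarrow> 's) \<Rightarrow> bool" where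
  "markov_process M S P X \<longleftrightarrow>
     prob_space M \<and>
     (\<forall>t\<ge>0. X t \<in> M \<rightarrow>\<^sub>M S) \<and>
     (\<forall>s\<ge>0. \<forall>t\<ge>0. \<forall>B\<in>sets S.
        AE \<omega> in M. real_cond_exp M (history M S X s) (\<lambda>\<omega>'. indicator B (X (s + t) \<omega>')) \<omega>
          = measure (P t (X s \<omega>)) B)"

definition cadlag :: "(real \<Rightarrow> 's::topological_space) \<Rightarrow> bool" where
  "cadlag \<gamma> \<longleftrightarrow>
     (\<forall>t\<ge>0. (\<gamma> \<longlongrightarrow> \<gamma> t) (at_right t)) \<and> (\<forall>t>0. \<exists>l. (\<gamma> \<longlongrightarrow> l) (at_left t))"

definition symmetrization :: "'a::group_add pmf \<Rightarrow> 'a \<Rightarrow> real" where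
  "symmetrization p v = (pmf p v + pmf p (- v)) / 2"

definition irreducible_jumps :: "('a::group_add \<Rightarrow> real) \<Rightarrow> bool" where
  "irreducible_jumps s \<longleftrightarrow> (\<forall>x y. (\<lambda>a b. s (b - a) > 0)\<^sup>*\<^sup>* x y)"

definition real_vec :: "int ^ 'd \<Rightarrow> real ^ 'd" where
  "real_vec v = (\<chi> i. real_of_int (v $ i))"

type_synonym 'd config = "int ^ 'd \<Rightarrow> bool"
type_synonym 'd tagged_state = "(int ^ 'd) \<times> 'd config"

definition config_space :: "'d::finite config measure" where
  "config_space = PiM UNIV (\<lambda>_. count_space UNIV)"

definition tagged_space :: "'d::finite tagged_state measure" where
  "tagged_space = count_space UNIV \<Otimes>\<^sub>M config_space"

definition exchange :: "'d::finite config \<Rightarrow> int ^ 'd \<Rightarrow> int ^ 'd \<Rightarrow> 'd config" where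
  "exchange \<eta> u v = \<eta>(u := \<eta> v, v := \<eta> u)"

definition local_functions :: "('d::finite tagged_state \<Rightarrow> real) set" where
  "local_functions = {f. bounded (range f) \<and>
     (\<exists>\<Lambda>. finite \<Lambda> \<and> (\<forall>x \<eta> \<zeta>. (\<forall>y\<in>\<Lambda>. \<eta> y = \<zeta> y) \<longrightarrow> f (x, \<eta>) = f (x, \<zeta>)))}"

text \<open>For a local function \<open>f\<close> and a jump probability \<open>p\<close> of finite range, only finitely many
  terms of the infinite sum are nonzero.\<close>

definition tagged_generator ::
  "(int ^ 'd) pmf \<Rightarrow> ('d::finite tagged_state \<Rightarrow> real) \<Rightarrow> 'd tagged_state \<Rightarrow> real" where
  "tagged_generator p f = (\<lambda>(x, \<eta>).
     (\<Sum>\<^sub>\<infinity>(u, v)\<in>{(u, v). u \<noteq> x \<and> v \<noteq> x}.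
        pmf p (v - u) * of_bool (\<eta> u) * (1 - of_bool (\<eta> v)) * (f (x, exchange \<eta> u v) - f (x, \<eta>)))
     + (\<Sum>v\<in>set_pmf p.
        pmf p v * (1 - of_bool (\<eta> (x + v))) * (f (x + v, exchange \<eta> x (x + v)) - f (x, \<eta>))))"

text \<open>The Bernoulli product measure conditioned on a particle at the origin; given directly as a
  product so that it also makes sense for \<open>\<rho> = 0\<close>.\<close>

definition bernoulli_tagged :: "real \<Rightarrow> 'd::finite config measure" where
  "bernoulli_tagged \<rho> =
     PiM UNIV (\<lambda>x. measure_pmf (if x = 0 then return_pmf True else bernoulli_pmf \<rho>))"

text \<open>The topology on states is the product of the discrete topology on the lattice and the
  product topology on configurations, so the path condition says that both the tagged particle's
  position and every occupation variable are cadlag.\<close>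

definition tagged_exclusion_process ::
  "(int ^ 'd) pmf \<Rightarrow> 'd::finite config measure \<Rightarrow> 'w measure \<Rightarrow> (real \<Rightarrow> 'w \<Rightarrow> 'd tagged_state) \<Rightarrow> bool" where
  "tagged_exclusion_process p \<nu> M X \<longleftrightarrow>
     (\<exists>P. markov_semigroup tagged_space P \<and>
          has_generator_on tagged_space P local_functions (tagged_generator p) \<and>
          markov_process M tagged_space P X) \<and>
     (\<forall>\<omega>\<in>space M. cadlag (\<lambda>t. X t \<omega>)) \<and>
     distr M tagged_space (X 0) = return (count_space UNIV) 0 \<Otimes>\<^sub>M \<nu>"

end

theory Submission
  imports Defs
begin

text \<open>
  Seen from the tagged particle, the environment is a stationary Markov process under the
  conditioned Bernoulli measure, and the mean velocity of the tagged particle is a linear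
  function of the environment. No ergodic theorem is needed: the fluctuations are controlled
  quantitatively, \<open>E (x\<^sub>t - v t)\<^sup>2 \<le> K t\<^bsup>3/2\<^esup>\<close>.

  The generator determines the semigroup on local functions because local functions are
  analytic vectors: \<open>L\<^sup>k f\<close> grows at most like \<open>C\<^sup>k k!\<close> with \<open>C\<close> independent of \<open>f\<close>. The same series
  shows that \<open>\<theta> - L\<close> has dense range, so \<open>\<theta> g - L g = \<phi>\<close> can be solved approximately by a local
  \<open>g\<close>, where \<open>\<phi>\<close> is the centred drift. Pairing with \<open>g\<close> and comparing the occupation of a site
  \<open>k\<close> in the support of \<open>p\<close> with its average over \<open>k, 2k, \<dots>, Nk\<close>, at the cost of the Dirichlet
  form, bounds \<open>g\<close> in \<open>L\<^sup>2\<close> by \<open>\<theta>\<^bsup>-3/4\<^esup>\<close>. With \<open>\<theta> = 1/t\<close> this controls the conditional mean of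
  \<open>x\<^sub>t - v t\<close>, and splitting \<open>[0, 2t]\<close> in two halves turns it into the variance bound.

  The variance bound gives convergence in \<open>L\<^sup>1\<close>, and almost surely along \<open>t = n\<^sup>4\<close>; between
  consecutive grid points a maximal inequality applies.
\<close>

section \<open>Local functions and the generator\<close>

text \<open>The class \<open>local_functions\<close>, on which the generator is given, reads fixed
  sites, while everything of interest reads sites relative to the tagged particle, and the position
  itself is unbounded. Both gaps are closed by cutting off and passing to the limit; the errors
  vanish because jumps have bounded length.

  The exponent 3/2 comes from a balance. Averaging over N sites costs a term of order N, and the
  remaining variance 1/N contributes 1 / (\<theta> N); N of order \<theta>^(-1/2) equalises the two.
  This is far from diffusive, but any exponent below 2 yields a law of large numbers.

  The conditional mean and variance of the displacement are not local functions, so stationarity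
  cannot be applied to them directly. Their estimates are stated for the law at an arbitrary later
  time s, uniformly in s, and stationarity is used for local functions only.

  When the two halves are joined, the cross term must be split unevenly. The even split would give
  the factor 2 + 1, which exceeds 2^(3/2), whereas 5/4 + 1 is smaller, so that the bound reproduces
  itself under doubling.\<close>

definition seen_from :: "int ^ 'd \<Rightarrow> 'd::finite config \<Rightarrow> 'd config" where
  "seen_from x \<eta> = (\<lambda>y. \<eta> (x + y))"

text \<open>The window is measured from the tagged position, whereas the sites in
  \<open>local_functions\<close> are fixed. This admits the drift and all local functions of the
  environment.\<close>

definition depends_near :: "(int ^ 'd) set \<Rightarrow> ('d::finite tagged_state \<Rightarrow> real) \<Rightarrow> bool" where
  "depends_near \<Lambda> f \<longleftrightarrow> (\<forall>x \<eta> \<zeta>. (\<forall>y\<in>\<Lambda>. \<eta> (x + y) = \<zeta> (x + y)) \<longrightarrow> f (x, \<eta>) = f (x, \<zeta>))"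

definition moving_local :: "('d::finite tagged_state \<Rightarrow> real) set" where
  "moving_local = {f. (\<exists>a. \<forall>z. \<bar>f z\<bar> \<le> a) \<and> (\<exists>\<Lambda>. finite \<Lambda> \<and> depends_near \<Lambda> f)}"

text \<open>These are the observables of the environment process. They stay functions on the full
  state space, so that no second semigroup for the environment has to be built.\<close>

definition environment_fun :: "('d::finite tagged_state \<Rightarrow> real) \<Rightarrow> bool" where
  "environment_fun f \<longleftrightarrow> (\<forall>x \<eta>. f (x, \<eta>) = f (0, seen_from x \<eta>))"

definition exchange_term ::
  "(int ^ 'd) pmf \<Rightarrow> int ^ 'd \<Rightarrow> int ^ 'd \<Rightarrow> ('d::finite tagged_state \<Rightarrow> real) \<Rightarrow> 'd tagged_state \<Rightarrow> real" where
  "exchange_term p k u f = (\<lambda>(x, \<eta>). of_bool (u \<noteq> 0 \<and> u + k \<noteq> 0) * pmf p k * of_bool (\<eta> (x + u)) *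
     (1 - of_bool (\<eta> (x + u + k))) * (f (x, exchange \<eta> (x + u) (x + u + k)) - f (x, \<eta>)))"

definition jump_term ::
  "(int ^ 'd) pmf \<Rightarrow> int ^ 'd \<Rightarrow> ('d::finite tagged_state \<Rightarrow> real) \<Rightarrow> 'd tagged_state \<Rightarrow> real" where
  "jump_term p k f = (\<lambda>(x, \<eta>). pmf p k * (1 - of_bool (\<eta> (x + k))) *
     (f (x + k, exchange \<eta> x (x + k)) - f (x, \<eta>)))"

text \<open>The starting sites \<open>u\<close> of the bonds from \<open>u\<close> to
  \<open>u + k\<close> that have an endpoint in \<open>\<Lambda>\<close>.\<close>

definition generator_hull :: "(int ^ 'd) pmf \<Rightarrow> (int ^ 'd) set \<Rightarrow> (int ^ 'd::finite) set" where
  "generator_hull p \<Lambda> = \<Lambda> \<union> (\<Union>k\<in>set_pmf p. (\<lambda>y. y - k) ` \<Lambda>)"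

lemma depends_nearD:
  "depends_near \<Lambda> f \<Longrightarrow> (\<And>y. y \<in> \<Lambda> \<Longrightarrow> \<eta> (x + y) = \<zeta> (x + y)) \<Longrightarrow> f (x, \<eta>) = f (x, \<zeta>)"
  unfolding depends_near_def by blast

lemma depends_near_mono: "depends_near \<Lambda> f \<Longrightarrow> \<Lambda> \<subseteq> \<Lambda>' \<Longrightarrow> depends_near \<Lambda>' f"
  unfolding depends_near_def by blast

lemma finite_generator_hull: "finite (set_pmf p) \<Longrightarrow> finite \<Lambda> \<Longrightarrow> finite (generator_hull p \<Lambda>)"
  unfolding generator_hull_def by auto

lemma exchange_outside:
  assumes "depends_near \<Lambda> f" "u - x \<notin> \<Lambda>" "v - x \<notin> \<Lambda>"
  shows "f (x, exchange \<eta> u v) = f (x, \<eta>)"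
  using assms(1) by (rule depends_nearD) (use assms(2,3) in \<open>auto simp: exchange_def\<close>)

text \<open>A bond with both endpoints outside the window does not change \<open>f\<close>, so the
  infinite sum is finite. Any finite superset \<open>A\<close> of the hull is allowed because
  several functions are later expanded over one common index set.\<close>

lemma tagged_generator_eq:
  assumes S: "finite (set_pmf p)" and f: "depends_near \<Lambda> f"
    and A: "finite A" "generator_hull p \<Lambda> \<subseteq> A"
  shows "tagged_generator p f z =
    (\<Sum>k\<in>set_pmf p. \<Sum>u\<in>A. exchange_term p k u f z) + (\<Sum>k\<in>set_pmf p. jump_term p k f z)"
proof -
  obtain x \<eta> where z: "z = (x, \<eta>)" by (cases z)
  define T where "T = (\<lambda>(u, v). pmf p (v - u) * of_bool (\<eta> u) * (1 - of_bool (\<eta> v)) *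
    (f (x, exchange \<eta> u v) - f (x, \<eta>)))"
  define J where "J = {(k, u). k \<in> set_pmf p \<and> u \<in> A \<and> u \<noteq> 0 \<and> u + k \<noteq> 0}"
  define h where "h = (\<lambda>(k, u). (x + u, x + u + k))"
  have finJ: "finite J"
    by (rule finite_subset[of _ "set_pmf p \<times> A"]) (use S A in \<open>auto simp: J_def\<close>)
  have inj: "inj_on h J" by (auto simp: h_def inj_on_def)
  \<comment> \<open>A bond not indexed by \<open>J\<close> has rate zero or starts outside
    \<open>A\<close>. In the second case \<open>v\<close> is outside the window too, since otherwise
    \<open>u\<close> would lie in the hull.\<close>
  have zero: "T (u, v) = 0" if uv: "u \<noteq> x" "v \<noteq> x" "(u, v) \<notin> h ` J" for u v
  proof (cases "v - u \<in> set_pmf p")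
    case True
    have "u - x \<notin> A"
    proof
      assume "u - x \<in> A"
      with True uv have "(v - u, u - x) \<in> J" by (auto simp: J_def)
      then have "h (v - u, u - x) \<in> h ` J" by (rule imageI)
      then show False using uv by (simp add: h_def)
    qed
    moreover have "u - x \<in> A" if "v - x \<in> \<Lambda>"
    proof -
      have "v - x - (v - u) \<in> generator_hull p \<Lambda>"
        using that True unfolding generator_hull_def by blast
      then show ?thesis using A by (auto simp: algebra_simps)
    qed
    ultimately have "u - x \<notin> \<Lambda>" "v - x \<notin> \<Lambda>"
      using A unfolding generator_hull_def by auto
    then show ?thesis using exchange_outside[OF f] by (simp add: T_def)
  qed (auto simp: T_def set_pmf_iff)
  have "infsum T {(u, v). u \<noteq> x \<and> v \<noteq> x} = infsum T (h ` J)"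
    by (rule infsum_cong_neutral) (auto simp: zero, auto simp: h_def J_def)
  also have "\<dots> = sum T (h ` J)" using finJ by simp
  also have "\<dots> = (\<Sum>(k, u)\<in>J. T (x + u, x + u + k))"
    by (subst sum.reindex[OF inj]) (auto simp: h_def intro: sum.cong)
  also have "\<dots> = (\<Sum>(k, u)\<in>set_pmf p \<times> A. exchange_term p k u f z)"
    by (rule sum.mono_neutral_cong_left)
      (use S A in \<open>auto simp: J_def T_def exchange_term_def z\<close>)
  also have "\<dots> = (\<Sum>k\<in>set_pmf p. \<Sum>u\<in>A. exchange_term p k u f z)"
    by (simp add: sum.cartesian_product)
  finally show ?thesis
    unfolding tagged_generator_def z T_def jump_term_def by simp
qed

section \<open>Closure properties, linearity and translation covariance\<close>

lemma moving_localE: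
  assumes "f \<in> moving_local"
  obtains a \<Lambda> where "\<And>z. \<bar>f z\<bar> \<le> a" "finite \<Lambda>" "depends_near \<Lambda> f"
  using assms unfolding moving_local_def by auto

lemma moving_localI:
  "(\<And>z. \<bar>f z\<bar> \<le> a) \<Longrightarrow> finite \<Lambda> \<Longrightarrow> depends_near \<Lambda> f \<Longrightarrow> f \<in> moving_local"
  unfolding moving_local_def by auto

lemma depends_near_comp2:
  fixes f g :: "'d::finite tagged_state \<Rightarrow> real"
  assumes "depends_near \<Lambda> f" "depends_near \<Lambda>' g"
  shows "depends_near (\<Lambda> \<union> \<Lambda>') (\<lambda>z. F (f z) (g z))"
  unfolding depends_near_def[of "\<Lambda> \<union> \<Lambda>'"]
proof (intro allI impI)
  fix x and \<eta> \<zeta> :: "'d config"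
  assume "\<forall>y\<in>\<Lambda> \<union> \<Lambda>'. \<eta> (x + y) = \<zeta> (x + y)"
  then have "f (x, \<eta>) = f (x, \<zeta>)" "g (x, \<eta>) = g (x, \<zeta>)"
    using depends_nearD[OF assms(1), of \<eta> x \<zeta>] depends_nearD[OF assms(2), of \<eta> x \<zeta>] by auto
  then show "F (f (x, \<eta>)) (g (x, \<eta>)) = F (f (x, \<zeta>)) (g (x, \<zeta>))"
    by (simp only:)
qed

lemmas depends_near_add = depends_near_comp2[where F = "(+)"]
lemmas depends_near_mult = depends_near_comp2[where F = "(*)"]

lemma moving_local_const [simp]: "(\<lambda>_. c) \<in> moving_local"
  by (rule moving_localI[of _ "\<bar>c\<bar>" "{}"]) (auto simp: depends_near_def)

lemma moving_local_add [intro]: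
  assumes "f \<in> moving_local" "g \<in> moving_local"
  shows "(\<lambda>z. f z + g z) \<in> moving_local"
proof -
  obtain a \<Lambda> b \<Lambda>' where *: "\<And>z. \<bar>f z\<bar> \<le> a" "finite \<Lambda>" "depends_near \<Lambda> f"
    "\<And>z. \<bar>g z\<bar> \<le> b" "finite \<Lambda>'" "depends_near \<Lambda>' g"
    using assms by (metis moving_localE)
  show ?thesis
  proof (rule moving_localI)
    show "\<bar>f z + g z\<bar> \<le> a + b" for z
      using *(1)[of z] *(4)[of z] by linarith
    show "depends_near (\<Lambda> \<union> \<Lambda>') (\<lambda>z. f z + g z)"
      by (rule depends_near_add) fact+
  qed (use * in auto)
qed

lemma moving_local_mult [intro]:
  assumes "f \<in> moving_local" "g \<in> moving_local"
  shows "(\<lambda>z. f z * g z) \<in> moving_local"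
proof -
  obtain a \<Lambda> b \<Lambda>' where *: "\<And>z. \<bar>f z\<bar> \<le> a" "finite \<Lambda>" "depends_near \<Lambda> f"
    "\<And>z. \<bar>g z\<bar> \<le> b" "finite \<Lambda>'" "depends_near \<Lambda>' g"
    using assms by (metis moving_localE)
  have "\<bar>f z * g z\<bar> \<le> a * b" for z
    unfolding abs_mult by (intro mult_mono *) (use *(1)[of z] in linarith)+
  then show ?thesis
    by (rule moving_localI[of _ _ "\<Lambda> \<union> \<Lambda>'"]) (use * in \<open>auto intro: depends_near_mult\<close>)
qed

lemma moving_local_cmult [intro]: "f \<in> moving_local \<Longrightarrow> (\<lambda>z. c * f z) \<in> moving_local"
  by (intro moving_local_mult moving_local_const)

lemma moving_local_diff [intro]:
  assumes "f \<in> moving_local" "g \<in> moving_local"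
  shows "(\<lambda>z. f z - g z) \<in> moving_local"
  using moving_local_add[OF assms(1) moving_local_cmult[OF assms(2), of "-1"]] by simp

lemma moving_local_sum [intro]:
  "(\<And>i. i \<in> I \<Longrightarrow> f i \<in> moving_local) \<Longrightarrow> (\<lambda>z. \<Sum>i\<in>I. f i z) \<in> moving_local"
  by (induction I rule: infinite_finite_induct) auto

lemma environment_fun_const [simp]: "environment_fun (\<lambda>_. c)"
  by (simp add: environment_fun_def)

lemma environment_funD: "environment_fun f \<Longrightarrow> f (x, \<eta>) = f (0, seen_from x \<eta>)"
  unfolding environment_fun_def by blast

lemma environment_funI: "(\<And>x \<eta>. f (x, \<eta>) = f (0, seen_from x \<eta>)) \<Longrightarrow> environment_fun f"
  unfolding environment_fun_def by blast

lemma environment_fun_comp2: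
  assumes "environment_fun f" "environment_fun g"
  shows "environment_fun (\<lambda>z. F (f z) (g z))"
proof (rule environment_funI)
  fix x \<eta>
  show "F (f (x, \<eta>)) (g (x, \<eta>)) = F (f (0, seen_from x \<eta>)) (g (0, seen_from x \<eta>))"
    by (simp only: environment_funD[OF assms(1), of x \<eta>] environment_funD[OF assms(2), of x \<eta>])
qed

lemma environment_fun_add [intro]:
  "environment_fun f \<Longrightarrow> environment_fun g \<Longrightarrow> environment_fun (\<lambda>z. f z + g z)"
  by (rule environment_fun_comp2[where F = "(+)"])

lemma environment_fun_mult [intro]:
  "environment_fun f \<Longrightarrow> environment_fun g \<Longrightarrow> environment_fun (\<lambda>z. f z * g z)"
  by (rule environment_fun_comp2[where F = "(*)"])

lemma environment_fun_cmult [intro]: "environment_fun f \<Longrightarrow> environment_fun (\<lambda>z. c * f z)"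
  by (intro environment_fun_mult environment_fun_const)

lemma environment_fun_diff [intro]:
  "environment_fun f \<Longrightarrow> environment_fun g \<Longrightarrow> environment_fun (\<lambda>z. f z - g z)"
  by (rule environment_fun_comp2[where F = "(-)"])

lemma environment_fun_sum [intro]:
  "(\<And>i. i \<in> I \<Longrightarrow> environment_fun (f i)) \<Longrightarrow> environment_fun (\<lambda>z. \<Sum>i\<in>I. f i z)"
  by (induction I rule: infinite_finite_induct) auto

lemma tagged_generator_linear:
  assumes S: "finite (set_pmf p)" and f: "f \<in> moving_local" and g: "g \<in> moving_local"
  shows "tagged_generator p (\<lambda>z. a * f z + b * g z) z =
    a * tagged_generator p f z + b * tagged_generator p g z"
proof -
  obtain \<Lambda> \<Lambda>' where *: "finite \<Lambda>" "depends_near \<Lambda> f" "finite \<Lambda>'" "depends_near \<Lambda>' g"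
    using f g by (metis moving_localE)
  let ?A = "generator_hull p (\<Lambda> \<union> \<Lambda>')"
  have fg: "depends_near (\<Lambda> \<union> \<Lambda>') f" "depends_near (\<Lambda> \<union> \<Lambda>') g"
    using * by (auto intro: depends_near_mono)
  then have fg': "depends_near (\<Lambda> \<union> \<Lambda>') (\<lambda>z. a * f z + b * g z)"
    using depends_near_comp2[OF fg, where F = "\<lambda>s t. a * s + b * t"] by simp
  have fin: "finite ?A" using * S by (intro finite_generator_hull) auto
  have [simp]: "exchange_term p k u (\<lambda>z. a * f z + b * g z) z =
      a * exchange_term p k u f z + b * exchange_term p k u g z" for k u
    by (cases z) (simp add: exchange_term_def algebra_simps)
  have [simp]: "jump_term p k (\<lambda>z. a * f z + b * g z) z =
      a * jump_term p k f z + b * jump_term p k g z" for k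
    by (cases z) (simp add: jump_term_def algebra_simps)
  show ?thesis
    by (simp add: tagged_generator_eq[OF S _ fin order_refl] fg fg' sum.distrib sum_distrib_left
        algebra_simps)
qed

lemma tagged_generator_add:
  assumes "finite (set_pmf p)" "f \<in> moving_local" "g \<in> moving_local"
  shows "tagged_generator p (\<lambda>z. f z + g z) z = tagged_generator p f z + tagged_generator p g z"
  using tagged_generator_linear[OF assms, of 1 1] by simp

lemma tagged_generator_cmult:
  assumes "finite (set_pmf p)" "f \<in> moving_local"
  shows "tagged_generator p (\<lambda>z. a * f z) z = a * tagged_generator p f z"
  using tagged_generator_linear[OF assms(1,2,2), of a 0] by simp

lemma tagged_generator_const: "tagged_generator p (\<lambda>_. c) = (\<lambda>_. 0)"
  unfolding tagged_generator_def by (auto simp: fun_eq_iff intro!: infsum_0)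

lemma tagged_generator_sum:
  assumes "finite (set_pmf p)" "\<And>i. i \<in> I \<Longrightarrow> f i \<in> moving_local"
  shows "tagged_generator p (\<lambda>z. \<Sum>i\<in>I. f i z) z = (\<Sum>i\<in>I. tagged_generator p (f i) z)"
  using assms(2)
proof (induction I rule: infinite_finite_induct)
  case (insert i I)
  then show ?case by (simp add: tagged_generator_add[OF assms(1)] moving_local_sum)
qed (simp_all add: tagged_generator_const)

text \<open>Both kinds of terms commute with the change of frame. At a jump the frame moves as well,
  and recentring at \<open>x + k\<close> amounts to recentring at \<open>x\<close> and then at
  \<open>k\<close>.\<close>

lemma environment_fun_tagged_generator:
  assumes S: "finite (set_pmf p)" and f: "f \<in> moving_local" "environment_fun f"
  shows "environment_fun (tagged_generator p f)"
  unfolding environment_fun_def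
proof (intro allI)
  fix x \<eta>
  obtain \<Lambda> where *: "finite \<Lambda>" "depends_near \<Lambda> f"
    using f by (metis moving_localE)
  have fin: "finite (generator_hull p \<Lambda>)" using * S by (intro finite_generator_hull) auto
  have env: "f (y, \<zeta>) = f (0, seen_from y \<zeta>)" for y \<zeta>
    using f(2) by (simp add: environment_fun_def)
  have 1: "exchange_term p k u f (x, \<eta>) = exchange_term p k u f (0, seen_from x \<eta>)" for k u
  proof -
    have "seen_from x (exchange \<eta> (x + u) (x + u + k)) = exchange (seen_from x \<eta>) u (u + k)"
      by (auto simp: seen_from_def exchange_def fun_eq_iff add.assoc)
    then show ?thesis
      unfolding exchange_term_def
      by (simp add: env[of x]) (simp add: seen_from_def add.assoc)
  qed
  have 2: "jump_term p k f (x, \<eta>) = jump_term p k f (0, seen_from x \<eta>)" for k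
  proof -
    have "seen_from (x + k) (exchange \<eta> x (x + k)) = seen_from k (exchange (seen_from x \<eta>) 0 k)"
      by (auto simp: seen_from_def exchange_def fun_eq_iff add.assoc)
    then show ?thesis
      unfolding jump_term_def
      by (simp add: env[of x] env[of "x + k"] env[of k]) (simp add: seen_from_def)
  qed
  show "tagged_generator p f (x, \<eta>) = tagged_generator p f (0, seen_from x \<eta>)"
    by (simp add: tagged_generator_eq[OF S *(2) fin order_refl] 1 2)
qed

section \<open>Growth of iterated generators\<close>

text \<open>A norm adapted to iteration: a finite sum of functions of at most \<open>n\<close> sites
  each, with \<open>a\<close> the total of their sup bounds. The generator turns a summand into a
  number of summands of order \<open>n + 1\<close>, each on \<open>n + 2\<close> sites. The window
  of the whole sum is not recorded: it grows like a volume, and a bound through it would outgrow the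
  factorial in higher dimension.\<close>

inductive local_sum :: "nat \<Rightarrow> real \<Rightarrow> ('d::finite tagged_state \<Rightarrow> real) \<Rightarrow> bool" where
  single: "finite \<Lambda> \<Longrightarrow> card \<Lambda> \<le> n \<Longrightarrow> depends_near \<Lambda> f \<Longrightarrow> (\<And>z. \<bar>f z\<bar> \<le> a) \<Longrightarrow> local_sum n a f"
| add: "local_sum n a f \<Longrightarrow> local_sum n b g \<Longrightarrow> local_sum n (a + b) (\<lambda>z. f z + g z)"

lemma local_sum_bound: "local_sum n a f \<Longrightarrow> \<bar>f z\<bar> \<le> a"
proof (induction rule: local_sum.induct)
  case (add n a f b g)
  then show ?case by linarith
qed auto

lemma local_sum_moving_local: "local_sum n a f \<Longrightarrow> f \<in> moving_local"
proof (induction rule: local_sum.induct)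
  case (single \<Lambda> n f a)
  then show ?case by (intro moving_localI[of f a \<Lambda>])
qed auto

lemma local_sum_zero: "0 \<le> a \<Longrightarrow> local_sum n a (\<lambda>_. 0)"
  by (rule local_sum.single[of "{}"]) (auto simp: depends_near_def)

lemma local_sum_mono:
  assumes "local_sum n a f" "a \<le> b"
  shows "local_sum n b f"
  using local_sum.add[OF assms(1) local_sum_zero[of "b - a"]] assms(2) by simp

lemma local_sum_sum:
  assumes "finite I" "\<And>i. i \<in> I \<Longrightarrow> local_sum n a (f i)"
  shows "local_sum n (real (card I) * a) (\<lambda>z. \<Sum>i\<in>I. f i z)"
  using assms
proof (induction I rule: finite_induct)
  case empty
  then show ?case by (simp add: local_sum_zero)
next
  case (insert i I)
  then have "local_sum n (a + real (card I) * a) (\<lambda>z. f i z + (\<Sum>i\<in>I. f i z))"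
    by (intro local_sum.add) auto
  then show ?case using insert by (simp add: algebra_simps)
qed

lemma local_sum_exchange_term:
  fixes f :: "'d::finite tagged_state \<Rightarrow> real"
  assumes L: "finite \<Lambda>" "card \<Lambda> \<le> n" and f: "depends_near \<Lambda> f" "\<And>z. \<bar>f z\<bar> \<le> a"
  shows "local_sum (n + 2) (2 * a) (exchange_term p k u f)"
proof (rule local_sum.single)
  let ?L = "\<Lambda> \<union> {u, u + k}"
  show "finite ?L" using L by simp
  have "card ?L \<le> card \<Lambda> + card {u, u + k}" by (rule card_Un_le)
  also have "card {u, u + k} \<le> 2" by (simp add: card_insert_if)
  finally show "card ?L \<le> n + 2" using L by simp
  show "depends_near ?L (exchange_term p k u f)"
    unfolding depends_near_def
  proof (intro allI impI)
    fix x and \<eta> \<zeta> :: "'d config"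
    assume "\<forall>y\<in>?L. \<eta> (x + y) = \<zeta> (x + y)"
    then have eq: "\<And>y. y \<in> \<Lambda> \<Longrightarrow> \<eta> (x + y) = \<zeta> (x + y)" "\<eta> (x + u) = \<zeta> (x + u)"
      "\<eta> (x + u + k) = \<zeta> (x + u + k)" by (auto simp: add.assoc)
    have "f (x, \<eta>) = f (x, \<zeta>)" by (rule depends_nearD[OF f(1)]) (rule eq)
    moreover have "f (x, exchange \<eta> (x + u) (x + u + k)) = f (x, exchange \<zeta> (x + u) (x + u + k))"
      by (rule depends_nearD[OF f(1)]) (auto simp: exchange_def eq)
    ultimately show "exchange_term p k u f (x, \<eta>) = exchange_term p k u f (x, \<zeta>)"
      by (simp add: exchange_term_def eq)
  qed
  show "\<bar>exchange_term p k u f z\<bar> \<le> 2 * a" for z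
  proof -
    obtain x \<eta> where z: "z = (x, \<eta>)" by (cases z)
    let ?d = "f (x, exchange \<eta> (x + u) (x + u + k)) - f (x, \<eta>)"
    have "\<bar>?d\<bar> \<le> 2 * a"
      using f(2)[of "(x, exchange \<eta> (x + u) (x + u + k))"] f(2)[of "(x, \<eta>)"] by linarith
    moreover have "\<bar>pmf p k * ?d\<bar> \<le> \<bar>?d\<bar>"
      by (simp add: abs_mult mult_left_le_one_le pmf_le_1)
    ultimately show ?thesis
      unfolding z exchange_term_def by (auto simp: of_bool_def)
  qed
qed

text \<open>After the jump \<open>f\<close> reads its window shifted by \<open>k\<close>, before the
  jump the original one. A single summand would need both windows and double the number of sites; as
  two summands of size \<open>a\<close>, each needs at most two new sites.\<close>

lemma local_sum_jump_term:
  fixes f :: "'d::finite tagged_state \<Rightarrow> real"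
  assumes L: "finite \<Lambda>" "card \<Lambda> \<le> n" and f: "depends_near \<Lambda> f" "\<And>z. \<bar>f z\<bar> \<le> a"
  shows "local_sum (n + 2) (2 * a) (jump_term p k f)"
proof -
  define c where "c = (\<lambda>(x, \<eta> :: 'd config). pmf p k * (1 - of_bool (\<eta> (x + k))))"
  define g where "g = (\<lambda>(x, \<eta>). f (x + k, exchange \<eta> x (x + k)))"
  have c: "\<bar>c z\<bar> \<le> 1" for z
    by (cases z) (auto simp: c_def of_bool_def pmf_le_1)
  have cd: "depends_near {k} c"
    by (simp add: depends_near_def c_def)
  have cf: "local_sum (n + 2) a (\<lambda>z. c z * h z)"
    if h: "depends_near \<Delta> h" "\<And>z. \<bar>h z\<bar> \<le> a" and D: "finite \<Delta>" "card (insert k \<Delta>) \<le> n + 2" for h \<Delta>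
  proof (rule local_sum.single)
    show "depends_near ({k} \<union> \<Delta>) (\<lambda>z. c z * h z)" by (rule depends_near_mult[OF cd h(1)])
    show "\<bar>c z * h z\<bar> \<le> a" for z
      using mult_mono[OF c[of z] h(2)[of z]] by (simp add: abs_mult)
  qed (use D in auto)
  have "local_sum (n + 2) a (\<lambda>z. c z * g z)"
  proof (rule cf)
    let ?D = "(\<lambda>y. k + y) ` \<Lambda> \<union> {0, k}"
    show "depends_near ?D g"
      unfolding depends_near_def
    proof (intro allI impI)
      fix x and \<eta> \<zeta> :: "'d config"
      assume "\<forall>y\<in>?D. \<eta> (x + y) = \<zeta> (x + y)"
      then have eq: "\<And>y. y \<in> \<Lambda> \<Longrightarrow> \<eta> (x + k + y) = \<zeta> (x + k + y)" "\<eta> x = \<zeta> x"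
        "\<eta> (x + k) = \<zeta> (x + k)" by (auto simp: add.assoc)
      show "g (x, \<eta>) = g (x, \<zeta>)"
        unfolding g_def prod.case
        by (rule depends_nearD[OF f(1)]) (auto simp: exchange_def eq)
    qed
    show "\<bar>g z\<bar> \<le> a" for z by (cases z) (simp add: g_def f)
    show "finite ?D" using L by simp
    have "card (insert k ?D) = card ((\<lambda>y. k + y) ` \<Lambda> \<union> {0, k})" by (intro arg_cong[of _ _ card]) auto
    also have "\<dots> \<le> card ((\<lambda>y. k + y) ` \<Lambda>) + card {0, k}" by (rule card_Un_le)
    also have "card {0, k} \<le> 2" by (simp add: card_insert_if)
    also have "card ((\<lambda>y. k + y) ` \<Lambda>) \<le> card \<Lambda>" using L by (intro card_image_le)
    finally show "card (insert k ?D) \<le> n + 2" using L by simp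
  qed
  moreover have "local_sum (n + 2) a (\<lambda>z. c z * - f z)"
  proof (rule cf)
    show "depends_near \<Lambda> (\<lambda>z. - f z)"
      using depends_near_comp2[OF f(1) f(1), of "\<lambda>s t. - s"] by simp
    show "card (insert k \<Lambda>) \<le> n + 2" using L by (simp add: card_insert_if)
  qed (use f L in auto)
  ultimately have "local_sum (n + 2) (a + a) (\<lambda>z. c z * g z + c z * - f z)"
    by (rule local_sum.add)
  moreover have "(\<lambda>z. c z * g z + c z * - f z) = jump_term p k f"
    by (auto simp: fun_eq_iff c_def g_def jump_term_def algebra_simps)
  ultimately show ?thesis by simp
qed

text \<open>The 2 bounds a difference by sup bounds, one cardinality counts the jumps, and
  \<open>1 + card\<close> bounds the size of the hull per site of the window.\<close>

definition growth_rate :: "(int ^ 'd::finite) pmf \<Rightarrow> real" where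
  "growth_rate p = 2 * real (card (set_pmf p)) * (1 + real (card (set_pmf p)))"

lemma growth_rate_pos: "finite (set_pmf p) \<Longrightarrow> growth_rate p > 0"
  unfolding growth_rate_def by (simp add: card_gt_0_iff set_pmf_not_empty)

lemma card_generator_hull:
  assumes "finite (set_pmf p)" "finite \<Lambda>"
  shows "card (generator_hull p \<Lambda>) \<le> card \<Lambda> * (1 + card (set_pmf p))"
proof -
  have "card (\<Union>k\<in>set_pmf p. (\<lambda>y. y - k) ` \<Lambda>) \<le> (\<Sum>k\<in>set_pmf p. card ((\<lambda>y. y - k) ` \<Lambda>))"
    by (rule card_UN_le[OF assms(1)])
  also have "\<dots> \<le> (\<Sum>k\<in>set_pmf p. card \<Lambda>)"
    by (intro sum_mono card_image_le assms)
  finally show ?thesis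
    unfolding generator_hull_def using card_Un_le[of \<Lambda> "\<Union>k\<in>set_pmf p. (\<lambda>y. y - k) ` \<Lambda>"]
    by (simp add: algebra_simps)
qed

lemma local_sum_tagged_generator:
  assumes S: "finite (set_pmf p)" and "local_sum n a f"
  shows "local_sum (n + 2) (growth_rate p * (real n + 1) * a) (tagged_generator p f)"
  using assms(2)
proof (induction rule: local_sum.induct)
  case (single \<Lambda> n f a)
  let ?A = "generator_hull p \<Lambda>" and ?S = "set_pmf p"
  have fin: "finite ?A" using S single by (intro finite_generator_hull)
  have a: "0 \<le> a" using single(4)[of undefined] by linarith
  have ex: "local_sum (n + 2) (2 * a) (exchange_term p k u f)" for k u
    by (rule local_sum_exchange_term) (use single in auto)
  have ju: "local_sum (n + 2) (2 * a) (jump_term p k f)" for k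
    by (rule local_sum_jump_term) (use single in auto)
  have "local_sum (n + 2) (real (card ?S) * (real (card ?A) * (2 * a)) + real (card ?S) * (2 * a))
     (\<lambda>z. (\<Sum>k\<in>?S. \<Sum>u\<in>?A. exchange_term p k u f z) + (\<Sum>k\<in>?S. jump_term p k f z))"
    by (intro local_sum.add local_sum_sum S fin ex ju)
  moreover have "(\<lambda>z. (\<Sum>k\<in>?S. \<Sum>u\<in>?A. exchange_term p k u f z) + (\<Sum>k\<in>?S. jump_term p k f z)) =
      tagged_generator p f"
    using tagged_generator_eq[OF S single(3) fin order_refl] by (simp add: fun_eq_iff)
  moreover have "real (card ?S) * (real (card ?A) * (2 * a)) + real (card ?S) * (2 * a)
     \<le> growth_rate p * (real n + 1) * a"
  proof -
    have "card ?A \<le> n * (1 + card ?S)"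
      using card_generator_hull[OF S single(1)] single(2) by (meson le_trans mult_le_mono1)
    then have A: "real (card ?A) \<le> real n * (1 + real (card ?S))"
      by (metis of_nat_1 of_nat_add of_nat_le_iff of_nat_mult)
    have "real (card ?S) * (real (card ?A) * (2 * a)) + real (card ?S) * (2 * a) =
        2 * real (card ?S) * a * (real (card ?A) + 1)" by (simp add: algebra_simps)
    also have "\<dots> \<le> 2 * real (card ?S) * a * ((real n + 1) * (1 + real (card ?S)))"
      using A a by (intro mult_left_mono) (auto simp: algebra_simps)
    finally show ?thesis by (simp add: growth_rate_def algebra_simps)
  qed
  ultimately show ?case by (simp add: local_sum_mono)
next
  case (add n a f b g)
  have "tagged_generator p (\<lambda>z. f z + g z) = (\<lambda>z. tagged_generator p f z + tagged_generator p g z)"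
    by (rule ext, rule tagged_generator_add[OF S]) (use add in \<open>auto intro: local_sum_moving_local\<close>)
  then show ?case
    using local_sum.add[OF add.IH] by (simp add: algebra_simps)
qed

text \<open>The windows grow by two sites per step, which produces the factors \<open>n + 1\<close>,
  \<open>n + 3\<close>, and so on. They are at most twice \<open>n + 1\<close>,
  \<open>n + 2\<close>, and so on; hence the doubled \<open>growth_rate\<close> and the quotient of
  factorials.\<close>

lemma local_sum_generator_power:
  assumes S: "finite (set_pmf p)" and f: "local_sum n a f"
  shows "local_sum (n + 2 * k) (a * (2 * growth_rate p) ^ k * fact (n + k) / fact n) ((tagged_generator p ^^ k) f)"
proof (induction k)
  case 0
  then show ?case using f by simp
next
  case (Suc k)
  let ?b = "\<lambda>k. a * (2 * growth_rate p) ^ k * fact (n + k) / fact n"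
  have a: "0 \<le> a" using local_sum_bound[OF f, of undefined] by linarith
  have C: "0 \<le> growth_rate p" using growth_rate_pos[OF S] by simp
  have "growth_rate p * (real (n + 2 * k) + 1) * ?b k \<le> growth_rate p * (2 * real (n + k + 1)) * ?b k"
    using a C by (intro mult_right_mono mult_left_mono) auto
  also have "\<dots> = ?b (Suc k)" by (simp add: field_simps)
  finally show ?case
    using local_sum_mono[OF local_sum_tagged_generator[OF S Suc]] by simp
qed

lemma moving_local_tagged_generator:
  assumes S: "finite (set_pmf p)" and f: "f \<in> moving_local"
  shows "tagged_generator p f \<in> moving_local"
proof -
  obtain a \<Lambda> where *: "\<And>z. \<bar>f z\<bar> \<le> a" "finite \<Lambda>" "depends_near \<Lambda> f"
    using f unfolding moving_local_def by blast
  have "local_sum (card \<Lambda>) a f" by (rule local_sum.single) (use * in auto)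
  from local_sum_moving_local[OF local_sum_tagged_generator[OF S this]] show ?thesis .
qed

lemma moving_local_generator_power:
  "finite (set_pmf p) \<Longrightarrow> f \<in> moving_local \<Longrightarrow> (tagged_generator p ^^ k) f \<in> moving_local"
  by (induction k) (auto intro: moving_local_tagged_generator)

lemma environment_fun_generator_power:
  "finite (set_pmf p) \<Longrightarrow> f \<in> moving_local \<Longrightarrow> environment_fun f \<Longrightarrow>
    environment_fun ((tagged_generator p ^^ k) f)"
  by (induction k) (auto intro: environment_fun_tagged_generator moving_local_generator_power)

text \<open>The radius of convergence of the exponential series does not depend on \<open>f\<close>, which is what
  allows the short-time expansion to be iterated.\<close>

lemma generator_power_bound:
  assumes S: "finite (set_pmf p)" and f: "f \<in> moving_local"
  shows "\<exists>K\<ge>0. \<forall>k z. \<bar>(tagged_generator p ^^ k) f z\<bar> \<le> K * (4 * growth_rate p) ^ k * fact k"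
proof -
  obtain a \<Lambda> where *: "\<And>z. \<bar>f z\<bar> \<le> a" "finite \<Lambda>" "depends_near \<Lambda> f"
    using f unfolding moving_local_def by blast
  define n where "n = card \<Lambda>"
  have ls: "local_sum n a f" unfolding n_def by (rule local_sum.single) (use * in auto)
  have a: "0 \<le> a" using *(1)[of undefined] by linarith
  have C: "0 \<le> growth_rate p" using growth_rate_pos[OF S] by simp
  show ?thesis
  proof (intro exI[of _ "a * 2 ^ n"] conjI allI)
    show "0 \<le> a * 2 ^ n" using a by simp
    fix k z
    have "fact (n + k) / (fact n * fact k) = real ((n + k) choose k)"
      by (subst binomial_fact) (auto simp: mult.commute)
    also have "\<dots> \<le> 2 ^ (n + k)"
      using binomial_le_pow2[of "n + k" k] by (metis of_nat_le_iff of_nat_numeral of_nat_power)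
    finally have b: "fact (n + k) / fact n \<le> 2 ^ (n + k) * (fact k :: real)"
      by (simp add: field_simps)
    have "\<bar>(tagged_generator p ^^ k) f z\<bar> \<le> a * (2 * growth_rate p) ^ k * (fact (n + k) / fact n)"
      using local_sum_bound[OF local_sum_generator_power[OF S ls, of k], of z] by simp
    also have "\<dots> \<le> a * (2 * growth_rate p) ^ k * (2 ^ (n + k) * fact k)"
      using a C by (intro mult_left_mono b) auto
    also have "\<dots> = a * 2 ^ n * (4 * growth_rate p) ^ k * fact k"
    proof -
      have "(2 * (2 * growth_rate p)) ^ k = 2 ^ k * (2 * growth_rate p) ^ k"
        by (rule power_mult_distrib)
      then have "(4 * growth_rate p) ^ k = 2 ^ k * (2 * growth_rate p) ^ k"
        by (simp only: mult.assoc[symmetric]) simp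
      then show ?thesis by (simp only: power_add) (simp only: ac_simps)
    qed
    finally show "\<bar>(tagged_generator p ^^ k) f z\<bar> \<le> a * 2 ^ n * (4 * growth_rate p) ^ k * fact k" .
  qed
qed

section \<open>The semigroup\<close>

text \<open>Splitting on the occupation of one site leaves two functions of one site fewer.\<close>

lemma local_function_measurable:
  fixes f :: "'d::finite config \<Rightarrow> real"
  assumes "finite \<Lambda>" "\<And>\<eta> \<zeta>. (\<And>y. y \<in> \<Lambda> \<Longrightarrow> \<eta> y = \<zeta> y) \<Longrightarrow> f \<eta> = f \<zeta>"
  shows "f \<in> borel_measurable config_space"
  using assms
proof (induction \<Lambda> arbitrary: f rule: finite_induct)
  case empty
  then have "f = (\<lambda>_. f undefined)" by auto
  then show ?case by (metis measurable_const UNIV_I space_borel)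
next
  case (insert a \<Lambda>)
  have [measurable]: "(\<lambda>\<eta>. f (\<eta>(a := b))) \<in> borel_measurable config_space" for b
    by (rule insert.IH) (auto intro!: insert.prems)
  have [measurable]: "Measurable.pred config_space (\<lambda>\<eta>. \<eta> a)"
    unfolding config_space_def by measurable
  have "f = (\<lambda>\<eta>. if \<eta> a then f (\<eta>(a := True)) else f (\<eta>(a := False)))"
    by (intro ext) (metis (full_types) fun_upd_triv)
  also have "\<dots> \<in> borel_measurable config_space" by measurable
  finally show ?case .
qed

lemma space_config_space [simp]: "space config_space = UNIV"
  by (simp add: config_space_def space_PiM)

lemma space_tagged_space [simp]: "space tagged_space = UNIV"
  by (simp add: tagged_space_def space_pair_measure)

lemma tagged_space_measurable:
  fixes f :: "'d::finite tagged_state \<Rightarrow> 'b"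
  assumes "\<And>x. (\<lambda>\<eta>. f (x, \<eta>)) \<in> measurable config_space N"
  shows "f \<in> measurable tagged_space N"
  unfolding tagged_space_def by (rule measurable_pair_measure_countable1) (use assms in auto)

definition bounded_fun :: "('d::finite tagged_state \<Rightarrow> real) set" where
  "bounded_fun = {f \<in> borel_measurable tagged_space. \<exists>a. \<forall>z. \<bar>f z\<bar> \<le> a}"

lemma bounded_funI:
  "f \<in> borel_measurable tagged_space \<Longrightarrow> (\<And>z. \<bar>f z\<bar> \<le> a) \<Longrightarrow> f \<in> bounded_fun"
  unfolding bounded_fun_def by auto

lemma bounded_fun_measurable [measurable_dest]: "f \<in> bounded_fun \<Longrightarrow> f \<in> borel_measurable tagged_space"
  unfolding bounded_fun_def by auto

lemma bounded_funE:
  assumes "f \<in> bounded_fun"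
  obtains a where "0 \<le> a" "\<And>z. \<bar>f z\<bar> \<le> a"
proof -
  obtain a where "\<And>z. \<bar>f z\<bar> \<le> a" using assms unfolding bounded_fun_def by blast
  then show ?thesis using that[of a] by (meson abs_ge_zero order_trans)
qed

lemma bounded_fun_add:
  assumes "f \<in> bounded_fun" "g \<in> bounded_fun"
  shows "(\<lambda>z. f z + g z) \<in> bounded_fun"
proof -
  note [measurable] = assms[THEN bounded_fun_measurable]
  obtain a where a: "\<And>z. \<bar>f z\<bar> \<le> a" using bounded_funE[OF assms(1)] by blast
  obtain b where b: "\<And>z. \<bar>g z\<bar> \<le> b" using bounded_funE[OF assms(2)] by blast
  have "\<bar>f z + g z\<bar> \<le> a + b" for z using a[of z] b[of z] by linarith
  then show ?thesis by (rule bounded_funI[rotated]) measurable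
qed

lemma bounded_fun_mult:
  assumes "f \<in> bounded_fun" "g \<in> bounded_fun"
  shows "(\<lambda>z. f z * g z) \<in> bounded_fun"
proof -
  note [measurable] = assms[THEN bounded_fun_measurable]
  obtain a where a: "0 \<le> a" "\<And>z. \<bar>f z\<bar> \<le> a" using bounded_funE[OF assms(1)] by blast
  obtain b where b: "\<And>z. \<bar>g z\<bar> \<le> b" using bounded_funE[OF assms(2)] by blast
  have "\<bar>f z * g z\<bar> \<le> a * b" for z unfolding abs_mult by (intro mult_mono a b) auto
  then show ?thesis by (rule bounded_funI[rotated]) measurable
qed

lemma bounded_fun_const [simp]: "(\<lambda>_. c) \<in> bounded_fun"
  by (rule bounded_funI[of _ "\<bar>c\<bar>"]) auto

lemma bounded_fun_cmult: "f \<in> bounded_fun \<Longrightarrow> (\<lambda>z. c * f z) \<in> bounded_fun"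
  by (intro bounded_fun_mult bounded_fun_const)

lemma bounded_fun_diff: "f \<in> bounded_fun \<Longrightarrow> g \<in> bounded_fun \<Longrightarrow> (\<lambda>z. f z - g z) \<in> bounded_fun"
  using bounded_fun_add[of f "\<lambda>z. (-1) * g z"] bounded_fun_cmult[of g "-1"] by simp

lemma bounded_fun_sum:
  "(\<And>i. i \<in> I \<Longrightarrow> f i \<in> bounded_fun) \<Longrightarrow> (\<lambda>z. \<Sum>i\<in>I. f i z) \<in> bounded_fun"
  by (induction I rule: infinite_finite_induct) (auto intro: bounded_fun_add)

lemma moving_local_bounded_fun:
  fixes f :: "'d::finite tagged_state \<Rightarrow> real"
  assumes "f \<in> moving_local"
  shows "f \<in> bounded_fun"
proof -
  obtain a \<Lambda> where *: "\<And>z. \<bar>f z\<bar> \<le> a" "finite \<Lambda>" "depends_near \<Lambda> f"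
    using assms unfolding moving_local_def by blast
  have "(\<lambda>\<eta>. f (x, \<eta>)) \<in> borel_measurable config_space" for x
  proof (rule local_function_measurable)
    show "finite ((\<lambda>y. x + y) ` \<Lambda>)" using * by simp
    fix \<eta> \<zeta> :: "'d config" assume "\<And>y. y \<in> (\<lambda>y. x + y) ` \<Lambda> \<Longrightarrow> \<eta> y = \<zeta> y"
    then show "f (x, \<eta>) = f (x, \<zeta>)" by (intro depends_nearD[OF *(3)]) auto
  qed
  then show ?thesis using * by (intro bounded_funI tagged_space_measurable)
qed

section \<open>Cutting off in the position\<close>

definition vec_norm1 :: "int ^ 'd::finite \<Rightarrow> real" where
  "vec_norm1 x = (\<Sum>i\<in>UNIV. \<bar>real_of_int (x $ i)\<bar>)"

lemma vec_norm1_nonneg: "0 \<le> vec_norm1 x"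
  by (simp add: vec_norm1_def sum_nonneg)

lemma vec_norm1_triangle: "vec_norm1 (x + y) \<le> vec_norm1 x + vec_norm1 y"
  unfolding vec_norm1_def sum.distrib[symmetric] by (intro sum_mono) simp

lemma vec_norm1_minus: "vec_norm1 (- x) = vec_norm1 x"
  by (simp add: vec_norm1_def)

lemma vec_nth_le_vec_norm1: "\<bar>real_of_int (x $ i)\<bar> \<le> vec_norm1 x"
  unfolding vec_norm1_def by (rule member_le_sum) auto

lemma finite_vec_norm1_less: "finite {x :: int ^ 'd::finite. vec_norm1 x < real n}"
proof (rule finite_subset)
  let ?P = "PiE UNIV (\<lambda>_ :: 'd. {- int n..int n})"
  show "{x :: int ^ 'd. vec_norm1 x < real n} \<subseteq> vec_lambda ` ?P"
  proof safe
    fix x :: "int ^ 'd" assume "vec_norm1 x < real n"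
    then have "\<bar>real_of_int (x $ i)\<bar> \<le> real n" for i
      using vec_nth_le_vec_norm1[of x i] by linarith
    then have "vec_nth x \<in> ?P" by (auto simp: abs_le_iff) (metis of_int_le_iff of_int_minus of_int_of_nat_eq minus_le_iff)+
    then show "x \<in> vec_lambda ` ?P" by (metis image_eqI vec_nth_inverse)
  qed
  show "finite (vec_lambda ` ?P)" by (intro finite_imageI finite_PiE) auto
qed

text \<open>A tent of slope \<open>1 / Suc n\<close>, not an indicator: a jump of bounded length
  then changes it by order 1/n only, so that cutting off nearly commutes with the generator.\<close>

definition cutoff :: "nat \<Rightarrow> int ^ 'd::finite \<Rightarrow> real" where
  "cutoff n x = max 0 (1 - vec_norm1 x / real (Suc n))"

lemma cutoff_bounds: "0 \<le> cutoff n x" "cutoff n x \<le> 1"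
  using vec_norm1_nonneg[of x] by (auto simp: cutoff_def)

lemma cutoff_lipschitz: "\<bar>cutoff n (x + k) - cutoff n x\<bar> \<le> vec_norm1 k / real (Suc n)"
proof -
  have "\<bar>vec_norm1 (x + k) - vec_norm1 x\<bar> \<le> vec_norm1 k"
    using vec_norm1_triangle[of x k] vec_norm1_triangle[of "x + k" "- k"] by (simp add: vec_norm1_minus)
  then have "\<bar>vec_norm1 (x + k) / real (Suc n) - vec_norm1 x / real (Suc n)\<bar> \<le> vec_norm1 k / real (Suc n)"
    by (simp flip: diff_divide_distrib) (simp add: divide_right_mono)
  then show ?thesis unfolding cutoff_def by linarith
qed

lemma cutoff_tendsto: "(\<lambda>n. cutoff n x) \<longlonglongrightarrow> 1"
proof -
  have "(\<lambda>n. vec_norm1 x / real (Suc n)) \<longlonglongrightarrow> 0"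
    by (rule LIMSEQ_Suc[OF lim_const_over_n])
  from tendsto_max[OF tendsto_const tendsto_diff[OF tendsto_const this], of 0 1]
  show ?thesis by (simp add: cutoff_def)
qed

definition truncate :: "nat \<Rightarrow> ('d::finite tagged_state \<Rightarrow> real) \<Rightarrow> 'd tagged_state \<Rightarrow> real" where
  "truncate n f z = cutoff n (fst z) * f z"

lemma truncate_le: "\<bar>truncate n f z\<bar> \<le> \<bar>f z\<bar>"
  unfolding truncate_def using cutoff_bounds[of n "fst z"]
  by (simp add: abs_mult mult_left_le_one_le)

lemma truncate_moving_local:
  fixes f :: "'d::finite tagged_state \<Rightarrow> real"
  assumes "f \<in> moving_local"
  shows "truncate n f \<in> moving_local"
proof -
  have "(\<lambda>z :: 'd tagged_state. cutoff n (fst z)) \<in> moving_local"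
    by (intro moving_localI[of _ 1 "{}"]) (auto simp: depends_near_def cutoff_bounds abs_of_nonneg)
  from moving_local_mult[OF this assms] show ?thesis
    by (simp add: truncate_def[abs_def])
qed

text \<open>The cutoff confines the position to a finite set, and the union of the windows around
  these positions is a finite set of fixed sites.\<close>

lemma truncate_local:
  fixes f :: "'d::finite tagged_state \<Rightarrow> real"
  assumes "f \<in> moving_local"
  shows "truncate n f \<in> local_functions"
proof -
  obtain a \<Lambda> where *: "\<And>z. \<bar>f z\<bar> \<le> a" "finite \<Lambda>" "depends_near \<Lambda> f"
    using assms unfolding moving_local_def by blast
  define X where "X = {x :: int ^ 'd. vec_norm1 x < real (Suc n)}"
  define \<Delta> where "\<Delta> = (\<Union>x\<in>X. (\<lambda>y. x + y) ` \<Lambda>)"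
  have fin: "finite \<Delta>" unfolding \<Delta>_def X_def by (intro finite_UN_I finite_vec_norm1_less finite_imageI *)
  have "bounded (range (truncate n f))"
    unfolding bounded_iff
    by (intro exI[of _ a]) (auto intro!: order_trans[OF truncate_le *(1)])
  moreover have "truncate n f (x, \<eta>) = truncate n f (x, \<zeta>)" if "\<forall>y\<in>\<Delta>. \<eta> y = \<zeta> y" for x \<eta> \<zeta>
  proof (cases "x \<in> X")
    case True
    then have "f (x, \<eta>) = f (x, \<zeta>)"
      using that by (intro depends_nearD[OF *(3)]) (auto simp: \<Delta>_def)
    then show ?thesis by (simp add: truncate_def)
  next
    case False
    then have "cutoff n x = 0" by (auto simp: X_def cutoff_def field_simps)
    then show ?thesis by (simp add: truncate_def)
  qed
  ultimately show ?thesis using fin unfolding local_functions_def by blast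
qed

text \<open>The cutoff is a function of the position alone, so it commutes with all exchange terms.
  Only the jumps of the tagged particle contribute, each with an increment of the cutoff.\<close>

lemma truncate_generator:
  assumes S: "finite (set_pmf p)" and f: "f \<in> moving_local" "\<And>z. \<bar>f z\<bar> \<le> a"
  shows "\<bar>tagged_generator p (truncate n f) z - truncate n (tagged_generator p f) z\<bar>
    \<le> (\<Sum>k\<in>set_pmf p. vec_norm1 k) * a / real (Suc n)"
proof -
  obtain \<Lambda> where *: "finite \<Lambda>" "depends_near \<Lambda> f"
    using f(1) unfolding moving_local_def by blast
  let ?A = "generator_hull p \<Lambda>"
  have a: "0 \<le> a" using f(2)[of undefined] by linarith
  have d: "depends_near \<Lambda> (truncate n f)" using *(2)
    unfolding depends_near_def by (auto simp: truncate_def)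
  have fin: "finite ?A" using * S by (intro finite_generator_hull) auto
  obtain x \<eta> where z: "z = (x, \<eta>)" by (cases z)
  define F where "F = (\<lambda>k. f (x + k, exchange \<eta> x (x + k)))"
  have ex: "exchange_term p k u (truncate n f) z = cutoff n x * exchange_term p k u f z" for k u
    by (simp add: z exchange_term_def truncate_def algebra_simps)
  have ju: "jump_term p k (truncate n f) z - cutoff n x * jump_term p k f z =
      pmf p k * (1 - of_bool (\<eta> (x + k))) * ((cutoff n (x + k) - cutoff n x) * F k)" for k
    by (simp add: z jump_term_def truncate_def F_def algebra_simps)
  have "tagged_generator p (truncate n f) z - truncate n (tagged_generator p f) z =
      (\<Sum>k\<in>set_pmf p. jump_term p k (truncate n f) z - cutoff n x * jump_term p k f z)"
    unfolding tagged_generator_eq[OF S d fin order_refl] truncate_def[of _ "tagged_generator p f"]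
      tagged_generator_eq[OF S *(2) fin order_refl]
    by (simp add: ex[unfolded z] z sum_distrib_left sum_subtractf algebra_simps)
  also have "\<bar>\<dots>\<bar> \<le> (\<Sum>k\<in>set_pmf p. vec_norm1 k / real (Suc n) * a)"
  proof (rule order_trans[OF sum_abs sum_mono])
    fix k
    have "\<bar>(cutoff n (x + k) - cutoff n x) * F k\<bar> \<le> vec_norm1 k / real (Suc n) * a"
      unfolding abs_mult F_def by (intro mult_mono cutoff_lipschitz f) (auto simp: vec_norm1_nonneg)
    moreover have "\<bar>pmf p k * (1 - of_bool (\<eta> (x + k)))\<bar> \<le> 1"
      by (auto simp: of_bool_def pmf_le_1)
    ultimately show "\<bar>jump_term p k (truncate n f) z - cutoff n x * jump_term p k f z\<bar> \<le> vec_norm1 k / real (Suc n) * a"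
      unfolding ju abs_mult[of "pmf p k * (1 - of_bool (\<eta> (x + k)))"]
      using mult_mono[of _ 1] by fastforce
  qed
  also have "\<dots> = (\<Sum>k\<in>set_pmf p. vec_norm1 k) * a / real (Suc n)"
    by (simp add: sum_distrib_right sum_divide_distrib)
  finally show ?thesis .
qed

section \<open>The semigroup on bounded measurable functions\<close>

locale tagged_semigroup =
  fixes p :: "(int ^ 'd::finite) pmf" and P :: "real \<Rightarrow> 'd tagged_state \<Rightarrow> 'd tagged_state measure"
  assumes finite_range: "finite (set_pmf p)"
    and semigroup: "markov_semigroup tagged_space P"
    and generator: "has_generator_on tagged_space P local_functions (tagged_generator p)"
begin

definition evolve :: "real \<Rightarrow> ('d tagged_state \<Rightarrow> real) \<Rightarrow> 'd tagged_state \<Rightarrow> real" where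
  "evolve t f z = (\<integral>z'. f z' \<partial>P t z)"

lemma kernel_measurable: "0 \<le> t \<Longrightarrow> P t \<in> tagged_space \<rightarrow>\<^sub>M subprob_algebra tagged_space"
  using semigroup unfolding markov_semigroup_def by (blast intro: measurable_prob_algebraD)

lemma prob_space_kernel: "0 \<le> t \<Longrightarrow> prob_space (P t z)"
proof -
  assume "0 \<le> t"
  then have "P t \<in> tagged_space \<rightarrow>\<^sub>M prob_algebra tagged_space"
    using semigroup unfolding markov_semigroup_def by blast
  from measurable_space[OF this, of z] show ?thesis by (simp add: space_prob_algebra)
qed

lemma sets_kernel_eq: "0 \<le> t \<Longrightarrow> sets (P t z) = sets tagged_space"
  using sets_kernel[OF kernel_measurable, of t z] by simp

lemma kernel_fun_measurable:
  "0 \<le> t \<Longrightarrow> f \<in> measurable tagged_space N \<Longrightarrow> f \<in> measurable (P t z) N"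
  by (simp add: measurable_cong_sets[OF sets_kernel_eq refl])

lemma integrable_kernel:
  assumes "0 \<le> t" "f \<in> bounded_fun"
  shows "integrable (P t z) f"
proof -
  interpret prob_space "P t z" using assms(1) by (rule prob_space_kernel)
  obtain a where "\<And>z. \<bar>f z\<bar> \<le> a" using bounded_funE[OF assms(2)] by blast
  then show ?thesis
    using assms by (intro integrable_const_bound[of _ a] kernel_fun_measurable) (auto intro: bounded_fun_measurable)
qed

lemma evolve_add: "0 \<le> t \<Longrightarrow> f \<in> bounded_fun \<Longrightarrow> g \<in> bounded_fun \<Longrightarrow>
    evolve t (\<lambda>z. f z + g z) z = evolve t f z + evolve t g z"
  unfolding evolve_def by (intro Bochner_Integration.integral_add integrable_kernel)

lemma evolve_diff: "0 \<le> t \<Longrightarrow> f \<in> bounded_fun \<Longrightarrow> g \<in> bounded_fun \<Longrightarrow>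
    evolve t (\<lambda>z. f z - g z) z = evolve t f z - evolve t g z"
  unfolding evolve_def by (intro Bochner_Integration.integral_diff integrable_kernel)

lemma evolve_cmult: "evolve t (\<lambda>z. c * f z) z = c * evolve t f z"
  unfolding evolve_def by simp

lemma evolve_const: "0 \<le> t \<Longrightarrow> evolve t (\<lambda>_. c) z = c"
  unfolding evolve_def using prob_space.prob_space[OF prob_space_kernel] by simp

lemma evolve_mono: "0 \<le> t \<Longrightarrow> f \<in> bounded_fun \<Longrightarrow> g \<in> bounded_fun \<Longrightarrow> (\<And>z. f z \<le> g z) \<Longrightarrow>
    evolve t f z \<le> evolve t g z"
  unfolding evolve_def by (intro integral_mono integrable_kernel)

lemma evolve_bound:
  assumes "0 \<le> t" "f \<in> bounded_fun" "\<And>z. \<bar>f z\<bar> \<le> a"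
  shows "\<bar>evolve t f z\<bar> \<le> a"
proof -
  have "evolve t f z \<le> a" "- a \<le> evolve t f z"
    using evolve_mono[OF assms(1,2) bounded_fun_const, of a] evolve_mono[OF assms(1) bounded_fun_const assms(2), of "- a"]
      assms(3) by (auto simp: evolve_const[OF assms(1)] abs_le_iff minus_le_iff)
  then show ?thesis by (simp add: abs_le_iff minus_le_iff)
qed

lemma evolve_sum: "0 \<le> t \<Longrightarrow> (\<And>i. i \<in> I \<Longrightarrow> f i \<in> bounded_fun) \<Longrightarrow>
    evolve t (\<lambda>z. \<Sum>i\<in>I. f i z) z = (\<Sum>i\<in>I. evolve t (f i) z)"
  unfolding evolve_def by (intro Bochner_Integration.integral_sum integrable_kernel)

lemma evolve_bounded_fun:
  assumes t: "0 \<le> t" and f: "f \<in> bounded_fun"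
  shows "evolve t f \<in> bounded_fun"
proof -
  obtain a where a: "\<And>z. \<bar>f z\<bar> \<le> a" using bounded_funE[OF f] by blast
  have "(\<lambda>z. integral\<^sup>L (P t z) f) \<in> borel_measurable tagged_space"
    by (rule measurable_compose[OF kernel_measurable[OF t] integral_measurable_subprob_algebra])
      (use f in \<open>rule bounded_fun_measurable\<close>)
  then show ?thesis
    by (intro bounded_funI[of _ a]) (auto simp: evolve_def[abs_def] intro!: evolve_bound[unfolded evolve_def] t f a)
qed

lemma evolve_zero: "f \<in> bounded_fun \<Longrightarrow> evolve 0 f z = f z"
proof -
  assume "f \<in> bounded_fun"
  then have "integral\<^sup>L (return tagged_space z) f = f z"
    by (intro integral_return bounded_fun_measurable) simp
  moreover have "P 0 z = return tagged_space z"
    using semigroup unfolding markov_semigroup_def by (metis UNIV_I space_tagged_space)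
  ultimately show ?thesis by (simp add: evolve_def)
qed

lemma kernel_semigroup: "0 \<le> s \<Longrightarrow> 0 \<le> t \<Longrightarrow> P (s + t) z = bind (P s z) (P t)"
  using semigroup unfolding markov_semigroup_def by (metis UNIV_I space_tagged_space)

lemma evolve_semigroup:
  assumes "0 \<le> s" "0 \<le> t" "f \<in> bounded_fun"
  shows "evolve (s + t) f z = evolve s (evolve t f) z"
proof -
  interpret prob_space "P s z" using assms(1) by (rule prob_space_kernel)
  obtain a where a: "\<And>z. \<bar>f z\<bar> \<le> a" using bounded_funE[OF assms(3)] by blast
  have "integral\<^sup>L (bind (P s z) (P t)) f = (\<integral>z'. integral\<^sup>L (P t z') f \<partial>P s z)"
  proof (rule integral_bind)
    show "f \<in> borel_measurable tagged_space" using assms(3) by (rule bounded_fun_measurable)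
    show "P t \<in> P s z \<rightarrow>\<^sub>M subprob_algebra tagged_space"
      by (rule kernel_fun_measurable[OF assms(1) kernel_measurable[OF assms(2)]])
    show "finite_measure (P s z)" by unfold_locales
    show "AE z' in P s z. emeasure (P t z') (space (P t z')) \<le> ennreal 1"
      using prob_space.emeasure_space_1[OF prob_space_kernel[OF assms(2)]] by simp
  qed (rule a)
  then show ?thesis by (simp add: evolve_def kernel_semigroup assms)
qed

text \<open>A mean value inequality for the map from \<open>t\<close> to
  \<open>evolve t f z\<close>, proved by an Euler scheme with no regularity in time assumed. The
  one-step remainder is small uniformly in the state, so evolving it to a later time does not
  enlarge it.\<close>

lemma evolve_increment:
  assumes f: "f \<in> bounded_fun" and g: "g \<in> bounded_fun"
    and deriv: "\<And>\<epsilon>. 0 < \<epsilon> \<Longrightarrow> \<exists>\<delta>>0. \<forall>h z. 0 < h \<longrightarrow> h < \<delta> \<longrightarrow> \<bar>evolve h f z - f z - h * g z\<bar> \<le> \<epsilon> * h"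
    and t: "0 \<le> t" and c: "\<And>s. 0 \<le> s \<Longrightarrow> s \<le> t \<Longrightarrow> \<bar>evolve s g z - b\<bar> \<le> c"
  shows "\<bar>evolve t f z - f z - t * b\<bar> \<le> t * c"
proof (cases "t = 0")
  case True
  then show ?thesis using f by (simp add: evolve_zero)
next
  case False
  with t have t0: "0 < t" by simp
  show ?thesis
  proof (rule field_le_epsilon)
    fix e :: real assume e: "0 < e"
    \<comment> \<open>The one-step errors \<open>\<epsilon> * h\<close> add up to
      \<open>\<epsilon> * t\<close>, which is \<open>e\<close>.\<close>
    define \<epsilon> where "\<epsilon> = e / t"
    have \<epsilon>: "0 < \<epsilon>" using e t0 by (simp add: \<epsilon>_def)
    obtain \<delta> where \<delta>: "0 < \<delta>" "\<And>h z. 0 < h \<Longrightarrow> h < \<delta> \<Longrightarrow> \<bar>evolve h f z - f z - h * g z\<bar> \<le> \<epsilon> * h"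
      using deriv[OF \<epsilon>] by blast
    obtain m where m: "t / \<delta> < real m" using reals_Archimedean2 by blast
    define n where "n = Suc m"
    define h where "h = t / real n"
    have n: "0 < real n" "t / \<delta> < real n" using m by (auto simp: n_def)
    have h: "0 < h" "h < \<delta>" "real n * h = t"
      using n t0 \<delta>(1) by (auto simp: h_def field_simps)
    have "\<bar>evolve (real j * h) f z - f z - real j * h * b\<bar> \<le> real j * h * (c + \<epsilon>)" if "j \<le> n" for j
      using that
    proof (induction j)
      case 0
      then show ?case using f by (simp add: evolve_zero)
    next
      case (Suc j)
      let ?r = "\<lambda>z. evolve h f z - f z - h * g z"
      have j0: "0 \<le> real j * h" using h by simp
      have jt: "real j * h \<le> t"
        using Suc.prems h by (metis Suc_leD less_eq_real_def mult_right_mono of_nat_le_iff)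
      have hf: "evolve h f \<in> bounded_fun" using h f by (intro evolve_bounded_fun) auto
      have r: "?r \<in> bounded_fun" by (intro bounded_fun_diff bounded_fun_cmult hf f g)
      have "evolve (real j * h) ?r z = evolve (real j * h) (evolve h f) z - evolve (real j * h) f z - h * evolve (real j * h) g z"
        using j0 by (simp add: evolve_diff hf f g bounded_fun_diff bounded_fun_cmult evolve_cmult)
      also have "evolve (real j * h) (evolve h f) z = evolve (real (Suc j) * h) f z"
        using evolve_semigroup[of "real j * h" h f z] h f j0 by (simp add: algebra_simps)
      finally have 1: "evolve (real (Suc j) * h) f z = evolve (real j * h) f z + h * evolve (real j * h) g z + evolve (real j * h) ?r z"
        by simp
      have 2: "\<bar>evolve (real j * h) ?r z\<bar> \<le> \<epsilon> * h"
        by (rule evolve_bound[OF j0 r]) (use \<delta>(2) h in auto)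
      have 3: "\<bar>evolve (real j * h) g z - b\<bar> \<le> c" by (rule c[OF j0 jt])
      have 4: "\<bar>h * evolve (real j * h) g z - h * b\<bar> \<le> h * c"
        using mult_left_mono[OF 3, of h] h by (simp add: abs_mult right_diff_distrib[symmetric])
      have "real (Suc j) * h * b = real j * h * b + h * b"
        "real (Suc j) * h * (c + \<epsilon>) = real j * h * (c + \<epsilon>) + h * c + \<epsilon> * h" by (simp_all add: algebra_simps)
      then show ?case using 1 2 4 Suc.IH Suc.prems by linarith
    qed
    from this[of n] h have "\<bar>evolve t f z - f z - t * b\<bar> \<le> t * (c + \<epsilon>)" by simp
    also have "\<dots> = t * c + e" using t0 by (simp add: \<epsilon>_def algebra_simps)
    finally show "\<bar>evolve t f z - f z - t * b\<bar> \<le> t * c + e" .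
  qed
qed

end

lemma DERIV_quadratic:
  fixes F :: "real \<Rightarrow> real"
  assumes "0 < \<delta>" "\<And>y. \<bar>y - x\<bar> < \<delta> \<Longrightarrow> \<bar>F y - F x - (y - x) * D\<bar> \<le> C * (y - x)\<^sup>2"
  shows "DERIV F x :> D"
proof -
  have "((\<lambda>y. (F y - F x) / (y - x) - D) \<longlongrightarrow> 0) (at x)"
  proof (rule Lim_null_comparison)
    have "\<bar>(F y - F x) / (y - x) - D\<bar> \<le> C * \<bar>y - x\<bar>" if y: "y \<noteq> x" "dist y x < \<delta>" for y
    proof -
      have eq: "(F y - F x) / (y - x) - D = (F y - F x - (y - x) * D) / (y - x)"
        using y by (simp add: field_simps)
      have "\<bar>F y - F x - (y - x) * D\<bar> \<le> C * (y - x)\<^sup>2"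
        by (rule assms(2)) (use y in \<open>simp add: dist_real_def\<close>)
      also have "\<dots> = C * \<bar>y - x\<bar> * \<bar>y - x\<bar>"
        by (subst power2_abs[symmetric]) (simp add: power2_eq_square)
      finally show ?thesis using y by (simp add: eq abs_divide pos_divide_le_eq)
    qed
    then show "\<forall>\<^sub>F y in at x. norm ((F y - F x) / (y - x) - D) \<le> C * \<bar>y - x\<bar>"
      using assms(1) by (auto simp: eventually_at intro!: exI[of _ \<delta>])
    have "((\<lambda>y. C * \<bar>y - x\<bar>) \<longlongrightarrow> C * \<bar>x - x\<bar>) (at x)" by (intro tendsto_intros)
    then show "((\<lambda>y. C * \<bar>y - x\<bar>) \<longlongrightarrow> 0) (at x)" by simp
  qed
  then show ?thesis unfolding has_field_derivative_iff by (rule LIM_zero_cancel)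
qed

lemma DERIV_power_fact: "DERIV (\<lambda>t :: real. t ^ Suc n / fact (Suc n)) t :> t ^ n / fact n"
proof -
  have "DERIV (\<lambda>t :: real. t ^ Suc n / fact (Suc n)) t :> real (Suc n) * t ^ n / fact (Suc n)"
    using DERIV_cdivide[OF DERIV_pow[of "Suc n" t], of "fact (Suc n)"] by simp
  moreover have "real (Suc n) * t ^ n / fact (Suc n) = t ^ n / fact n"
    by (simp only: fact_Suc of_nat_mult mult_divide_mult_cancel_left_if) simp
  ultimately show ?thesis by metis
qed

lemma truncate_tendsto: "(\<lambda>n. truncate n f z) \<longlonglongrightarrow> f z"
  unfolding truncate_def using tendsto_mult[OF cutoff_tendsto tendsto_const] by simp

lemma lim_const_over_Suc: "(\<lambda>n. c / real (Suc n)) \<longlonglongrightarrow> 0"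
  by (rule LIMSEQ_Suc[OF lim_const_over_n])

section \<open>Short-time expansion near the tagged particle\<close>

context tagged_semigroup
begin

abbreviation "L \<equiv> tagged_generator p"

lemmas L_moving_local = moving_local_tagged_generator[OF finite_range]
lemmas Lpow_moving_local = moving_local_generator_power[OF finite_range]
lemmas L_environment_fun = environment_fun_tagged_generator[OF finite_range]

lemma local_function_derivative:
  assumes "f \<in> local_functions" "0 < \<epsilon>"
  shows "\<exists>\<delta>>0. \<forall>h z. 0 < h \<longrightarrow> h < \<delta> \<longrightarrow> \<bar>evolve h f z - f z - h * L f z\<bar> \<le> \<epsilon> * h"
proof -
  have "uniform_limit UNIV (\<lambda>t z. (evolve t f z - f z) / t) (L f) (at_right 0)"
    using generator assms(1) unfolding has_generator_on_def evolve_def by auto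
  from uniform_limitD[OF this assms(2)] obtain \<delta> where \<delta>: "0 < \<delta>"
    "\<And>h z. 0 < h \<Longrightarrow> h < \<delta> \<Longrightarrow> dist ((evolve h f z - f z) / h) (L f z) < \<epsilon>"
    unfolding eventually_at_right_field by auto
  have "\<bar>evolve h f z - f z - h * L f z\<bar> \<le> \<epsilon> * h" if h: "0 < h" "h < \<delta>" for h z
  proof -
    have "evolve h f z - f z - h * L f z = ((evolve h f z - f z) / h - L f z) * h"
      using h by (simp add: field_simps)
    then have "\<bar>evolve h f z - f z - h * L f z\<bar> = \<bar>(evolve h f z - f z) / h - L f z\<bar> * h"
      using h by (simp only: abs_mult abs_of_pos)
    also have "\<dots> \<le> \<epsilon> * h"
      using \<delta>(2)[OF h, of z] h by (intro mult_right_mono) (auto simp: dist_real_def)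
    finally show ?thesis .
  qed
  then show ?thesis using \<delta>(1) by blast
qed

lemma evolve_truncate_tendsto:
  assumes t: "0 \<le> t" and f: "f \<in> moving_local"
  shows "(\<lambda>n. evolve t (truncate n f) z) \<longlonglongrightarrow> evolve t f z"
proof -
  obtain a where a: "\<And>z. \<bar>f z\<bar> \<le> a" using bounded_funE[OF moving_local_bounded_fun[OF f]] by blast
  show ?thesis
    unfolding evolve_def
  proof (rule integral_dominated_convergence[where w = "\<lambda>_. a"])
  show "f \<in> borel_measurable (P t z)" "truncate n f \<in> borel_measurable (P t z)" for n
    using f by (auto intro!: kernel_fun_measurable[OF t] bounded_fun_measurable moving_local_bounded_fun truncate_moving_local)
  show "integrable (P t z) (\<lambda>_. a)" by (intro integrable_kernel t bounded_fun_const)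
  show "AE x in P t z. norm (truncate n f x) \<le> a" for n
    unfolding real_norm_def by (intro AE_I2 order_trans[OF truncate_le a])
  qed (simp add: truncate_tendsto)
qed

definition jump_size :: real where "jump_size = (\<Sum>k\<in>set_pmf p. vec_norm1 k)"

lemma truncate_generator_bound:
  "f \<in> moving_local \<Longrightarrow> (\<And>z. \<bar>f z\<bar> \<le> a) \<Longrightarrow>
    \<bar>L (truncate n f) z - truncate n (L f) z\<bar> \<le> jump_size * a / real (Suc n)"
  unfolding jump_size_def by (rule truncate_generator[OF finite_range])

lemma evolve_truncate_lipschitz:
  assumes t: "0 \<le> t" and f: "f \<in> moving_local" and a: "\<And>z. \<bar>f z\<bar> \<le> a" and c: "\<And>z. \<bar>L f z\<bar> \<le> c"
  shows "\<bar>evolve t (truncate n f) z - truncate n f z\<bar> \<le> t * (c + jump_size * a / real (Suc n))"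
proof -
  have g: "truncate n f \<in> moving_local" using f by (rule truncate_moving_local)
  have b: "\<bar>L (truncate n f) z\<bar> \<le> c + jump_size * a / real (Suc n)" for z
    using truncate_generator_bound[OF f a, of n z] truncate_le[of n "L f" z] c[of z] by linarith
  have "\<bar>evolve t (truncate n f) z - truncate n f z - t * 0\<bar> \<le> t * (c + jump_size * a / real (Suc n))"
  proof (rule evolve_increment[where g = "L (truncate n f)"])
    show "\<bar>evolve s (L (truncate n f)) z - 0\<bar> \<le> c + jump_size * a / real (Suc n)" if "0 \<le> s" for s
      using evolve_bound[OF that _ b] g by (simp add: moving_local_bounded_fun L_moving_local)
    show "\<exists>\<delta>>0. \<forall>h z. 0 < h \<longrightarrow> h < \<delta> \<longrightarrow> \<bar>evolve h (truncate n f) z - truncate n f z - h * L (truncate n f) z\<bar> \<le> \<epsilon> * h"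
      if "0 < \<epsilon>" for \<epsilon> by (rule local_function_derivative[OF truncate_local[OF f] that])
  qed (use t f g in \<open>auto intro!: moving_local_bounded_fun L_moving_local\<close>)
  then show ?thesis by simp
qed

text \<open>The truncations belong to the class on which the generator is given. Their bound carries
  a commutator error of order 1/n, which disappears in the limit.\<close>

lemma evolve_lipschitz:
  assumes t: "0 \<le> t" and f: "f \<in> moving_local" and c: "\<And>z. \<bar>L f z\<bar> \<le> c"
  shows "\<bar>evolve t f z - f z\<bar> \<le> t * c"
proof -
  obtain a where a: "\<And>z. \<bar>f z\<bar> \<le> a" using bounded_funE[OF moving_local_bounded_fun[OF f]] by blast
  have "(\<lambda>n. \<bar>evolve t (truncate n f) z - truncate n f z\<bar>) \<longlonglongrightarrow> \<bar>evolve t f z - f z\<bar>"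
    by (intro tendsto_intros evolve_truncate_tendsto truncate_tendsto t f)
  moreover have "(\<lambda>n. t * (c + jump_size * a / real (Suc n))) \<longlonglongrightarrow> t * (c + 0)"
    by (intro tendsto_intros lim_const_over_Suc)
  ultimately have "\<bar>evolve t f z - f z\<bar> \<le> t * (c + 0)"
    by (rule LIMSEQ_le) (use evolve_truncate_lipschitz[OF t f a c] in blast)
  then show ?thesis by simp
qed

text \<open>The slope is frozen at time zero. Along the evolution of the truncated function it
  drifts by the commutator error and by the Lipschitz bound for \<open>L f\<close>, of order
  \<open>t * c\<close>. The quadratic remainder extends the uniform derivative at zero from
  \<open>local_functions\<close> to \<open>moving_local\<close>.\<close>

lemma evolve_quadratic:
  assumes t: "0 \<le> t" and f: "f \<in> moving_local" and c: "\<And>z. \<bar>L (L f) z\<bar> \<le> c"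
  shows "\<bar>evolve t f z - f z - t * L f z\<bar> \<le> t * (t * c)"
proof -
  obtain a where a: "\<And>z. \<bar>f z\<bar> \<le> a" using bounded_funE[OF moving_local_bounded_fun[OF f]] by blast
  obtain b where b: "\<And>z. \<bar>L f z\<bar> \<le> b"
    using bounded_funE[OF moving_local_bounded_fun[OF L_moving_local[OF f]]] by blast
  have c0: "0 \<le> c" using c[of z] by linarith
  have a0: "0 \<le> a" "0 \<le> b" using a[of z] b[of z] by linarith+
  have j0: "0 \<le> jump_size" unfolding jump_size_def by (intro sum_nonneg vec_norm1_nonneg)
  let ?g = "\<lambda>n. truncate n f" and ?K = "\<lambda>n. jump_size * a / real (Suc n) + t * (c + jump_size * b / real (Suc n))"
  have *: "\<bar>evolve t (?g n) z - ?g n z - t * truncate n (L f) z\<bar> \<le> t * ?K n" for n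
  proof (rule evolve_increment[where g = "L (?g n)"])
    have g: "?g n \<in> moving_local" using f by (rule truncate_moving_local)
    show "?g n \<in> bounded_fun" "L (?g n) \<in> bounded_fun" using g by (auto intro: moving_local_bounded_fun L_moving_local)
    show "0 \<le> t" by fact
    show "\<exists>\<delta>>0. \<forall>h z. 0 < h \<longrightarrow> h < \<delta> \<longrightarrow> \<bar>evolve h (?g n) z - ?g n z - h * L (?g n) z\<bar> \<le> \<epsilon> * h"
      if "0 < \<epsilon>" for \<epsilon> by (rule local_function_derivative[OF truncate_local[OF f] that])
    fix s :: real assume s: "0 \<le> s" "s \<le> t"
    have bf: "L (?g n) \<in> bounded_fun" "truncate n (L f) \<in> bounded_fun"
      using f g by (auto intro!: moving_local_bounded_fun L_moving_local truncate_moving_local)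
    have "\<bar>evolve s (\<lambda>z. L (?g n) z - truncate n (L f) z) z\<bar> \<le> jump_size * a / real (Suc n)"
      by (intro evolve_bound s bounded_fun_diff bf truncate_generator_bound f a)
    moreover have "\<bar>evolve s (truncate n (L f)) z - truncate n (L f) z\<bar> \<le> s * (c + jump_size * b / real (Suc n))"
      by (rule evolve_truncate_lipschitz[OF s(1) L_moving_local[OF f] b c])
    moreover have "s * (c + jump_size * b / real (Suc n)) \<le> t * (c + jump_size * b / real (Suc n))"
      using s c0 a0 j0 by (intro mult_right_mono) auto
    ultimately show "\<bar>evolve s (L (?g n)) z - truncate n (L f) z\<bar> \<le> ?K n"
      using evolve_diff[OF s(1) bf, of z] by linarith
  qed
  have "(\<lambda>n. \<bar>evolve t (?g n) z - ?g n z - t * truncate n (L f) z\<bar>) \<longlonglongrightarrow> \<bar>evolve t f z - f z - t * L f z\<bar>"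
    by (intro tendsto_intros evolve_truncate_tendsto truncate_tendsto t f)
  moreover have "(\<lambda>n. t * ?K n) \<longlonglongrightarrow> t * (0 + t * (c + 0))"
    by (intro tendsto_intros lim_const_over_Suc)
  ultimately have "\<bar>evolve t f z - f z - t * L f z\<bar> \<le> t * (0 + t * (c + 0))"
    by (rule LIMSEQ_le) (use * in blast)
  then show ?thesis by simp
qed

lemma moving_local_derivative:
  assumes f: "f \<in> moving_local" and e: "0 < \<epsilon>"
  shows "\<exists>\<delta>>0. \<forall>h z. 0 < h \<longrightarrow> h < \<delta> \<longrightarrow> \<bar>evolve h f z - f z - h * L f z\<bar> \<le> \<epsilon> * h"
proof -
  obtain c where c: "0 \<le> c" "\<And>z. \<bar>L (L f) z\<bar> \<le> c"
    using bounded_funE[OF moving_local_bounded_fun[OF L_moving_local[OF L_moving_local[OF f]]]] by blast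
  show ?thesis
  proof (intro exI[of _ "\<epsilon> / (c + 1)"] conjI allI impI)
    show "0 < \<epsilon> / (c + 1)" using e c by simp
    fix h z assume h: "0 < h" "h < \<epsilon> / (c + 1)"
    have "h * c \<le> h * (c + 1)" using h by simp
    also have "\<dots> \<le> \<epsilon>" using h c by (simp add: field_simps)
    finally have "h * (h * c) \<le> \<epsilon> * h" using h by (simp add: mult.commute)
    with evolve_quadratic[OF _ f c(2), of h z] h
    show "\<bar>evolve h f z - f z - h * L f z\<bar> \<le> \<epsilon> * h" by linarith
  qed
qed

lemma moving_local_increment:
  assumes f: "f \<in> moving_local" and t: "0 \<le> t"
    and c: "\<And>s. 0 \<le> s \<Longrightarrow> s \<le> t \<Longrightarrow> \<bar>evolve s (L f) z - b\<bar> \<le> c"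
  shows "\<bar>evolve t f z - f z - t * b\<bar> \<le> t * c"
  by (rule evolve_increment[OF _ _ moving_local_derivative[OF f] t c])
    (use f in \<open>auto intro: moving_local_bounded_fun L_moving_local\<close>)

lemma evolve_expand:
  assumes f: "f \<in> moving_local" and c: "\<And>z. \<bar>L (L f) z\<bar> \<le> c" and st: "0 \<le> s" "0 \<le> t"
  shows "\<bar>evolve s f z - evolve t f z - (s - t) * evolve t (L f) z\<bar> \<le> (2 * c) * (s - t)\<^sup>2"
proof -
  have c0: "0 \<le> c" using c[of z] by linarith
  have Lf: "L f \<in> moving_local" using f by (rule L_moving_local)
  have bf: "f \<in> bounded_fun" "L f \<in> bounded_fun" using f Lf by (auto intro: moving_local_bounded_fun)
  have fwd: "\<bar>evolve (u + h) f z - evolve u f z - h * evolve u (L f) z\<bar> \<le> h * (h * c)" if "0 \<le> u" "0 \<le> h" for u h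
  proof -
    have bh: "evolve h f \<in> bounded_fun" using that bf by (intro evolve_bounded_fun)
    have "\<bar>evolve u (\<lambda>z. evolve h f z - f z - h * L f z) z\<bar> \<le> h * (h * c)"
      by (rule evolve_bound[OF that(1)]) (auto intro!: bounded_fun_diff bounded_fun_cmult bh bf evolve_quadratic that f c)
    then show ?thesis
      by (simp add: evolve_diff evolve_cmult evolve_semigroup that bf bh bounded_fun_diff bounded_fun_cmult)
  qed
  show ?thesis
  proof (cases "t \<le> s")
    case True
    have "(s - t) * ((s - t) * c) \<le> 2 * c * (s - t)\<^sup>2" using c0 by (simp add: power2_eq_square mult_left_mono)
    then show ?thesis using fwd[of t "s - t"] st True by simp
  next
    case False
    \<comment> \<open>Backwards from \<open>t\<close>, the forward expansion starts at
      \<open>s\<close> and has the slope at \<open>s\<close>. Replacing it by the slope at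
      \<open>t\<close> costs another \<open>h * (h * c)\<close>, whence the factor 2.\<close>
    define h where "h = t - s"
    have h: "0 \<le> h" "t = s + h" using False by (auto simp: h_def)
    have bh: "evolve h (L f) \<in> bounded_fun" using h bf by (intro evolve_bounded_fun)
    have "\<bar>evolve s (\<lambda>z. evolve h (L f) z - L f z) z\<bar> \<le> h * c"
      by (rule evolve_bound[OF st(1)]) (auto intro!: bounded_fun_diff bh bf evolve_lipschitz h Lf c)
    then have "\<bar>evolve t (L f) z - evolve s (L f) z\<bar> \<le> h * c"
      unfolding h(2) by (simp add: evolve_diff evolve_semigroup h st bf bh)
    from mult_left_mono[OF this h(1)] have "\<bar>h * evolve t (L f) z - h * evolve s (L f) z\<bar> \<le> h * (h * c)"
      using h by (simp add: abs_mult right_diff_distrib[symmetric])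
    moreover have "\<bar>evolve t f z - evolve s f z - h * evolve s (L f) z\<bar> \<le> h * (h * c)"
      using fwd[of s h] h st by simp
    moreover have "(s - t) * evolve t (L f) z = - (h * evolve t (L f) z)" "(2 * c) * (s - t)\<^sup>2 = 2 * (h * (h * c))"
      by (simp_all add: h_def power2_eq_square algebra_simps)
    ultimately show ?thesis by linarith
  qed
qed

lemma DERIV_evolve:
  assumes f: "f \<in> moving_local" and t: "0 < t"
  shows "DERIV (\<lambda>t. evolve t f z) t :> evolve t (L f) z"
proof -
  obtain c where c: "0 \<le> c" "\<And>z. \<bar>L (L f) z\<bar> \<le> c"
    using bounded_funE[OF moving_local_bounded_fun[OF L_moving_local[OF L_moving_local[OF f]]]] by blast
  show ?thesis
    by (rule DERIV_quadratic[where \<delta> = t and C = "2 * c"]) (use t in \<open>auto intro!: evolve_expand f c\<close>)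
qed

lemma continuous_on_evolve:
  assumes f: "f \<in> moving_local"
  shows "continuous_on {0..} (\<lambda>t. evolve t f z)"
proof -
  obtain c where c: "0 \<le> c" "\<And>z. \<bar>L f z\<bar> \<le> c"
    using bounded_funE[OF moving_local_bounded_fun[OF L_moving_local[OF f]]] by blast
  have bf: "f \<in> bounded_fun" using f by (rule moving_local_bounded_fun)
  have *: "\<bar>evolve (u + h) f z - evolve u f z\<bar> \<le> h * c" if "0 \<le> u" "0 \<le> h" for u h
  proof -
    have bh: "evolve h f \<in> bounded_fun" using that bf by (intro evolve_bounded_fun)
    have "\<bar>evolve u (\<lambda>z. evolve h f z - f z) z\<bar> \<le> h * c"
      by (rule evolve_bound[OF that(1)]) (auto intro!: bounded_fun_diff bh bf evolve_lipschitz that f c)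
    then show ?thesis by (simp add: evolve_diff evolve_semigroup that bf bh)
  qed
  have "dist (evolve s f z) (evolve t f z) \<le> c * dist s t" if "0 \<le> s" "0 \<le> t" for s t
    using *[of s "t - s"] *[of t "s - t"] that by (cases "s \<le> t") (auto simp: dist_real_def mult.commute)
  then have "c-lipschitz_on {0..} (\<lambda>t. evolve t f z)"
    using c by (auto intro!: lipschitz_onI)
  then show ?thesis by (rule lipschitz_on_continuous_on)
qed

section \<open>The exponential series\<close>

definition series :: "nat \<Rightarrow> real \<Rightarrow> ('d tagged_state \<Rightarrow> real) \<Rightarrow> 'd tagged_state \<Rightarrow> real" where
  "series n t f z = (\<Sum>k<n. t ^ k / fact k * (L ^^ k) f z)"

lemma series_moving_local: "f \<in> moving_local \<Longrightarrow> series n t f \<in> moving_local"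
  unfolding series_def[abs_def] by (intro moving_local_sum moving_local_cmult Lpow_moving_local)

lemma DERIV_series: "DERIV (\<lambda>t. series (Suc n) t f z) t :> series n t (L f) z"
proof (induction n)
  case 0
  then show ?case by (simp add: series_def)
next
  case (Suc n)
  have 1: "series (Suc (Suc n)) t f z = series (Suc n) t f z + t ^ Suc n / fact (Suc n) * (L ^^ Suc n) f z" for t
    by (simp add: series_def)
  have "DERIV (\<lambda>t. t ^ Suc n / fact (Suc n) * (L ^^ Suc n) f z) t :> t ^ n / fact n * (L ^^ n) (L f) z"
    using DERIV_cmult_right[OF DERIV_power_fact, where c = "(L ^^ Suc n) f z"] by (simp add: funpow_swap1)
  from DERIV_add[OF Suc this] show ?case unfolding 1 by (simp add: series_def)
qed

text \<open>The derivative in time of the remainder for \<open>f\<close> is the remainder of one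
  order less for \<open>L f\<close>. By induction its modulus is at most the derivative of the
  claimed bound, so bound minus remainder and bound plus remainder both increase from zero.\<close>

lemma evolve_taylor:
  assumes "f \<in> moving_local" "0 \<le> t" "\<And>z. \<bar>(L ^^ n) f z\<bar> \<le> c"
  shows "\<bar>evolve t f z - series n t f z\<bar> \<le> c * t ^ n / fact n"
  using assms
proof (induction n arbitrary: f t)
  case 0
  then show ?case using evolve_bound[of t f c z] by (simp add: series_def moving_local_bounded_fun)
next
  case (Suc n)
  have Lf: "L f \<in> moving_local" using Suc.prems by (intro L_moving_local)
  have IH: "\<bar>evolve s (L f) z - series n s (L f) z\<bar> \<le> c * s ^ n / fact n" if "0 \<le> s" for s
    using Suc.IH[OF Lf that] Suc.prems(3) by (simp add: funpow_swap1)
  let ?psi = "\<lambda>s. evolve s f z - series (Suc n) s f z"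
  have d: "DERIV ?psi s :> evolve s (L f) z - series n s (L f) z" if "0 < s" for s
    using that by (intro DERIV_diff DERIV_evolve DERIV_series Suc.prems)
  have db: "DERIV (\<lambda>s. c * s ^ Suc n / fact (Suc n)) s :> c * s ^ n / fact n" for s
    using DERIV_cmult[OF DERIV_power_fact, of c n s] by simp
  have cont: "continuous_on {0..t} ?psi"
    unfolding series_def by (intro continuous_intros continuous_on_subset[OF continuous_on_evolve[OF Suc.prems(1)]]) auto
  have psi0: "?psi 0 = 0"
    using Suc.prems(1) by (simp add: evolve_zero moving_local_bounded_fun series_def sum.lessThan_Suc_shift
        del: sum.lessThan_Suc)
  have "(\<lambda>s. c * s ^ Suc n / fact (Suc n) - ?psi s) 0 \<le> (\<lambda>s. c * s ^ Suc n / fact (Suc n) - ?psi s) t"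
  proof (rule DERIV_nonneg_imp_increasing_open[OF Suc.prems(2)])
    fix s assume "0 < s" "s < t"
    then show "\<exists>y. DERIV (\<lambda>s. c * s ^ Suc n / fact (Suc n) - ?psi s) s :> y \<and> 0 \<le> y"
      using IH[of s] by - (rule exI, rule conjI, rule DERIV_diff[OF db d], auto)
  qed (rule continuous_on_diff[OF _ cont], intro continuous_intros, simp)
  moreover have "(\<lambda>s. c * s ^ Suc n / fact (Suc n) + ?psi s) 0 \<le> (\<lambda>s. c * s ^ Suc n / fact (Suc n) + ?psi s) t"
  proof (rule DERIV_nonneg_imp_increasing_open[OF Suc.prems(2)])
    fix s assume "0 < s" "s < t"
    then show "\<exists>y. DERIV (\<lambda>s. c * s ^ Suc n / fact (Suc n) + ?psi s) s :> y \<and> 0 \<le> y"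
      using IH[of s] by - (rule exI, rule conjI, rule DERIV_add[OF db d], auto)
  qed (rule continuous_on_add[OF _ cont], intro continuous_intros, simp)
  ultimately show ?case using psi0 by (simp add: abs_le_iff del: fact_Suc)
qed

text \<open>Half of the radius \<open>1 / (4 * growth_rate p)\<close> given by
  \<open>generator_power_bound\<close>, so that the Taylor error decays like
  \<open>(1 / 2) ^ n\<close>.\<close>

definition horizon :: real where "horizon = 1 / (8 * growth_rate p)"

lemma horizon_pos: "0 < horizon"
  using growth_rate_pos[OF finite_range] by (simp add: horizon_def)

lemma evolve_series:
  assumes f: "f \<in> moving_local" and t: "0 \<le> t" "t \<le> horizon" and e: "0 < e"
  shows "\<exists>n0. \<forall>n\<ge>n0. \<forall>z. \<bar>evolve t f z - series n t f z\<bar> \<le> e"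
proof -
  obtain K where K: "0 \<le> K" "\<And>k z. \<bar>(L ^^ k) f z\<bar> \<le> K * (4 * growth_rate p) ^ k * fact k"
    using generator_power_bound[OF finite_range f] by blast
  have C: "0 < growth_rate p" by (rule growth_rate_pos[OF finite_range])
  have *: "\<bar>evolve t f z - series n t f z\<bar> \<le> K * (1 / 2) ^ n" for n z
  proof -
    have "\<bar>evolve t f z - series n t f z\<bar> \<le> K * (4 * growth_rate p) ^ n * fact n * t ^ n / fact n"
      by (rule evolve_taylor[OF f t(1) K(2)])
    also have "\<dots> = K * (4 * growth_rate p * t) ^ n" by (simp add: power_mult_distrib)
    also have "\<dots> \<le> K * (1 / 2) ^ n"
      using t C by (intro mult_left_mono power_mono K) (auto simp: horizon_def field_simps)
    finally show ?thesis .
  qed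
  have "(\<lambda>n. K * (1 / 2) ^ n) \<longlonglongrightarrow> K * 0" by (intro tendsto_intros LIMSEQ_power_zero) auto
  then have "\<forall>\<^sub>F n in sequentially. K * (1 / 2) ^ n < e" using e by (intro order_tendstoD(2)[of _ "0"]) auto
  then obtain n0 where "\<And>n. n \<ge> n0 \<Longrightarrow> K * (1 / 2) ^ n < e" by (auto simp: eventually_sequentially)
  with * show ?thesis by (meson less_imp_le order_trans)
qed

end

section \<open>Invariance of the environment measure\<close>

lemma sets_bernoulli_tagged [measurable_cong]: "sets (bernoulli_tagged \<rho>) = sets config_space"
  unfolding bernoulli_tagged_def config_space_def by (rule sets_PiM_cong) auto

lemma space_bernoulli_tagged [simp]: "space (bernoulli_tagged \<rho>) = UNIV"
  using sets_eq_imp_space_eq[OF sets_bernoulli_tagged] by simp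

lemma prob_space_bernoulli_tagged: "prob_space (bernoulli_tagged \<rho>)"
  unfolding bernoulli_tagged_def by (rule prob_space_PiM) (rule prob_space_measure_pmf)

lemma pred_occupied [measurable]: "Measurable.pred config_space (\<lambda>\<eta>. \<eta> u)"
  unfolding config_space_def by measurable

text \<open>Off the origin the occupations are independent with a common law, so an injective
  relabelling that fixes the origin preserves the measure.\<close>

lemma integral_bernoulli_tagged_reindex:
  fixes g :: "int ^ 'd \<Rightarrow> int ^ 'd" and h :: "'d::finite config \<Rightarrow> real"
  assumes g: "inj g" "g 0 = 0" "\<And>y. y \<noteq> 0 \<Longrightarrow> g y \<noteq> 0" and h: "h \<in> borel_measurable config_space"
  shows "(\<integral>\<xi>. h (\<lambda>y. \<xi> (g y)) \<partial>bernoulli_tagged \<rho>) = (\<integral>\<xi>. h \<xi> \<partial>bernoulli_tagged \<rho>)"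
proof -
  let ?M = "\<lambda>x :: int ^ 'd. measure_pmf (if x = 0 then return_pmf True else bernoulli_pmf \<rho>)"
  have M: "(\<lambda>i. ?M (g i)) = ?M" using g by (auto simp: fun_eq_iff)
  have "distr (PiM UNIV ?M) (PiM UNIV (\<lambda>i. ?M (g i))) (\<lambda>\<omega>. \<lambda>n\<in>UNIV. \<omega> (g n)) = PiM UNIV (\<lambda>i. ?M (g i))"
    by (rule distr_PiM_reindex) (use g in \<open>auto intro: prob_space_measure_pmf\<close>)
  then have d: "distr (bernoulli_tagged \<rho>) (bernoulli_tagged \<rho>) (\<lambda>\<omega> y. \<omega> (g y)) = bernoulli_tagged \<rho>"
    unfolding M by (simp add: bernoulli_tagged_def restrict_UNIV)
  have m: "(\<lambda>\<omega> y. \<omega> (g y)) \<in> bernoulli_tagged \<rho> \<rightarrow>\<^sub>M bernoulli_tagged \<rho>"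
    unfolding bernoulli_tagged_def by (rule measurable_PiM_single') (auto simp: space_PiM intro!: measurable_compose[OF measurable_component_singleton[of "g _" UNIV ?M]])
  have "(\<integral>\<xi>. h \<xi> \<partial>distr (bernoulli_tagged \<rho>) (bernoulli_tagged \<rho>) (\<lambda>\<omega> y. \<omega> (g y))) =
      (\<integral>\<xi>. h (\<lambda>y. \<xi> (g y)) \<partial>bernoulli_tagged \<rho>)"
    using h m by (intro integral_distr) (simp_all add: measurable_cong_sets[OF sets_bernoulli_tagged refl])
  then show ?thesis unfolding d by simp
qed

lemma integrable_bernoulli_tagged:
  fixes h :: "'d::finite config \<Rightarrow> real"
  assumes "h \<in> borel_measurable config_space" "\<And>\<xi>. \<bar>h \<xi>\<bar> \<le> a"
  shows "integrable (bernoulli_tagged \<rho>) h"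
proof -
  interpret prob_space "bernoulli_tagged \<rho>" by (rule prob_space_bernoulli_tagged)
  show ?thesis
    using assms by (intro integrable_const_bound[of _ a]) (auto simp: measurable_cong_sets[OF sets_bernoulli_tagged refl])
qed

lemma integral_exchange:
  fixes h :: "'d::finite config \<Rightarrow> real"
  assumes "h \<in> borel_measurable config_space" "u \<noteq> 0" "v \<noteq> 0"
  shows "(\<integral>\<xi>. h (exchange \<xi> u v) \<partial>bernoulli_tagged \<rho>) = (\<integral>\<xi>. h \<xi> \<partial>bernoulli_tagged \<rho>)"
proof -
  let ?g = "\<lambda>y. if y = v then u else if y = u then v else y"
  have "exchange \<xi> u v = (\<lambda>y. \<xi> (?g y))" for \<xi> :: "'d config"
    by (auto simp: exchange_def fun_eq_iff)
  moreover have "inj ?g" by (rule injI) (simp split: if_splits)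
  then have "(\<integral>\<xi>. h (\<lambda>y. \<xi> (?g y)) \<partial>bernoulli_tagged \<rho>) = (\<integral>\<xi>. h \<xi> \<partial>bernoulli_tagged \<rho>)"
    by (rule integral_bernoulli_tagged_reindex[of ?g h]) (use assms in auto)
  ultimately show ?thesis by simp
qed

text \<open>Jumping to \<open>k\<close> and recentring is itself a relabelling that fixes the
  origin: the site left behind is now \<open>- k\<close> and carries the old value at
  \<open>k\<close>, all others are shifted.\<close>

lemma integral_jump:
  fixes h :: "'d::finite config \<Rightarrow> real"
  assumes "h \<in> borel_measurable config_space" "k \<noteq> 0"
  shows "(\<integral>\<xi>. h (seen_from k (exchange \<xi> 0 k)) \<partial>bernoulli_tagged \<rho>) = (\<integral>\<xi>. h \<xi> \<partial>bernoulli_tagged \<rho>)"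
proof -
  let ?g = "\<lambda>y. if y = 0 then 0 else if y = - k then k else k + y"
  have eq: "k + y = 0 \<longleftrightarrow> y = - k" for y by (metis add.right_inverse add_left_cancel)
  have "seen_from k (exchange \<xi> 0 k) = (\<lambda>y. \<xi> (?g y))" for \<xi> :: "'d config"
    using assms(2) by (auto simp: seen_from_def exchange_def fun_eq_iff eq)
  moreover have "inj ?g"
    using assms(2) by (intro injI) (simp add: eq split: if_splits)
  then have "(\<integral>\<xi>. h (\<lambda>y. \<xi> (?g y)) \<partial>bernoulli_tagged \<rho>) = (\<integral>\<xi>. h \<xi> \<partial>bernoulli_tagged \<rho>)"
    by (rule integral_bernoulli_tagged_reindex[of ?g h]) (use assms in \<open>auto simp: eq\<close>)
  ultimately show ?thesis by simp
qed

text \<open>Resampling the occupation of \<open>u\<close> leaves the measure unchanged and does not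
  affect \<open>h\<close>; integrating over the fresh value first gives zero.\<close>

lemma integral_centred_occupation:
  fixes h :: "'d::finite config \<Rightarrow> real"
  assumes r: "0 \<le> \<rho>" "\<rho> \<le> 1" and u: "u \<noteq> 0"
    and h[measurable]: "h \<in> borel_measurable config_space" and a: "\<And>\<xi>. \<bar>h \<xi>\<bar> \<le> a"
    and indep: "\<And>\<xi> b. h (\<xi>(u := b)) = h \<xi>"
  shows "(\<integral>\<xi>. (of_bool (\<xi> u) - \<rho>) * h \<xi> \<partial>bernoulli_tagged \<rho>) = 0"
proof -
  let ?M = "\<lambda>x :: int ^ 'd. measure_pmf (if x = 0 then return_pmf True else bernoulli_pmf \<rho>)"
  let ?N = "bernoulli_tagged \<rho> :: 'd config measure" and ?U = "measure_pmf (bernoulli_pmf \<rho>)"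
  let ?F = "\<lambda>\<xi> :: 'd config. (of_bool (\<xi> u) - \<rho>) * h \<xi>"
  interpret N: prob_space ?N by (rule prob_space_bernoulli_tagged)
  interpret U: prob_space ?U by (rule prob_space_measure_pmf)
  interpret UN: pair_prob_space ?U ?N ..
  \<comment> \<open>Since \<open>insert u UNIV\<close> is \<open>UNIV\<close>, this says that
    overwriting the coordinate \<open>u\<close> by an independent copy preserves the product
    measure.\<close>
  have "distr (?M u \<Otimes>\<^sub>M PiM UNIV ?M) (PiM (insert u UNIV) ?M) (\<lambda>(x, X). X(u := x)) = PiM (insert u UNIV) ?M"
    by (rule distr_pair_PiM_eq_PiM) (auto intro: prob_space_measure_pmf)
  then have d: "distr (?U \<Otimes>\<^sub>M ?N) ?N (\<lambda>(x, X). X(u := x)) = ?N"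
    using u by (simp add: bernoulli_tagged_def)
  have "(\<lambda>z. ((snd z)(u := fst z)) i) \<in> ?U \<Otimes>\<^sub>M PiM UNIV ?M \<rightarrow>\<^sub>M ?M i" for i
  proof (cases "i = u")
    case True
    then show ?thesis using u by simp
  next
    case False
    then show ?thesis
      using measurable_compose[OF measurable_snd measurable_component_singleton[of i UNIV ?M]] by simp
  qed
  then have m: "(\<lambda>(x, X). X(u := x)) \<in> ?U \<Otimes>\<^sub>M ?N \<rightarrow>\<^sub>M ?N"
    unfolding bernoulli_tagged_def case_prod_beta'
    by (intro measurable_PiM_single') (simp_all add: space_pair_measure space_PiM)
  have F[measurable]: "?F \<in> borel_measurable config_space" by measurable
  have "(\<integral>\<xi>. ?F \<xi> \<partial>?N) = (\<integral>\<xi>. ?F \<xi> \<partial>distr (?U \<Otimes>\<^sub>M ?N) ?N (\<lambda>(x, X). X(u := x)))"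
    unfolding d ..
  also have "\<dots> = (\<integral>z. ?F (case z of (x, X) \<Rightarrow> X(u := x)) \<partial>(?U \<Otimes>\<^sub>M ?N))"
    using m F by (intro integral_distr) (simp_all add: measurable_cong_sets[OF sets_bernoulli_tagged refl])
  also have "\<dots> = (\<integral>z. (of_bool (fst z) - \<rho>) * h (snd z) \<partial>(?U \<Otimes>\<^sub>M ?N))"
    by (intro Bochner_Integration.integral_cong refl) (auto simp: indep)
  also have "\<dots> = (\<integral>X. \<integral>x. (of_bool x - \<rho>) * h X \<partial>?U \<partial>?N)"
  proof -
    have "\<bar>(of_bool (fst z) - \<rho>) * h (snd z)\<bar> \<le> 1 * a" for z :: "bool \<times> 'd config"
      unfolding abs_mult using r a by (intro mult_mono) (auto simp: of_bool_def)
    then have "integrable (?U \<Otimes>\<^sub>M ?N) (\<lambda>(x, y). (of_bool x - \<rho>) * h y)"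
      by (intro UN.integrable_const_bound[of _ a]) auto
    from UN.integral_snd[OF this] show ?thesis by (simp add: case_prod_beta')
  qed
  also have "\<dots> = 0" using r by (simp add: algebra_simps)
  finally show ?thesis .
qed

lemma moving_local_measurable_origin:
  assumes "f \<in> moving_local"
  shows "(\<lambda>\<xi>. f (0, \<xi>)) \<in> borel_measurable config_space"
  using bounded_fun_measurable[OF moving_local_bounded_fun[OF assms]]
  unfolding tagged_space_def by measurable

section \<open>Means over the environment\<close>

definition env_mean :: "real \<Rightarrow> ('d::finite tagged_state \<Rightarrow> real) \<Rightarrow> real" where
  "env_mean \<rho> f = (\<integral>\<xi>. f (0, \<xi>) \<partial>bernoulli_tagged \<rho>)"

lemma bounded_fun_measurable_origin [measurable]:
  assumes "f \<in> bounded_fun"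
  shows "(\<lambda>\<xi>. f (0, \<xi>)) \<in> borel_measurable config_space"
  using bounded_fun_measurable[OF assms] unfolding tagged_space_def by measurable

lemma integrable_origin:
  assumes "f \<in> bounded_fun"
  shows "integrable (bernoulli_tagged \<rho>) (\<lambda>\<xi>. f (0, \<xi>))"
proof -
  obtain a where "\<And>z. \<bar>f z\<bar> \<le> a" using bounded_funE[OF assms] by blast
  then show ?thesis
    using assms by (intro integrable_bernoulli_tagged[of _ a] bounded_fun_measurable_origin) auto
qed

lemma env_mean_add: "f \<in> bounded_fun \<Longrightarrow> g \<in> bounded_fun \<Longrightarrow>
    env_mean \<rho> (\<lambda>z. f z + g z) = env_mean \<rho> f + env_mean \<rho> g"
  unfolding env_mean_def by (intro Bochner_Integration.integral_add integrable_origin)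

lemma env_mean_diff: "f \<in> bounded_fun \<Longrightarrow> g \<in> bounded_fun \<Longrightarrow>
    env_mean \<rho> (\<lambda>z. f z - g z) = env_mean \<rho> f - env_mean \<rho> g"
  unfolding env_mean_def by (intro Bochner_Integration.integral_diff integrable_origin)

lemma env_mean_cmult: "env_mean \<rho> (\<lambda>z. c * f z) = c * env_mean \<rho> f"
  unfolding env_mean_def by simp

lemma env_mean_const: "env_mean \<rho> (\<lambda>_ :: 'd::finite tagged_state. c) = c"
proof -
  interpret prob_space "bernoulli_tagged \<rho> :: 'd config measure" by (rule prob_space_bernoulli_tagged)
  show ?thesis using prob_space by (simp add: env_mean_def)
qed

lemma env_mean_sum: "(\<And>i. i \<in> I \<Longrightarrow> f i \<in> bounded_fun) \<Longrightarrow>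
    env_mean \<rho> (\<lambda>z. \<Sum>i\<in>I. f i z) = (\<Sum>i\<in>I. env_mean \<rho> (f i))"
  unfolding env_mean_def by (intro Bochner_Integration.integral_sum integrable_origin)

lemma env_mean_mono: "f \<in> bounded_fun \<Longrightarrow> g \<in> bounded_fun \<Longrightarrow> (\<And>z. f z \<le> g z) \<Longrightarrow>
    env_mean \<rho> f \<le> env_mean \<rho> g"
  unfolding env_mean_def by (intro integral_mono integrable_origin)

lemma env_mean_bound:
  assumes "f \<in> bounded_fun" "\<And>z. \<bar>f z\<bar> \<le> a"
  shows "\<bar>env_mean \<rho> f\<bar> \<le> a"
proof (rule abs_leI)
  show "env_mean \<rho> f \<le> a"
    using env_mean_mono[OF assms(1) bounded_fun_const, of a \<rho>] assms(2) by (simp add: env_mean_const abs_le_iff)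
  have "- a \<le> f z" for z using assms(2)[of z] by linarith
  then show "- env_mean \<rho> f \<le> a"
    using env_mean_mono[OF bounded_fun_const assms(1), of "- a" \<rho>] by (simp add: env_mean_const)
qed

lemma moving_local_exchange_term:
  assumes "f \<in> moving_local" shows "exchange_term p k u f \<in> moving_local"
proof -
  obtain a \<Lambda> where *: "\<And>z. \<bar>f z\<bar> \<le> a" "finite \<Lambda>" "depends_near \<Lambda> f"
    using assms unfolding moving_local_def by blast
  show ?thesis by (rule local_sum_moving_local, rule local_sum_exchange_term[OF *(2) order_refl *(3,1)])
qed

lemma moving_local_jump_term:
  assumes "f \<in> moving_local" shows "jump_term p k f \<in> moving_local"
proof -
  obtain a \<Lambda> where *: "\<And>z. \<bar>f z\<bar> \<le> a" "finite \<Lambda>" "depends_near \<Lambda> f"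
    using assms unfolding moving_local_def by blast
  show ?thesis by (rule local_sum_moving_local, rule local_sum_jump_term[OF *(2) order_refl *(3,1)])
qed

definition occupied :: "int ^ 'd \<Rightarrow> 'd::finite tagged_state \<Rightarrow> real" where
  "occupied u = (\<lambda>(x, \<eta>). of_bool (\<eta> (x + u)))"

lemma occupied_bounds: "0 \<le> occupied u z" "occupied u z \<le> 1"
  by (auto simp: occupied_def split: prod.split)

lemma moving_local_occupied: "occupied u \<in> moving_local"
  by (rule moving_localI[of _ 1 "{u}"]) (auto simp: occupied_def depends_near_def)

lemma environment_fun_occupied: "environment_fun (occupied u)"
  by (simp add: environment_fun_def occupied_def seen_from_def)

text \<open>The exchange is measure preserving and turns the gain term, with \<open>u\<close>
  occupied and \<open>u + k\<close> empty, into the opposite situation. In the difference of the two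
  indicators the products cancel and the difference of the occupations remains.\<close>

lemma env_mean_exchange_term:
  fixes f :: "'d::finite tagged_state \<Rightarrow> real"
  assumes f: "f \<in> moving_local" and u: "u \<noteq> 0" "u + k \<noteq> 0"
  shows "env_mean \<rho> (exchange_term p k u f) =
    pmf p k * (env_mean \<rho> (\<lambda>z. occupied (u + k) z * f z) - env_mean \<rho> (\<lambda>z. occupied u z * f z))"
proof -
  let ?v = "u + k"
  let ?F = "\<lambda>z. occupied ?v z * (1 - occupied u z) * f z"
  let ?F' = "\<lambda>z. occupied u z * (1 - occupied ?v z) * f z"
  let ?G = "\<lambda>\<xi>. ?F (0, \<xi>)"
  have F: "?F \<in> bounded_fun" "?F' \<in> bounded_fun" "(\<lambda>z. occupied w z * f z) \<in> bounded_fun" for w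
    by (intro moving_local_bounded_fun moving_local_mult moving_local_diff moving_local_const moving_local_occupied f)+
  have ex: "exchange_term p k u f \<in> bounded_fun"
    by (intro moving_local_bounded_fun moving_local_exchange_term f)
  have G: "?G \<in> borel_measurable config_space" by (rule bounded_fun_measurable_origin[OF F(1)])
  have "env_mean \<rho> (\<lambda>z. exchange_term p k u f z + pmf p k * ?F' z) =
      (\<integral>\<xi>. pmf p k * ?G (exchange \<xi> u ?v) \<partial>bernoulli_tagged \<rho>)"
    unfolding env_mean_def using u
    by (intro Bochner_Integration.integral_cong refl)
      (auto simp: exchange_term_def occupied_def exchange_def algebra_simps)
  also have "\<dots> = pmf p k * env_mean \<rho> ?F"
    using integral_exchange[OF G u, of \<rho>] by (simp add: env_mean_def)
  finally have "env_mean \<rho> (exchange_term p k u f) = pmf p k * (env_mean \<rho> ?F - env_mean \<rho> ?F')"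
    using env_mean_add[OF ex bounded_fun_cmult[OF F(2), of "pmf p k"], of \<rho>]
    by (simp only: env_mean_cmult right_diff_distrib)
  also have "env_mean \<rho> ?F - env_mean \<rho> ?F' = env_mean \<rho> (\<lambda>z. occupied ?v z * f z - occupied u z * f z)"
    unfolding env_mean_diff[OF F(1,2), symmetric] by (simp add: algebra_simps)
  also have "\<dots> = env_mean \<rho> (\<lambda>z. occupied ?v z * f z) - env_mean \<rho> (\<lambda>z. occupied u z * f z)"
    by (rule env_mean_diff[OF F(3) F(3)])
  finally show ?thesis .
qed

text \<open>Write \<open>m u\<close> for the correlation of \<open>f\<close> with the centred
  occupation of \<open>u\<close>. For fixed \<open>k\<close> the exchange terms are the increments
  \<open>m (u + k) - m u\<close>, which would telescope to zero over the whole lattice. The two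
  bonds through the origin are missing from that sum, and the jump of the tagged particle supplies
  precisely their contribution \<open>m k - m (- k)\<close>.\<close>

lemma env_mean_generator:
  fixes f :: "'d::finite tagged_state \<Rightarrow> real"
  assumes r: "0 \<le> \<rho>" "\<rho> \<le> 1" and S: "finite (set_pmf p)"
    and f: "f \<in> moving_local" "environment_fun f"
  shows "env_mean \<rho> (tagged_generator p f) = 0"
proof -
  let ?N = "bernoulli_tagged \<rho> :: 'd config measure"
  obtain a \<Lambda> where *: "\<And>z. \<bar>f z\<bar> \<le> a" "finite \<Lambda>" "depends_near \<Lambda> f"
    using f(1) unfolding moving_local_def by blast
  define h where "h = (\<lambda>\<xi>. f (0, \<xi>))"
  have h[measurable]: "h \<in> borel_measurable config_space"
    unfolding h_def by (rule moving_local_measurable_origin[OF f(1)])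
  have ha: "\<bar>h \<xi>\<bar> \<le> a" for \<xi> using *(1) by (simp add: h_def)
  have ob: "\<bar>of_bool b * x\<bar> \<le> \<bar>x\<bar>" "\<bar>(1 - of_bool b) * x\<bar> \<le> \<bar>x\<bar>" for b and x :: real by auto
  have int: "integrable ?N (\<lambda>\<xi>. of_bool (\<xi> u) * h \<xi>)" for u
    by (intro integrable_bernoulli_tagged[of _ a] order_trans[OF ob(1) ha]) measurable
  have inth: "integrable ?N h" by (intro integrable_bernoulli_tagged[of _ a] h ha)
  have int1: "integrable ?N (\<lambda>\<xi>. (1 - of_bool (\<xi> u)) * h \<xi>)" for u
    by (intro integrable_bernoulli_tagged[of _ a] order_trans[OF ob(2) ha]) measurable
  have int2: "integrable ?N (\<lambda>\<xi>. of_bool (\<xi> u) * (1 - of_bool (\<xi> v)) * h \<xi>)" for u v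
    unfolding mult.assoc
    by (intro integrable_bernoulli_tagged[of _ a] order_trans[OF ob(1) order_trans[OF ob(2) ha]]) measurable
  define q where "q = (\<lambda>u. \<integral>\<xi>. of_bool (\<xi> u) * h \<xi> \<partial>?N)"
  \<comment> \<open>Centring makes \<open>m\<close> vanish outside the window, so the telescoping
    sums are finite. The value at the origin is set to zero, as the origin is always
    occupied.\<close>
  define m where "m = (\<lambda>u. if u = 0 then 0 else \<integral>\<xi>. (of_bool (\<xi> u) - \<rho>) * h \<xi> \<partial>?N)"
  have m: "m u = q u - \<rho> * integral\<^sup>L ?N h" if "u \<noteq> 0" for u
    using that int[of u] inth by (simp add: m_def q_def left_diff_distrib)
  have m0: "m 0 = 0" by (simp add: m_def)
  have mL: "m u = 0" if "u \<notin> \<Lambda>" for u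
  proof (cases "u = 0")
    case False
    have "h (\<xi>(u := b)) = h \<xi>" for \<xi> b
      unfolding h_def by (rule depends_nearD[OF *(3)]) (use that in auto)
    then show ?thesis
      using integral_centred_occupation[OF r False h ha] False by (simp add: m_def)
  qed (simp add: m0)
  have ex: "env_mean \<rho> (exchange_term p k u f) = pmf p k * (of_bool (u \<noteq> 0 \<and> u + k \<noteq> 0) * (m (u + k) - m u))" for k u
  proof (cases "u \<noteq> 0 \<and> u + k \<noteq> 0")
    case True
    then show ?thesis using env_mean_exchange_term[OF f(1), of u k \<rho> p] m
      by (simp add: q_def h_def env_mean_def occupied_def)
  next
    case False
    then have "exchange_term p k u f = (\<lambda>_. 0)" by (auto simp: exchange_term_def fun_eq_iff)
    then show ?thesis using False by (auto simp: env_mean_const)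
  qed
  have ju: "env_mean \<rho> (jump_term p k f) = pmf p k * (m k - m (- k))" for k
  proof (cases "k = 0")
    case True
    then have "jump_term p k f (x, \<eta>) = 0" for x \<eta> by (simp add: jump_term_def exchange_def)
    then show ?thesis using True by (simp add: env_mean_def)
  next
    case False
    let ?s = "\<lambda>\<xi>. seen_from k (exchange \<xi> 0 k)"
    let ?G = "\<lambda>\<xi>. (1 - of_bool (\<xi> (- k))) * h \<xi>"
    have G: "?G \<in> borel_measurable config_space" by measurable
    \<comment> \<open>The vacancy at \<open>k\<close> required before the jump is a vacancy at
      \<open>- k\<close> in the environment \<open>?s\<close> after it, so the gain term becomes an
      integral over the untransformed configuration.\<close>
    have sk: "?s \<xi> (- k) = \<xi> k" for \<xi> using False by (simp add: seen_from_def exchange_def)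
    have 1: "(\<integral>\<xi>. (1 - of_bool (\<xi> k)) * h (?s \<xi>) \<partial>?N) = integral\<^sup>L ?N ?G"
      using integral_jump[OF G False, of \<rho>] unfolding sk .
    have fk: "f (k, exchange \<xi> 0 k) = h (?s \<xi>)" for \<xi>
      unfolding h_def by (rule environment_funD[OF f(2)])
    have i0: "integrable ?N (\<lambda>\<xi>. jump_term p k f (0, \<xi>))"
      by (intro integrable_origin moving_local_bounded_fun moving_local_jump_term f)
    have pk: "(\<lambda>\<xi>. jump_term p k f (0, \<xi>)) = (\<lambda>\<xi>. pmf p k * ((1 - of_bool (\<xi> k)) * h (?s \<xi>) - (1 - of_bool (\<xi> k)) * h \<xi>))"
      by (auto simp: jump_term_def fk fun_eq_iff h_def algebra_simps)
    show ?thesis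
    proof (cases "pmf p k = 0")
      case True
      then show ?thesis unfolding env_mean_def pk by simp
    next
      case pk0: False
      \<comment> \<open>Integrability of the gain term is read off from that of the whole jump term,
        which requires dividing by the rate.\<close>
      have "integrable ?N (\<lambda>\<xi>. (1 - of_bool (\<xi> k)) * h (?s \<xi>) - (1 - of_bool (\<xi> k)) * h \<xi>)"
        using i0 pk0 unfolding pk by simp
      from Bochner_Integration.integrable_add[OF this int1[of k]]
      have i1: "integrable ?N (\<lambda>\<xi>. (1 - of_bool (\<xi> k)) * h (?s \<xi>))" by simp
      have q1: "(\<integral>\<xi>. (1 - of_bool (\<xi> u)) * h \<xi> \<partial>?N) = integral\<^sup>L ?N h - q u" for u
        unfolding q_def using int[of u] inth by (simp add: left_diff_distrib)
      have "env_mean \<rho> (jump_term p k f) = pmf p k * (integral\<^sup>L ?N ?G - (\<integral>\<xi>. (1 - of_bool (\<xi> k)) * h \<xi> \<partial>?N))"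
        unfolding env_mean_def pk using i1 int1[of k] by (simp add: 1)
      also have "\<dots> = pmf p k * (q k - q (- k))" unfolding q1 by simp
      finally show ?thesis using False m by simp
    qed
  qed
  \<comment> \<open>The origin and the sites \<open>- k\<close> are added so that the sum over
    \<open>A\<close> meets both exceptional bonds.\<close>
  define A where "A = generator_hull p \<Lambda> \<union> ({0} \<union> uminus ` set_pmf p)"
  have A: "finite A" "generator_hull p \<Lambda> \<subseteq> A" "0 \<in> A" "\<And>k. k \<in> set_pmf p \<Longrightarrow> - k \<in> A" "\<Lambda> \<subseteq> A"
    "\<And>k y. k \<in> set_pmf p \<Longrightarrow> y \<in> \<Lambda> \<Longrightarrow> y - k \<in> A"
    using finite_generator_hull[OF S *(2)] S unfolding A_def generator_hull_def by auto
  have bd: "exchange_term p k u f \<in> bounded_fun" "jump_term p k f \<in> bounded_fun" for k u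
    by (intro moving_local_bounded_fun moving_local_exchange_term moving_local_jump_term f)+
  have Leq: "tagged_generator p f = (\<lambda>z. (\<Sum>k\<in>set_pmf p. \<Sum>u\<in>A. exchange_term p k u f z) + (\<Sum>k\<in>set_pmf p. jump_term p k f z))"
    using tagged_generator_eq[OF S *(3) A(1,2)] by (simp add: fun_eq_iff)
  have "env_mean \<rho> (tagged_generator p f) =
    (\<Sum>k\<in>set_pmf p. \<Sum>u\<in>A. env_mean \<rho> (exchange_term p k u f)) + (\<Sum>k\<in>set_pmf p. env_mean \<rho> (jump_term p k f))"
    unfolding Leq by (simp add: env_mean_add env_mean_sum bd bounded_fun_sum)
  also have "\<dots> = (\<Sum>k\<in>set_pmf p. pmf p k * ((\<Sum>u\<in>A. of_bool (u \<noteq> 0 \<and> u + k \<noteq> 0) * (m (u + k) - m u)) + (m k - m (- k))))"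
    by (simp add: ex ju sum_distrib_left sum.distrib distrib_left)
  also have "\<dots> = 0"
  proof (rule sum.neutral, rule ballI)
    fix k assume k: "k \<in> set_pmf p"
    have u0: "u + k = 0 \<longleftrightarrow> u = - k" for u by (metis add.left_inverse add_right_cancel)
    \<comment> \<open>The full increment corrected at the two bonds through the origin, where one
      end of the increment is \<open>m 0\<close>, which is zero.\<close>
    have "of_bool (u \<noteq> 0 \<and> u + k \<noteq> 0) * (m (u + k) - m u) =
        (m (u + k) - of_bool (u = 0) * m k) - (m u - of_bool (u = - k) * m (- k))" for u
      using m0 by (auto simp: u0)
    then have "(\<Sum>u\<in>A. of_bool (u \<noteq> 0 \<and> u + k \<noteq> 0) * (m (u + k) - m u)) =
        ((\<Sum>u\<in>A. m (u + k)) - (\<Sum>u\<in>A. of_bool (u = 0) * m k)) - ((\<Sum>u\<in>A. m u) - (\<Sum>u\<in>A. of_bool (u = - k) * m (- k)))"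
      by (simp add: sum_subtractf)
    also have "(\<Sum>u\<in>A. of_bool (u = 0) * m k) = m k"
      using A by (simp add: sum.delta of_bool_def if_distrib[of "\<lambda>x. x * _"] cong: if_cong)
    also have "(\<Sum>u\<in>A. of_bool (u = - k) * m (- k)) = m (- k)"
      using A(1) A(4)[OF k] by (simp add: sum.delta of_bool_def if_distrib[of "\<lambda>x. x * _"] cong: if_cong)
    also have "(\<Sum>u\<in>A. m u) = (\<Sum>u\<in>\<Lambda>. m u)"
      by (rule sum.mono_neutral_right) (use A mL in auto)
    also have "(\<Sum>u\<in>A. m (u + k)) = (\<Sum>u\<in>(\<lambda>y. y - k) ` \<Lambda>. m (u + k))"
    proof (rule sum.mono_neutral_right)
      show "\<forall>u\<in>A - (\<lambda>y. y - k) ` \<Lambda>. m (u + k) = 0"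
      proof
        fix u assume "u \<in> A - (\<lambda>y. y - k) ` \<Lambda>"
        then have "u + k \<notin> \<Lambda>" by (auto simp: image_iff)
        then show "m (u + k) = 0" by (rule mL)
      qed
    qed (use A k in auto)
    also have "\<dots> = (\<Sum>u\<in>\<Lambda>. m u)" by (subst sum.reindex) (auto simp: inj_on_def)
    finally show "pmf p k * ((\<Sum>u\<in>A. of_bool (u \<noteq> 0 \<and> u + k \<noteq> 0) * (m (u + k) - m u)) + (m k - m (- k))) = 0"
      by simp
  qed
  finally show ?thesis .
qed

section \<open>Energy estimates\<close>

text \<open>The carre du champ of a single bond; see \<open>exchange_energy_eq\<close>.\<close>

definition exchange_energy ::
  "(int ^ 'd) pmf \<Rightarrow> int ^ 'd \<Rightarrow> int ^ 'd \<Rightarrow> ('d::finite tagged_state \<Rightarrow> real) \<Rightarrow> 'd tagged_state \<Rightarrow> real" where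
  "exchange_energy p k u f = (\<lambda>(x, \<eta>). of_bool (u \<noteq> 0 \<and> u + k \<noteq> 0) * pmf p k * of_bool (\<eta> (x + u)) *
     (1 - of_bool (\<eta> (x + u + k))) * (f (x, exchange \<eta> (x + u) (x + u + k)) - f (x, \<eta>))\<^sup>2)"

lemma exchange_energy_eq:
  "exchange_energy p k u f z =
    exchange_term p k u (\<lambda>z. f z * f z) z - 2 * (f z * exchange_term p k u f z)"
  by (cases z) (simp add: exchange_energy_def exchange_term_def power2_eq_square algebra_simps)

lemma exchange_energy_nonneg: "0 \<le> exchange_energy p k u f z"
  by (cases z) (simp add: exchange_energy_def)

lemma moving_local_exchange_energy:
  assumes "f \<in> moving_local" shows "exchange_energy p k u f \<in> moving_local"
  unfolding exchange_energy_eq[abs_def]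
  by (intro moving_local_diff moving_local_cmult moving_local_mult moving_local_exchange_term assms)

lemma jump_energy_nonneg:
  "0 \<le> jump_term p k (\<lambda>z. f z * f z) z - 2 * (f z * jump_term p k f z)"
proof -
  obtain x \<eta> where z: "z = (x, \<eta>)" by (cases z)
  have "jump_term p k (\<lambda>z. f z * f z) z - 2 * (f z * jump_term p k f z) =
      pmf p k * (1 - of_bool (\<eta> (x + k))) * (f (x + k, exchange \<eta> x (x + k)) - f (x, \<eta>))\<^sup>2"
    by (simp add: z jump_term_def power2_eq_square algebra_simps)
  then show ?thesis by simp
qed

text \<open>The generator applied to the square of \<open>f\<close>, minus
  \<open>2 * f * L f\<close>, is the sum of the energies of all bonds and jumps. By invariance the
  first part has mean zero. All energies are nonnegative, so any selection of bonds is bounded by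
  the rest.\<close>

lemma exchange_energy_le_dirichlet:
  fixes f :: "'d::finite tagged_state \<Rightarrow> real"
  assumes r: "0 \<le> \<rho>" "\<rho> \<le> 1" and S: "finite (set_pmf p)"
    and f: "f \<in> moving_local" "environment_fun f" and K: "K \<subseteq> set_pmf p" and B: "\<And>k. k \<in> K \<Longrightarrow> finite (B k)"
  shows "(\<Sum>k\<in>K. \<Sum>u\<in>B k. env_mean \<rho> (exchange_energy p k u f))
    \<le> - 2 * env_mean \<rho> (\<lambda>z. f z * tagged_generator p f z)"
proof -
  let ?ff = "\<lambda>z. f z * f z" and ?L = "tagged_generator p"
  have finK: "finite K" using K S by (rule finite_subset)
  obtain \<Lambda> where *: "finite \<Lambda>" "depends_near \<Lambda> f"
    using f(1) unfolding moving_local_def by blast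
  define A where "A = generator_hull p \<Lambda> \<union> (\<Union>k\<in>K. B k)"
  have hull: "finite A" "generator_hull p \<Lambda> \<subseteq> A"
    using * S finK B by (auto simp: A_def intro: finite_generator_hull)
  have "depends_near \<Lambda> ?ff" using depends_near_mult[OF *(2,2)] by simp
  note A = hull(1) tagged_generator_eq[OF S *(2) hull] tagged_generator_eq[OF S this hull]
  have BA: "B k \<subseteq> A" if "k \<in> K" for k using that by (auto simp: A_def)
  have ff: "?ff \<in> moving_local" "environment_fun ?ff" using f by auto
  have Lf: "?L f \<in> moving_local" "?L ?ff \<in> moving_local"
    by (intro moving_local_tagged_generator[OF S] f ff)+
  have bd: "exchange_energy p k u f \<in> bounded_fun" for k u
    by (intro moving_local_bounded_fun moving_local_exchange_energy f)
  have "(\<Sum>k\<in>K. \<Sum>u\<in>B k. env_mean \<rho> (exchange_energy p k u f)) =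
      env_mean \<rho> (\<lambda>z. \<Sum>k\<in>K. \<Sum>u\<in>B k. exchange_energy p k u f z)"
    by (simp add: env_mean_sum bd bounded_fun_sum)
  also have "\<dots> \<le> env_mean \<rho> (\<lambda>z. ?L ?ff z - 2 * (f z * ?L f z))"
  proof (rule env_mean_mono)
    fix z
    have "(\<Sum>k\<in>K. \<Sum>u\<in>B k. exchange_energy p k u f z) \<le> (\<Sum>k\<in>K. \<Sum>u\<in>A. exchange_energy p k u f z)"
      by (intro sum_mono sum_mono2 A(1) BA exchange_energy_nonneg)
    also have "\<dots> \<le> (\<Sum>k\<in>set_pmf p. \<Sum>u\<in>A. exchange_energy p k u f z)"
      by (intro sum_mono2 S K sum_nonneg exchange_energy_nonneg)
    also have "\<dots> \<le> (\<Sum>k\<in>set_pmf p. \<Sum>u\<in>A. exchange_energy p k u f z) +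
        (\<Sum>k\<in>set_pmf p. jump_term p k ?ff z - 2 * (f z * jump_term p k f z))"
      using sum_nonneg[of "set_pmf p" "\<lambda>k. jump_term p k ?ff z - 2 * (f z * jump_term p k f z)"]
        jump_energy_nonneg[of p _ f z] by simp
    also have "\<dots> = ?L ?ff z - 2 * (f z * ?L f z)"
      unfolding A(2,3) exchange_energy_eq
      by (simp add: sum_subtractf sum_distrib_left distrib_left)
    finally show "(\<Sum>k\<in>K. \<Sum>u\<in>B k. exchange_energy p k u f z) \<le> ?L ?ff z - 2 * (f z * ?L f z)" .
  qed (intro bounded_fun_sum bd, intro moving_local_bounded_fun moving_local_diff moving_local_cmult moving_local_mult Lf f)
  also have "\<dots> = env_mean \<rho> (?L ?ff) - 2 * env_mean \<rho> (\<lambda>z. f z * ?L f z)"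
    by (subst env_mean_diff)
      (auto simp: env_mean_cmult intro!: moving_local_bounded_fun moving_local_cmult moving_local_mult Lf f)
  also have "env_mean \<rho> (?L ?ff) = 0" by (rule env_mean_generator[OF r S ff])
  finally show ?thesis by simp
qed

lemma weighted_am_gm: "0 < (\<beta> :: real) \<Longrightarrow> \<bar>a * b\<bar> \<le> \<beta> / 2 * a\<^sup>2 + 1 / (2 * \<beta>) * b\<^sup>2"
proof -
  assume b: "0 < \<beta>"
  have "0 \<le> (\<beta> * \<bar>a\<bar> - \<bar>b\<bar>)\<^sup>2 / (2 * \<beta>)" using b by simp
  also have "\<dots> = \<beta> / 2 * a\<^sup>2 + 1 / (2 * \<beta>) * b\<^sup>2 - \<bar>a * b\<bar>"
    using b by (simp add: power2_eq_square field_simps abs_mult)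
  finally show ?thesis by simp
qed

text \<open>By \<open>env_mean_exchange_term\<close> the difference is the mean of a rate times an
  increment of \<open>f\<close>. The weighted inequality of arithmetic and geometric means separates
  the squared increment, which is the energy, from the rate; \<open>\<beta>\<close> is fixed
  later.\<close>

lemma occupied_difference_bound:
  assumes f: "f \<in> moving_local" and b: "0 < \<beta>" and u: "u \<noteq> 0" "u + k \<noteq> 0"
  shows "pmf p k * \<bar>env_mean \<rho> (\<lambda>z. occupied (u + k) z * f z) - env_mean \<rho> (\<lambda>z. occupied u z * f z)\<bar>
    \<le> \<beta> / 2 * env_mean \<rho> (exchange_energy p k u f) + pmf p k / (2 * \<beta>)"
proof -
  have bd: "exchange_term p k u f \<in> bounded_fun" "exchange_energy p k u f \<in> bounded_fun"
    by (intro moving_local_bounded_fun moving_local_exchange_term moving_local_exchange_energy f)+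
  have *: "\<bar>exchange_term p k u f z\<bar> \<le> \<beta> / 2 * exchange_energy p k u f z + pmf p k / (2 * \<beta>)" for z
  proof -
    obtain x \<eta> where z: "z = (x, \<eta>)" by (cases z)
    let ?d = "f (x, exchange \<eta> (x + u) (x + u + k)) - f (x, \<eta>)"
    have "\<bar>?d\<bar> \<le> \<beta> / 2 * ?d\<^sup>2 + 1 / (2 * \<beta>)" using weighted_am_gm[OF b, of ?d 1] by simp
    from mult_left_mono[OF this, of "pmf p k"]
    have "pmf p k * \<bar>?d\<bar> \<le> \<beta> / 2 * (pmf p k * ?d\<^sup>2) + pmf p k / (2 * \<beta>)" by (simp add: algebra_simps)
    then show ?thesis
      using b u by (auto simp: z exchange_term_def exchange_energy_def of_bool_def abs_mult)
  qed
  have "\<bar>env_mean \<rho> (exchange_term p k u f)\<bar> \<le> env_mean \<rho> (\<lambda>z. \<beta> / 2 * exchange_energy p k u f z + pmf p k / (2 * \<beta>))"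
  proof (rule abs_leI)
    show "env_mean \<rho> (exchange_term p k u f) \<le> env_mean \<rho> (\<lambda>z. \<beta> / 2 * exchange_energy p k u f z + pmf p k / (2 * \<beta>))"
      by (intro env_mean_mono bd bounded_fun_add bounded_fun_cmult bounded_fun_const order_trans[OF abs_ge_self *])
    have "env_mean \<rho> (\<lambda>z. (-1) * exchange_term p k u f z) \<le> env_mean \<rho> (\<lambda>z. \<beta> / 2 * exchange_energy p k u f z + pmf p k / (2 * \<beta>))"
    proof (intro env_mean_mono bd bounded_fun_add bounded_fun_cmult bounded_fun_const)
      show "(-1) * exchange_term p k u f z \<le> \<beta> / 2 * exchange_energy p k u f z + pmf p k / (2 * \<beta>)" for z
        using *[of z] by linarith
    qed
    then show "- env_mean \<rho> (exchange_term p k u f) \<le> env_mean \<rho> (\<lambda>z. \<beta> / 2 * exchange_energy p k u f z + pmf p k / (2 * \<beta>))"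
      unfolding env_mean_cmult by simp
  qed
  also have "\<dots> = \<beta> / 2 * env_mean \<rho> (exchange_energy p k u f) + pmf p k / (2 * \<beta>)"
    using bd by (simp only: env_mean_add bounded_fun_cmult bounded_fun_const env_mean_cmult env_mean_const)
  finally show ?thesis
    unfolding env_mean_exchange_term[OF f u] by (simp add: abs_mult)
qed

definition ray :: "int ^ 'd \<Rightarrow> nat \<Rightarrow> int ^ 'd::finite" where
  "ray k j = (\<chi> i. int (Suc j) * k $ i)"

lemma ray_0: "ray k 0 = k"
  by (simp add: ray_def vec_eq_iff)

lemma ray_Suc: "ray k j + k = ray k (Suc j)"
  by (simp add: ray_def vec_eq_iff algebra_simps)

lemma ray_nonzero: "k \<noteq> 0 \<Longrightarrow> ray k j \<noteq> 0"
  by (auto simp: ray_def vec_eq_iff)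

lemma inj_ray: "k \<noteq> 0 \<Longrightarrow> inj (ray k)"
  by (auto simp: ray_def vec_eq_iff inj_def)

text \<open>The sites of the ray are distinct and differ from the origin, so the centred occupations
  are uncorrelated and only the diagonal of the double sum survives.\<close>

lemma ray_average_variance:
  assumes r: "0 \<le> \<rho>" "\<rho> \<le> 1" and k: "k \<noteq> 0" and N: "0 < N"
  shows "env_mean \<rho> (\<lambda>z. ((\<Sum>j<N. occupied (ray k j) z - \<rho>) / real N)\<^sup>2) \<le> 1 / real N"
proof -
  let ?c = "\<lambda>j z. occupied (ray k j) z - \<rho>"
  have ml: "?c j \<in> moving_local" for j by (intro moving_local_diff moving_local_occupied moving_local_const)
  have bd: "(\<lambda>z. ?c i z * ?c j z) \<in> bounded_fun" for i j
    by (intro moving_local_bounded_fun moving_local_mult ml)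
  have c1: "\<bar>?c j z\<bar> \<le> 1" for j z using r occupied_bounds[of "ray k j" z] by (simp add: abs_le_iff)
  have diag: "env_mean \<rho> (\<lambda>z. ?c i z * ?c i z) \<le> 1" for i
  proof -
    have "\<bar>?c i z * ?c i z\<bar> \<le> 1" for z unfolding abs_mult using mult_mono[OF c1 c1, of i z i z] by simp
    from env_mean_bound[OF bd[of i i] this, of \<rho>] show ?thesis by linarith
  qed
  have off: "env_mean \<rho> (\<lambda>z. ?c i z * ?c j z) = 0" if "i \<noteq> j" for i j
  proof -
    have ne: "ray k i \<noteq> ray k j" using inj_ray[OF k] that by (auto dest: injD)
    have "(\<integral>\<xi>. (of_bool (\<xi> (ray k i)) - \<rho>) * ?c j (0, \<xi>) \<partial>bernoulli_tagged \<rho>) = 0"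
    proof (rule integral_centred_occupation[OF r])
      show "ray k i \<noteq> 0" using k by (rule ray_nonzero)
      show "(\<lambda>\<xi>. ?c j (0, \<xi>)) \<in> borel_measurable config_space"
        by (rule moving_local_measurable_origin[OF ml])
      show "\<bar>?c j (0, \<xi>)\<bar> \<le> 1" for \<xi> by (rule c1)
      show "?c j (0, \<xi>(ray k i := b)) = ?c j (0, \<xi>)" for \<xi> b using ne by (auto simp: occupied_def)
    qed
    then show ?thesis by (simp add: env_mean_def occupied_def)
  qed
  have "(\<lambda>z. ((\<Sum>j<N. ?c j z) / real N)\<^sup>2) = (\<lambda>z. (1 / (real N)\<^sup>2) * (\<Sum>i<N. \<Sum>j<N. ?c i z * ?c j z))"
    by (simp add: fun_eq_iff power_divide power2_eq_square sum_product)
  then have "env_mean \<rho> (\<lambda>z. ((\<Sum>j<N. ?c j z) / real N)\<^sup>2) = 1 / (real N)\<^sup>2 * (\<Sum>i<N. \<Sum>j<N. env_mean \<rho> (\<lambda>z. ?c i z * ?c j z))"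
    by (simp only: env_mean_cmult env_mean_sum bd bounded_fun_sum)
  also have "(\<Sum>i<N. \<Sum>j<N. env_mean \<rho> (\<lambda>z. ?c i z * ?c j z)) = (\<Sum>i<N. env_mean \<rho> (\<lambda>z. ?c i z * ?c i z))"
  proof (rule sum.cong[OF refl])
    fix i assume i: "i \<in> {..<N}"
    have "(\<Sum>j<N. env_mean \<rho> (\<lambda>z. ?c i z * ?c j z)) = (\<Sum>j\<in>{i}. env_mean \<rho> (\<lambda>z. ?c i z * ?c j z))"
      by (rule sum.mono_neutral_right) (use i off in auto)
    then show "(\<Sum>j<N. env_mean \<rho> (\<lambda>z. ?c i z * ?c j z)) = env_mean \<rho> (\<lambda>z. ?c i z * ?c i z)" by simp
  qed
  also have "\<dots> \<le> (\<Sum>i<N. 1)" by (intro sum_mono diag)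
  finally have "env_mean \<rho> (\<lambda>z. ((\<Sum>j<N. ?c j z) / real N)\<^sup>2) \<le> 1 / (real N)\<^sup>2 * real N"
    by (simp add: divide_right_mono)
  then show ?thesis using N by (simp add: power2_eq_square)
qed

text \<open>The static counterpart of spreading out mass: the occupation of \<open>k\<close> is compared with the
  average over \<open>N\<close> sites along the ray \<open>k, 2k, 3k, \<dots>\<close>, which avoids the tagged site and whose
  bonds all carry the rate \<open>pmf p k\<close>.\<close>

lemma centred_occupation_bound:
  assumes r: "0 \<le> \<rho>" "\<rho> \<le> 1" and k: "k \<noteq> 0" and N: "0 < N" and f: "f \<in> moving_local"
    and pos: "0 < \<alpha>" "0 < \<beta>"
  shows "pmf p k * \<bar>env_mean \<rho> (\<lambda>z. (occupied k z - \<rho>) * f z)\<bar> \<le>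
    \<beta> / 2 * (\<Sum>j<N. env_mean \<rho> (exchange_energy p k (ray k j) f)) + pmf p k * real N / (2 * \<beta>) +
    pmf p k * (\<alpha> / 2 * env_mean \<rho> (\<lambda>z. f z * f z) + 1 / (2 * \<alpha> * real N))"
proof -
  define q where "q = (\<lambda>j. env_mean \<rho> (\<lambda>z. occupied (ray k j) z * f z))"
  define E where "E = (\<lambda>j. env_mean \<rho> (exchange_energy p k (ray k j) f))"
  define a where "a = (\<lambda>z. (\<Sum>j<N. occupied (ray k j) z - \<rho>) / real N)"
  have bf: "f \<in> bounded_fun" "(\<lambda>z. occupied u z * f z) \<in> bounded_fun" "(\<lambda>z. (occupied u z - \<rho>) * f z) \<in> bounded_fun" for u
    by (intro moving_local_bounded_fun moving_local_mult moving_local_diff moving_local_const moving_local_occupied f)+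
  have E0: "0 \<le> E j" for j
    unfolding E_def env_mean_def by (intro integral_nonneg_AE AE_I2) (rule exchange_energy_nonneg)
  have qc: "env_mean \<rho> (\<lambda>z. (occupied (ray k j) z - \<rho>) * f z) = q j - \<rho> * env_mean \<rho> f" for j
    unfolding q_def left_diff_distrib using bf by (simp add: env_mean_diff env_mean_cmult bounded_fun_cmult)
  have step: "pmf p k * \<bar>q (Suc j) - q j\<bar> \<le> \<beta> / 2 * E j + pmf p k / (2 * \<beta>)" for j
    unfolding q_def E_def ray_Suc[symmetric]
    by (rule occupied_difference_bound[OF f pos(2)]) (use ray_nonzero[OF k] ray_Suc[of k j] in auto)
  have dist: "pmf p k * \<bar>q 0 - q j\<bar> \<le> \<beta> / 2 * (\<Sum>i<j. E i) + pmf p k * real j / (2 * \<beta>)" for j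
  proof (induction j)
    case (Suc j)
    have "pmf p k * \<bar>q 0 - q (Suc j)\<bar> \<le> pmf p k * (\<bar>q 0 - q j\<bar> + \<bar>q (Suc j) - q j\<bar>)"
      by (intro mult_left_mono) auto
    with Suc step[of j] show ?case by (simp add: algebra_simps add_divide_distrib)
  qed simp
  define B where "B = \<beta> / 2 * (\<Sum>j<N. E j) + pmf p k * real N / (2 * \<beta>)"
  have distN: "pmf p k * \<bar>q 0 - q j\<bar> \<le> B" if "j < N" for j
  proof -
    have "(\<Sum>i<j. E i) \<le> (\<Sum>i<N. E i)" using that E0 by (intro sum_mono2) auto
    moreover have "pmf p k * real j / (2 * \<beta>) \<le> pmf p k * real N / (2 * \<beta>)"
      using that pos by (intro divide_right_mono mult_left_mono) auto
    ultimately show ?thesis using dist[of j] pos unfolding B_def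
      by (smt (verit, best) mult_left_mono divide_nonneg_nonneg)
  qed
  have mean: "env_mean \<rho> (\<lambda>z. a z * f z) = (\<Sum>j<N. q j - \<rho> * env_mean \<rho> f) / real N"
  proof -
    have "(\<lambda>z. a z * f z) = (\<lambda>z. (1 / real N) * (\<Sum>j<N. (occupied (ray k j) z - \<rho>) * f z))"
      by (simp add: a_def sum_distrib_right fun_eq_iff)
    then have "env_mean \<rho> (\<lambda>z. a z * f z) = (1 / real N) * (\<Sum>j<N. env_mean \<rho> (\<lambda>z. (occupied (ray k j) z - \<rho>) * f z))"
      by (simp only: env_mean_cmult env_mean_sum bf)
    then show ?thesis by (simp add: qc)
  qed
  \<comment> \<open>The correlation at \<open>k\<close> is the average of its differences to the
    other sites of the ray, paid for by energy, plus the correlation with the ray average, paid for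
    by its small variance.\<close>
  have q0: "q 0 - \<rho> * env_mean \<rho> f = (\<Sum>j<N. q 0 - q j) / real N + env_mean \<rho> (\<lambda>z. a z * f z)"
    unfolding mean using N by (simp add: sum_subtractf field_simps)
  have "pmf p k * \<bar>(\<Sum>j<N. q 0 - q j) / real N\<bar> \<le> B"
  proof -
    have "pmf p k * \<bar>\<Sum>j<N. q 0 - q j\<bar> \<le> (\<Sum>j<N. pmf p k * \<bar>q 0 - q j\<bar>)"
      unfolding sum_distrib_left[symmetric] by (intro mult_left_mono sum_abs) auto
    also have "\<dots> \<le> (\<Sum>j<N. B)" by (intro sum_mono distN) auto
    finally show ?thesis using N by (simp add: field_simps)
  qed
  moreover have "\<bar>env_mean \<rho> (\<lambda>z. a z * f z)\<bar> \<le> \<alpha> / 2 * env_mean \<rho> (\<lambda>z. f z * f z) + 1 / (2 * \<alpha> * real N)"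
  proof -
    have aml: "a \<in> moving_local" unfolding a_def divide_inverse
      by (intro moving_local_mult moving_local_sum moving_local_const moving_local_diff moving_local_occupied)
    have b: "(\<lambda>z. a z * f z) \<in> bounded_fun" "(\<lambda>z. f z * f z) \<in> bounded_fun" "(\<lambda>z. (a z)\<^sup>2) \<in> bounded_fun"
      unfolding power2_eq_square by (intro moving_local_bounded_fun moving_local_mult aml f)+
    have *: "\<bar>a z * f z\<bar> \<le> \<alpha> / 2 * (f z * f z) + 1 / (2 * \<alpha>) * (a z)\<^sup>2" for z
      using weighted_am_gm[OF pos(1), of "f z" "a z"] by (simp add: power2_eq_square mult.commute)
    have rhs: "(\<lambda>z. \<alpha> / 2 * (f z * f z) + 1 / (2 * \<alpha>) * (a z)\<^sup>2) \<in> bounded_fun"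
      by (intro bounded_fun_add bounded_fun_cmult b)
    have "env_mean \<rho> (\<lambda>z. a z * f z) \<le> env_mean \<rho> (\<lambda>z. \<alpha> / 2 * (f z * f z) + 1 / (2 * \<alpha>) * (a z)\<^sup>2)"
      by (intro env_mean_mono b rhs order_trans[OF abs_ge_self *])
    moreover have "env_mean \<rho> (\<lambda>z. (-1) * (a z * f z)) \<le> env_mean \<rho> (\<lambda>z. \<alpha> / 2 * (f z * f z) + 1 / (2 * \<alpha>) * (a z)\<^sup>2)"
    proof (intro env_mean_mono bounded_fun_cmult b rhs)
      show "(-1) * (a z * f z) \<le> \<alpha> / 2 * (f z * f z) + 1 / (2 * \<alpha>) * (a z)\<^sup>2" for z
        using *[of z] by linarith
    qed
    moreover have "env_mean \<rho> (\<lambda>z. \<alpha> / 2 * (f z * f z) + 1 / (2 * \<alpha>) * (a z)\<^sup>2) =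
        \<alpha> / 2 * env_mean \<rho> (\<lambda>z. f z * f z) + 1 / (2 * \<alpha>) * env_mean \<rho> (\<lambda>z. (a z)\<^sup>2)"
      using b by (simp only: env_mean_add bounded_fun_cmult env_mean_cmult)
    moreover have "1 / (2 * \<alpha>) * env_mean \<rho> (\<lambda>z. (a z)\<^sup>2) \<le> 1 / (2 * \<alpha>) * (1 / real N)"
      using ray_average_variance[OF r k N] pos unfolding a_def by (intro mult_left_mono) auto
    ultimately show ?thesis unfolding env_mean_cmult by (simp add: abs_le_iff)
  qed
  from mult_left_mono[OF this, of "pmf p k"] have
    "pmf p k * \<bar>env_mean \<rho> (\<lambda>z. a z * f z)\<bar> \<le> pmf p k * (\<alpha> / 2 * env_mean \<rho> (\<lambda>z. f z * f z) + 1 / (2 * \<alpha> * real N))"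
    by simp
  moreover have "pmf p k * \<bar>q 0 - \<rho> * env_mean \<rho> f\<bar> \<le>
      pmf p k * (\<bar>(\<Sum>j<N. q 0 - q j) / real N\<bar> + \<bar>env_mean \<rho> (\<lambda>z. a z * f z)\<bar>)"
    unfolding q0 by (intro mult_left_mono abs_triangle_ineq) auto
  ultimately show ?thesis
    using qc[of 0] unfolding B_def E_def ray_0 by (simp add: distrib_left)
qed

section \<open>The resolvent equation\<close>

locale stationary_semigroup = tagged_semigroup p P
  for p :: "(int ^ 'd::finite) pmf" and P +
  fixes \<rho> :: real
  assumes density: "0 \<le> \<rho>" "\<rho> \<le> 1"
begin

abbreviation "E \<equiv> env_mean \<rho>"

section \<open>Invariance under the semigroup\<close>

lemma env_mean_Lpow:
  assumes "f \<in> moving_local" "environment_fun f" "0 < k"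
  shows "E ((L ^^ k) f) = 0"
proof -
  obtain j where "k = Suc j" using assms(3) by (cases k) auto
  then show ?thesis
    using env_mean_generator[OF density finite_range Lpow_moving_local[OF assms(1), of j]
        environment_fun_generator_power[OF finite_range assms(1,2), of j]] by simp
qed

lemma environment_fun_series:
  "f \<in> moving_local \<Longrightarrow> environment_fun f \<Longrightarrow> environment_fun (series n t f)"
  unfolding series_def[abs_def]
  by (intro environment_fun_sum environment_fun_cmult environment_fun_generator_power finite_range)

lemma env_mean_series:
  assumes f: "f \<in> moving_local" "environment_fun f"
  shows "E (series (Suc n) t f) = E f"
proof -
  have "(\<lambda>z. t ^ k / fact k * (L ^^ k) f z) \<in> bounded_fun" for k
    by (intro moving_local_bounded_fun moving_local_cmult Lpow_moving_local f)
  then have "E (series (Suc n) t f) = (\<Sum>k<Suc n. t ^ k / fact k * E ((L ^^ k) f))"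
    unfolding series_def[abs_def] by (simp only: env_mean_sum env_mean_cmult)
  also have "\<dots> = (\<Sum>k<n. t ^ Suc k / fact (Suc k) * E ((L ^^ Suc k) f)) + E f"
    by (simp only: sum.lessThan_Suc_shift) simp
  also have "(\<Sum>k<n. t ^ Suc k / fact (Suc k) * E ((L ^^ Suc k) f)) = 0"
    by (intro sum.neutral ballI) (simp only: env_mean_Lpow[OF f zero_less_Suc] mult_zero_right)
  finally show ?thesis by simp
qed

text \<open>The evolved function \<open>evolve h f\<close> is not local, so the induction hypothesis
  does not apply to it. It applies to the partial sums of its series, which are local, uniformly
  close and of the same mean; this is why \<open>f\<close> is generalised and each step stays within
  the horizon.\<close>

lemma env_mean_evolve_steps:
  assumes h: "0 \<le> h" "h \<le> horizon" and f: "f \<in> moving_local" "environment_fun f"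
  shows "E (evolve (real j * h) f) = E f"
  using f
proof (induction j arbitrary: f)
  case 0
  then have "evolve 0 f = f" by (simp add: fun_eq_iff evolve_zero moving_local_bounded_fun)
  then show ?case by simp
next
  case (Suc j)
  note f = Suc.prems
  have t: "0 \<le> real j * h" using h by simp
  have bf: "f \<in> bounded_fun" using f by (intro moving_local_bounded_fun)
  have hf: "evolve h f \<in> bounded_fun" by (rule evolve_bounded_fun[OF h(1) bf])
  have ev: "evolve (real (Suc j) * h) f = evolve (real j * h) (evolve h f)"
    using evolve_semigroup[OF t h(1) bf] by (simp add: fun_eq_iff algebra_simps)
  have "\<bar>E (evolve (real (Suc j) * h) f) - E f\<bar> \<le> e" if e: "0 < e" for e
  proof -
    obtain n where n: "\<And>z. \<bar>evolve h f z - series (Suc n) h f z\<bar> \<le> e"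
      using evolve_series[OF f(1) h e] by (meson le_SucI order_refl)
    let ?s = "series (Suc n) h f"
    have s: "?s \<in> moving_local" "environment_fun ?s"
      using f by (auto intro: series_moving_local environment_fun_series)
    have bs: "?s \<in> bounded_fun" by (rule moving_local_bounded_fun[OF s(1)])
    have "\<bar>E (\<lambda>z. evolve (real j * h) (\<lambda>z. evolve h f z - ?s z) z)\<bar> \<le> e"
      by (intro env_mean_bound evolve_bounded_fun evolve_bound t bounded_fun_diff hf bs n)
    also have "E (\<lambda>z. evolve (real j * h) (\<lambda>z. evolve h f z - ?s z) z) =
        E (evolve (real j * h) (evolve h f)) - E (evolve (real j * h) ?s)"
      by (simp add: evolve_diff[OF t hf bs] env_mean_diff evolve_bounded_fun t hf bs)
    also have "E (evolve (real j * h) ?s) = E f"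
      using Suc.IH[OF s] env_mean_series[OF f] by simp
    finally show ?thesis unfolding ev .
  qed
  then show ?case by (metis abs_le_zero_iff eq_iff_diff_eq_0 field_le_epsilon add_0)
qed

lemma env_mean_evolve:
  assumes t: "0 \<le> t" and f: "f \<in> moving_local" "environment_fun f"
  shows "E (evolve t f) = E f"
proof -
  obtain m where m: "t / horizon < real m" using reals_Archimedean2 by blast
  define h where "h = t / real (Suc m)"
  have "t / horizon < real (Suc m)" using m by simp
  then have h: "0 \<le> h" "h \<le> horizon" "real (Suc m) * h = t"
    using t horizon_pos by (auto simp: h_def field_simps)
  show ?thesis using env_mean_evolve_steps[OF h(1,2) f, of "Suc m"] unfolding h(3) .
qed

lemma evolve_square_le:
  assumes t: "0 \<le> t" and f: "f \<in> bounded_fun"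
  shows "(evolve t f z)\<^sup>2 \<le> evolve t (\<lambda>z. f z * f z) z"
proof -
  let ?c = "evolve t f z"
  have ff: "(\<lambda>z. f z * f z) \<in> bounded_fun" by (rule bounded_fun_mult[OF f f])
  have "evolve t (\<lambda>_. 0) z \<le> evolve t (\<lambda>z'. (f z' * f z' - (2 * ?c) * f z') + ?c\<^sup>2) z"
  proof (rule evolve_mono[OF t])
    fix z'
    have "0 \<le> (f z' - ?c)\<^sup>2" by simp
    then show "0 \<le> (f z' * f z' - (2 * ?c) * f z') + ?c\<^sup>2" by (simp add: power2_eq_square algebra_simps)
  qed (intro bounded_fun_add bounded_fun_diff bounded_fun_cmult bounded_fun_const ff f)+
  also have "\<dots> = evolve t (\<lambda>z. f z * f z) z - (2 * ?c) * ?c + ?c\<^sup>2"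
    by (simp add: evolve_add evolve_diff evolve_cmult evolve_const t ff f bounded_fun_diff bounded_fun_cmult)
  finally show ?thesis by (simp add: evolve_const[OF t] power2_eq_square)
qed

text \<open>Invariance is available for local functions only. Jensen's inequality moves the square
  inside the evolution, where it acts on the local function \<open>f\<close>.\<close>

lemma env_mean_evolve_square_le:
  assumes t: "0 \<le> t" "0 \<le> s" and f: "f \<in> moving_local" "environment_fun f"
  shows "E (evolve s (\<lambda>z. (evolve t f z)\<^sup>2)) \<le> E (\<lambda>z. f z * f z)"
proof -
  have bf: "f \<in> bounded_fun" "evolve t f \<in> bounded_fun" "(\<lambda>z. f z * f z) \<in> bounded_fun"
    by (intro moving_local_bounded_fun evolve_bounded_fun moving_local_mult t f)+
  have b2: "(\<lambda>z. (evolve t f z)\<^sup>2) \<in> bounded_fun" unfolding power2_eq_square by (rule bounded_fun_mult[OF bf(2,2)])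
  have "E (evolve s (\<lambda>z. (evolve t f z)\<^sup>2)) \<le> E (evolve s (evolve t (\<lambda>z. f z * f z)))"
    by (intro env_mean_mono evolve_bounded_fun evolve_mono evolve_square_le t b2 bf)
  also have "evolve s (evolve t (\<lambda>z. f z * f z)) = evolve (s + t) (\<lambda>z. f z * f z)"
    using evolve_semigroup[OF t(2,1) bf(3)] by (simp add: fun_eq_iff)
  also have "E \<dots> = E (\<lambda>z. f z * f z)"
    using t f by (intro env_mean_evolve) auto
  finally show ?thesis .
qed

section \<open>Approximate solutions of the resolvent equation\<close>

text \<open>The factorisation of the polynomial \<theta>^k - L^k by \<theta> - L, built up by the
  recursion from \<open>g\<close> to \<open>\<theta> * g + (L ^^ k) f\<close>.\<close>

lemma resolvent_power:
  assumes f: "f \<in> moving_local" "environment_fun f"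
  shows "\<exists>g. g \<in> moving_local \<and> environment_fun g \<and> (\<forall>z. \<theta> * g z - L g z = \<theta> ^ k * f z - (L ^^ k) f z)"
proof (induction k)
  case 0
  then show ?case by (intro exI[of _ "\<lambda>_. 0"]) (simp add: tagged_generator_const)
next
  case (Suc k)
  then obtain g where g: "g \<in> moving_local" "environment_fun g" "\<And>z. \<theta> * g z - L g z = \<theta> ^ k * f z - (L ^^ k) f z"
    by blast
  let ?h = "(L ^^ k) f"
  have h: "?h \<in> moving_local" "environment_fun ?h"
    using f by (auto intro: Lpow_moving_local environment_fun_generator_power finite_range)
  have "\<theta> * (\<theta> * g z + 1 * ?h z) - L (\<lambda>z. \<theta> * g z + 1 * ?h z) z = \<theta> ^ Suc k * f z - (L ^^ Suc k) f z" for z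
  proof -
    have "L (\<lambda>z. \<theta> * g z + 1 * ?h z) z = \<theta> * L g z + 1 * L ?h z"
      by (rule tagged_generator_linear[OF finite_range g(1) h(1)])
    moreover have "\<theta> * (\<theta> * g z - L g z) = \<theta> * (\<theta> ^ k * f z - ?h z)" using g(3) by simp
    ultimately show ?thesis by (simp add: algebra_simps)
  qed
  moreover have "(\<lambda>z. \<theta> * g z + 1 * ?h z) \<in> moving_local" "environment_fun (\<lambda>z. \<theta> * g z + 1 * ?h z)"
    using g h by (intro moving_local_add moving_local_cmult environment_fun_add environment_fun_cmult; simp)+
  ultimately show ?case by blast
qed

text \<open>Modulo the range of \<open>\<theta> - L\<close> the operator \<open>L\<close> acts as multiplication by \<open>\<theta>\<close>, so that \<open>f\<close> is
  congruent to \<open>exp (- \<theta> h)\<close> times the contraction \<open>exp (h L) f\<close>.\<close>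

lemma resolvent_contraction:
  assumes l: "0 < \<theta>" and f: "f \<in> moving_local" "environment_fun f" and c: "0 < c" "\<And>z. \<bar>f z\<bar> \<le> c"
  shows "\<exists>g. g \<in> moving_local \<and> environment_fun g \<and>
    (\<forall>z. \<bar>f z - (\<theta> * g z - L g z)\<bar> \<le> (1 + \<theta> * horizon / 2) / (1 + \<theta> * horizon) * c)"
proof -
  let ?h = horizon
  \<comment> \<open>Chosen so that \<open>c + \<eta>\<close> is
    \<open>c * (1 + \<theta> * ?h / 2)\<close>: half of the gain from the denominator
    \<open>1 + \<theta> * ?h\<close> is left.\<close>
  define \<eta> where "\<eta> = c * \<theta> * ?h / 2"
  have \<eta>: "0 < \<eta>" using l c horizon_pos by (simp add: \<eta>_def)
  obtain n0 where n0: "\<And>n z. n \<ge> n0 \<Longrightarrow> \<bar>evolve ?h f z - series n ?h f z\<bar> \<le> \<eta>"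
    using evolve_series[OF f(1) _ order_refl \<eta>] horizon_pos by (meson less_imp_le)
  define n where "n = n0 + 2"
  have s: "\<bar>series n ?h f z\<bar> \<le> c + \<eta>" for z
  proof -
    have "\<bar>evolve ?h f z\<bar> \<le> c"
      using horizon_pos by (intro evolve_bound moving_local_bounded_fun f c) auto
    moreover have "\<bar>evolve ?h f z - series n ?h f z\<bar> \<le> \<eta>" by (rule n0) (simp add: n_def)
    ultimately show ?thesis by linarith
  qed
  have "\<forall>k. \<exists>g. g \<in> moving_local \<and> environment_fun g \<and> (\<forall>z. \<theta> * g z - L g z = \<theta> ^ k * f z - (L ^^ k) f z)"
    using resolvent_power[OF f] by blast
  then obtain g where g: "\<And>k. g k \<in> moving_local" "\<And>k. environment_fun (g k)"
    "\<And>k z. \<theta> * g k z - L (g k) z = \<theta> ^ k * f z - (L ^^ k) f z" by metis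
  define G where "G = (\<lambda>z. \<Sum>k<n. ?h ^ k / fact k * g k z)"
  define e where "e = (\<Sum>k<n. ?h ^ k / fact k * \<theta> ^ k)"
  have ml: "(\<lambda>z. ?h ^ k / fact k * g k z) \<in> moving_local" "environment_fun (\<lambda>z. ?h ^ k / fact k * g k z)" for k
    by (intro moving_local_cmult environment_fun_cmult g)+
  have G: "G \<in> moving_local" "environment_fun G"
    unfolding G_def by (intro moving_local_sum environment_fun_sum ml)+
  have LG: "\<theta> * G z - L G z = e * f z - series n ?h f z" for z
  proof -
    have "L G z = (\<Sum>k<n. ?h ^ k / fact k * L (g k) z)"
      unfolding G_def by (simp only: tagged_generator_sum[OF finite_range ml(1)] tagged_generator_cmult[OF finite_range g(1)])
    then have "\<theta> * G z - L G z = (\<Sum>k<n. ?h ^ k / fact k * (\<theta> * g k z - L (g k) z))"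
      by (simp add: G_def sum_distrib_left sum_subtractf algebra_simps)
    also have "\<dots> = e * f z - series n ?h f z"
      unfolding g(3) e_def series_def sum_distrib_right sum_subtractf[symmetric]
      by (intro sum.cong refl) (simp add: algebra_simps)
    finally show ?thesis .
  qed
  \<comment> \<open>The first two terms of the scalar exponential series already exceed one; this is
    what the summand 2 in \<open>n\<close> is for.\<close>
  have "(\<Sum>k<2. ?h ^ k / fact k * \<theta> ^ k) \<le> e"
    unfolding e_def using l horizon_pos by (intro sum_mono2) (auto simp: n_def)
  then have e: "1 + \<theta> * ?h \<le> e" by (simp add: numeral_2_eq_2 mult.commute)
  have e1: "0 < 1 + \<theta> * ?h" using l horizon_pos by (simp add: add_pos_pos)
  have "\<bar>f z - (\<theta> * (1 / e * G z) - L (\<lambda>z. 1 / e * G z) z)\<bar> \<le> (1 + \<theta> * ?h / 2) / (1 + \<theta> * ?h) * c" for z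
  proof -
    have "f z - (\<theta> * (1 / e * G z) - L (\<lambda>z. 1 / e * G z) z) = f z - 1 / e * (\<theta> * G z - L G z)"
      unfolding tagged_generator_cmult[OF finite_range G(1)] by (simp add: algebra_simps)
    also have "\<dots> = series n ?h f z / e"
      unfolding LG using e e1 by (simp add: field_simps)
    also have "\<bar>\<dots>\<bar> \<le> (c + \<eta>) / (1 + \<theta> * ?h)"
      unfolding abs_divide using s[of z] e e1 c \<eta> by (intro frac_le) auto
    also have "\<dots> = (1 + \<theta> * ?h / 2) / (1 + \<theta> * ?h) * c"
      by (simp add: \<eta>_def algebra_simps add_divide_distrib)
    finally show ?thesis .
  qed
  with G show ?thesis
    by (intro exI[of _ "\<lambda>z. 1 / e * G z"] conjI allI moving_local_cmult environment_fun_cmult)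
qed

text \<open>The residual of each approximate solution is again local, so the contraction can be
  applied to it. The residuals decay geometrically; nothing is claimed about convergence of the
  solutions themselves.\<close>

lemma resolvent_dense:
  assumes l: "0 < \<theta>" and f: "f \<in> moving_local" "environment_fun f" and e: "0 < \<epsilon>"
  obtains g where "g \<in> moving_local" "environment_fun g" "\<And>z. \<bar>\<theta> * g z - L g z - f z\<bar> \<le> \<epsilon>"
proof -
  define \<kappa> where "\<kappa> = (1 + \<theta> * horizon / 2) / (1 + \<theta> * horizon)"
  have lh: "0 < \<theta> * horizon" using l horizon_pos by simp
  then have \<kappa>: "0 < \<kappa>" "\<kappa> < 1" by (auto simp: \<kappa>_def field_simps add_pos_pos)
  obtain c0 where c0: "0 \<le> c0" "\<And>z. \<bar>f z\<bar> \<le> c0" using bounded_funE[OF moving_local_bounded_fun[OF f(1)]] by blast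
  define c where "c = c0 + 1"
  have "\<bar>f z\<bar> \<le> c" for z using c0(2)[of z] by (simp add: c_def)
  moreover have "0 < c" using c0(1) by (simp add: c_def)
  ultimately have c: "0 < c" "\<And>z. \<bar>f z\<bar> \<le> c" by auto
  have "\<exists>g. g \<in> moving_local \<and> environment_fun g \<and> (\<forall>z. \<bar>f z - (\<theta> * g z - L g z)\<bar> \<le> \<kappa> ^ n * c)" for n
  proof (induction n)
    case 0
    show ?case using c by (intro exI[of _ "\<lambda>_. 0"]) (simp add: tagged_generator_const)
  next
    case (Suc n)
    then obtain g where g: "g \<in> moving_local" "environment_fun g" "\<And>z. \<bar>f z - (\<theta> * g z - L g z)\<bar> \<le> \<kappa> ^ n * c"
      by blast
    let ?f = "\<lambda>z. f z - (\<theta> * g z - L g z)"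
    have ff: "?f \<in> moving_local" "environment_fun ?f"
      by (intro moving_local_diff moving_local_cmult environment_fun_diff environment_fun_cmult
          L_moving_local L_environment_fun f g)+
    have "0 < \<kappa> ^ n * c" using \<kappa> c by simp
    from resolvent_contraction[OF l ff this g(3)] obtain g' where g': "g' \<in> moving_local" "environment_fun g'"
      "\<And>z. \<bar>?f z - (\<theta> * g' z - L g' z)\<bar> \<le> \<kappa> * (\<kappa> ^ n * c)" unfolding \<kappa>_def by blast
    have "\<bar>f z - (\<theta> * (g z + g' z) - L (\<lambda>z. g z + g' z) z)\<bar> \<le> \<kappa> ^ Suc n * c" for z
      using g'(3)[of z] tagged_generator_add[OF finite_range g(1) g'(1), of z] by (simp add: algebra_simps)
    then show ?case using g g' by (intro exI[of _ "\<lambda>z. g z + g' z"] conjI allI moving_local_add environment_fun_add)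
  qed
  moreover have "(\<lambda>n. \<kappa> ^ n * c) \<longlonglongrightarrow> 0 * c"
    using \<kappa> by (intro tendsto_intros LIMSEQ_power_zero) auto
  then have "\<forall>\<^sub>F n in sequentially. \<kappa> ^ n * c < \<epsilon>" using e by (intro order_tendstoD(2)[of _ "0"]) auto
  then obtain n where "\<kappa> ^ n * c < \<epsilon>" by (auto simp: eventually_sequentially)
  ultimately obtain g where "g \<in> moving_local" "environment_fun g" "\<And>z. \<bar>f z - (\<theta> * g z - L g z)\<bar> \<le> \<epsilon>"
    by (meson less_imp_le order_trans)
  then show ?thesis by (intro that[of g]) (auto simp: abs_minus_commute)
qed

section \<open>The corrector of the drift\<close>

definition drift :: "'d \<Rightarrow> 'd tagged_state \<Rightarrow> real" where
  "drift i z = (\<Sum>k\<in>set_pmf p. pmf p k * real_of_int (k $ i) * (1 - occupied k z))"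

definition speed :: "'d \<Rightarrow> real" where
  "speed i = (1 - \<rho>) * (\<Sum>k\<in>set_pmf p. pmf p k * real_of_int (k $ i))"

lemma drift_moving_local: "drift i \<in> moving_local"
  unfolding drift_def[abs_def] by (intro moving_local_sum moving_local_cmult moving_local_diff moving_local_const moving_local_occupied)

lemma drift_environment_fun: "environment_fun (drift i)"
  unfolding drift_def[abs_def]
  by (intro environment_fun_sum environment_fun_cmult environment_fun_diff environment_fun_const environment_fun_occupied)

text \<open>The added 1 keeps the bound positive when the only jump is zero, so that it may stand in
  a denominator.\<close>

definition range_bound :: real where "range_bound = jump_size + 1"

lemma range_bound_ge: "1 \<le> range_bound" "k \<in> set_pmf p \<Longrightarrow> \<bar>real_of_int (k $ i)\<bar> \<le> range_bound"
proof -
  show "1 \<le> range_bound" unfolding range_bound_def jump_size_def by (simp add: sum_nonneg vec_norm1_nonneg)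
  assume "k \<in> set_pmf p"
  then have "vec_norm1 k \<le> jump_size"
    unfolding jump_size_def by (intro member_le_sum vec_norm1_nonneg finite_range)
  then show "\<bar>real_of_int (k $ i)\<bar> \<le> range_bound"
    using vec_nth_le_vec_norm1[of k i] by (simp add: range_bound_def)
qed

text \<open>The centred drift is a linear combination of centred occupations of the sites in the
  support of \<open>p\<close>, so \<open>centred_occupation_bound\<close> applies to each of them
  and the energies of all rays are charged to one Dirichlet form.\<close>

lemma drift_pairing_bound:
  assumes f: "f \<in> moving_local" "environment_fun f" and N: "0 < N" and l: "0 < \<theta>"
  shows "\<bar>E (\<lambda>z. (drift i z - speed i) * f z)\<bar> \<le>
    - E (\<lambda>z. f z * L f z) + range_bound\<^sup>2 * real N / 2 + \<theta> / 4 * E (\<lambda>z. f z * f z) + range_bound\<^sup>2 / (\<theta> * real N)"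
proof -
  let ?R = range_bound
  \<comment> \<open>The zero jump contributes nothing to the drift, and its ray would sit on the
    tagged site.\<close>
  define K where "K = set_pmf p - {0}"
  have K: "K \<subseteq> set_pmf p" "finite K" using finite_range by (auto simp: K_def)
  have R: "0 < ?R" using range_bound_ge(1) by linarith
  \<comment> \<open>With this choice the energy term becomes exactly the Dirichlet form with
    coefficient 1, which cancels in \<open>resolvent_energy\<close>. The choice of
    \<open>\<alpha>\<close> leaves \<open>\<theta> / 4\<close> of the squared norm, to be absorbed
    there.\<close>
  define \<beta> where "\<beta> = 1 / ?R"
  define \<alpha> where "\<alpha> = \<theta> / (2 * ?R)"
  have pos: "0 < \<beta>" "0 < \<alpha>" using R l by (auto simp: \<beta>_def \<alpha>_def)
  define A where "A = (\<lambda>k. E (\<lambda>z. (occupied k z - \<rho>) * f z))"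
  define G where "G = E (\<lambda>z. f z * f z)"
  define En where "En = (\<lambda>k. \<Sum>j<N. E (exchange_energy p k (ray k j) f))"
  have bf: "(\<lambda>z. (occupied u z - \<rho>) * f z) \<in> bounded_fun" for u
    by (intro moving_local_bounded_fun moving_local_mult moving_local_diff moving_local_const moving_local_occupied f)
  have "(\<lambda>z. (drift i z - speed i) * f z) =
      (\<lambda>z. \<Sum>k\<in>set_pmf p. (- (pmf p k * real_of_int (k $ i))) * ((occupied k z - \<rho>) * f z))"
  proof
    fix z
    have "drift i z - speed i = (\<Sum>k\<in>set_pmf p. (- (pmf p k * real_of_int (k $ i))) * (occupied k z - \<rho>))"
      unfolding drift_def speed_def sum_distrib_left sum_subtractf[symmetric]
      by (intro sum.cong refl) (simp add: algebra_simps)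
    then show "(drift i z - speed i) * f z = (\<Sum>k\<in>set_pmf p. (- (pmf p k * real_of_int (k $ i))) * ((occupied k z - \<rho>) * f z))"
      by (simp add: sum_distrib_right mult.assoc)
  qed
  then have "E (\<lambda>z. (drift i z - speed i) * f z) = (\<Sum>k\<in>set_pmf p. (- (pmf p k * real_of_int (k $ i))) * A k)"
    by (simp only: env_mean_sum env_mean_cmult bf bounded_fun_cmult A_def)
  also have "\<dots> = (\<Sum>k\<in>K. (- (pmf p k * real_of_int (k $ i))) * A k)"
    by (rule sum.mono_neutral_right) (use finite_range in \<open>auto simp: K_def\<close>)
  also have "\<bar>\<dots>\<bar> \<le> (\<Sum>k\<in>K. ?R * (pmf p k * \<bar>A k\<bar>))"
  proof (rule order_trans[OF sum_abs sum_mono])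
    fix k assume "k \<in> K"
    then have "\<bar>real_of_int (k $ i)\<bar> \<le> ?R" using range_bound_ge(2) K by blast
    from mult_right_mono[OF this, of "pmf p k * \<bar>A k\<bar>"]
    show "\<bar>(- (pmf p k * real_of_int (k $ i))) * A k\<bar> \<le> ?R * (pmf p k * \<bar>A k\<bar>)"
      by (simp add: abs_mult mult_ac)
  qed
  also have "\<dots> \<le> (\<Sum>k\<in>K. ?R * (\<beta> / 2 * En k + pmf p k * real N / (2 * \<beta>) + pmf p k * (\<alpha> / 2 * G + 1 / (2 * \<alpha> * real N))))"
    unfolding A_def G_def En_def using R
    by (intro sum_mono mult_left_mono centred_occupation_bound density N f pos) (auto simp: K_def)
  also have "\<dots> = ?R * (\<beta> / 2 * (\<Sum>k\<in>K. En k) + (\<Sum>k\<in>K. pmf p k) * (real N / (2 * \<beta>) + (\<alpha> / 2 * G + 1 / (2 * \<alpha> * real N))))"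
  proof -
    define W where "W = real N / (2 * \<beta>) + (\<alpha> / 2 * G + 1 / (2 * \<alpha> * real N))"
    have "(\<Sum>k\<in>K. ?R * (\<beta> / 2 * En k + pmf p k * real N / (2 * \<beta>) + pmf p k * (\<alpha> / 2 * G + 1 / (2 * \<alpha> * real N)))) =
        (\<Sum>k\<in>K. (?R * \<beta> / 2) * En k + (?R * W) * pmf p k)"
      by (intro sum.cong refl) (simp add: W_def algebra_simps)
    also have "\<dots> = (?R * \<beta> / 2) * (\<Sum>k\<in>K. En k) + (?R * W) * (\<Sum>k\<in>K. pmf p k)"
      by (simp only: sum.distrib sum_distrib_left)
    also have "\<dots> = ?R * (\<beta> / 2 * (\<Sum>k\<in>K. En k) + (\<Sum>k\<in>K. pmf p k) * W)"
      by (simp add: algebra_simps)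
    finally show ?thesis by (simp only: W_def)
  qed
  also have "\<dots> \<le> ?R * (\<beta> / 2 * (- 2 * E (\<lambda>z. f z * L f z)) + 1 * (real N / (2 * \<beta>) + (\<alpha> / 2 * G + 1 / (2 * \<alpha> * real N))))"
  proof (intro mult_left_mono add_mono mult_right_mono)
    have "(\<Sum>k\<in>K. En k) = (\<Sum>k\<in>K. \<Sum>u\<in>ray k ` {..<N}. E (exchange_energy p k u f))"
      unfolding En_def by (intro sum.cong refl, subst sum.reindex) (auto simp: K_def intro: inj_on_subset[OF inj_ray])
    also have "\<dots> \<le> - 2 * E (\<lambda>z. f z * L f z)"
      by (rule exchange_energy_le_dirichlet[OF density finite_range f K(1)]) auto
    finally show "(\<Sum>k\<in>K. En k) \<le> - 2 * E (\<lambda>z. f z * L f z)" .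
    have "(\<Sum>k\<in>K. pmf p k) \<le> (\<Sum>k\<in>set_pmf p. pmf p k)" by (intro sum_mono2 finite_range K) auto
    also have "\<dots> = 1" by (rule sum_pmf_eq_1) (use finite_range in auto)
    finally show "(\<Sum>k\<in>K. pmf p k) \<le> 1" .
    have "0 \<le> G" unfolding G_def env_mean_def by (intro integral_nonneg_AE AE_I2) simp
    then show "0 \<le> real N / (2 * \<beta>) + (\<alpha> / 2 * G + 1 / (2 * \<alpha> * real N))" using pos by simp
  qed (use R pos in auto)
  also have "\<dots> = - E (\<lambda>z. f z * L f z) + ?R\<^sup>2 * real N / 2 + \<theta> / 4 * G + ?R\<^sup>2 / (\<theta> * real N)"
    using R l N unfolding \<alpha>_def \<beta>_def by (simp add: field_simps power2_eq_square)
  finally show ?thesis unfolding G_def .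
qed

text \<open>Pairing the approximate resolvent equation with \<open>g\<close> gives
  \<open>\<theta>\<close> times the squared norm plus the Dirichlet form on one side. The drift
  pairing uses up the Dirichlet form and a quarter of the norm term, the residual another quarter;
  half is left.\<close>

lemma resolvent_energy:
  assumes g: "g \<in> moving_local" "environment_fun g" and N: "0 < N" and l: "0 < \<theta>"
    and e: "\<And>z. \<bar>\<theta> * g z - L g z - (drift i z - speed i)\<bar> \<le> \<epsilon>"
  shows "\<theta> / 2 * E (\<lambda>z. g z * g z) \<le> range_bound\<^sup>2 * real N / 2 + range_bound\<^sup>2 / (\<theta> * real N) + \<epsilon>\<^sup>2 / \<theta>"
proof -
  define r where "r = (\<lambda>z. \<theta> * g z - L g z - (drift i z - speed i))"
  have Lg: "L g \<in> moving_local" by (rule L_moving_local[OF g(1)])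
  have d: "(\<lambda>z. drift i z - speed i) \<in> moving_local" by (intro moving_local_diff drift_moving_local moving_local_const)
  have rml: "r \<in> moving_local" unfolding r_def by (intro moving_local_diff moving_local_cmult g Lg d)
  have bd: "(\<lambda>z. g z * g z) \<in> bounded_fun" "(\<lambda>z. g z * L g z) \<in> bounded_fun"
    "(\<lambda>z. (drift i z - speed i) * g z) \<in> bounded_fun" "(\<lambda>z. r z * g z) \<in> bounded_fun"
    by (intro moving_local_bounded_fun moving_local_mult g Lg d rml)+
  have "(\<lambda>z. \<theta> * (g z * g z)) = (\<lambda>z. g z * L g z + ((drift i z - speed i) * g z + r z * g z))"
    by (auto simp: r_def fun_eq_iff algebra_simps)
  then have "\<theta> * E (\<lambda>z. g z * g z) = E (\<lambda>z. g z * L g z) + (E (\<lambda>z. (drift i z - speed i) * g z) + E (\<lambda>z. r z * g z))"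
    using bd by (simp only: env_mean_cmult[symmetric] env_mean_add bounded_fun_add)
  moreover have "E (\<lambda>z. r z * g z) \<le> E (\<lambda>z. \<theta> / 4 * (g z * g z) + \<epsilon>\<^sup>2 / \<theta>)"
  proof (intro env_mean_mono bd bounded_fun_add bounded_fun_cmult bounded_fun_const)
    fix z
    have "\<bar>g z * r z\<bar> \<le> (\<theta> / 2) / 2 * (g z)\<^sup>2 + 1 / (2 * (\<theta> / 2)) * (r z)\<^sup>2"
      by (rule weighted_am_gm) (use l in simp)
    moreover have "(r z)\<^sup>2 \<le> \<epsilon>\<^sup>2" using e[of z] by (intro power2_le_iff_abs_le[THEN iffD2]) (auto simp: r_def intro: order_trans[OF abs_ge_zero])
    then have "1 / (2 * (\<theta> / 2)) * (r z)\<^sup>2 \<le> \<epsilon>\<^sup>2 / \<theta>" using l by (simp add: divide_right_mono)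
    moreover have "r z * g z \<le> \<bar>g z * r z\<bar>" by (simp add: mult.commute abs_ge_self)
    ultimately show "r z * g z \<le> \<theta> / 4 * (g z * g z) + \<epsilon>\<^sup>2 / \<theta>" by (simp add: power2_eq_square)
  qed
  moreover have "E (\<lambda>z. \<theta> / 4 * (g z * g z) + \<epsilon>\<^sup>2 / \<theta>) = \<theta> / 4 * E (\<lambda>z. g z * g z) + \<epsilon>\<^sup>2 / \<theta>"
    using bd by (simp only: env_mean_add bounded_fun_cmult bounded_fun_const env_mean_cmult env_mean_const)
  moreover have "E (\<lambda>z. (drift i z - speed i) * g z) \<le>
      - E (\<lambda>z. g z * L g z) + range_bound\<^sup>2 * real N / 2 + \<theta> / 4 * E (\<lambda>z. g z * g z) + range_bound\<^sup>2 / (\<theta> * real N)"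
    using drift_pairing_bound[OF g N l, of i] by linarith
  ultimately show ?thesis by linarith
qed

text \<open>The case \<open>\<theta> = 1 / t\<close>. The tolerance \<open>1 / sqrt t\<close>
  contributes only 1 to the energy bound.\<close>

lemma corrector:
  assumes t: "1 \<le> t"
  obtains g where "g \<in> moving_local" "environment_fun g"
    "\<And>z. \<bar>1 / t * g z - L g z - (drift i z - speed i)\<bar> \<le> 1 / sqrt t"
    "E (\<lambda>z. g z * g z) \<le> (4 * range_bound\<^sup>2 + 2) * (t * sqrt t)"
proof -
  have t0: "0 < t" "1 \<le> sqrt t" using t by auto
  obtain g where g: "g \<in> moving_local" "environment_fun g"
    "\<And>z. \<bar>1 / t * g z - L g z - (drift i z - speed i)\<bar> \<le> 1 / sqrt t"
  proof (rule resolvent_dense[of "1 / t" "\<lambda>z. drift i z - speed i" "1 / sqrt t"])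
    show "(\<lambda>z. drift i z - speed i) \<in> moving_local" "environment_fun (\<lambda>z. drift i z - speed i)"
      by (intro moving_local_diff environment_fun_diff drift_moving_local drift_environment_fun moving_local_const environment_fun_const)+
  qed (use t0 in auto)
  \<comment> \<open>This balances the terms \<open>N\<close> and \<open>t / N\<close> in the energy
    bound.\<close>
  define N where "N = nat \<lceil>sqrt t\<rceil>"
  have N: "0 < N" "sqrt t \<le> real N" "real N \<le> 2 * sqrt t"
    using t0 unfolding N_def by linarith+
  let ?R2 = "range_bound\<^sup>2"
  have "(1 / t) / 2 * E (\<lambda>z. g z * g z) \<le> ?R2 * real N / 2 + ?R2 / (1 / t * real N) + (1 / sqrt t)\<^sup>2 / (1 / t)"
    by (rule resolvent_energy[OF g(1,2) N(1) _ g(3)]) (use t0 in simp)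
  also have "\<dots> = ?R2 * real N / 2 + ?R2 * (t / real N) + 1"
    using t0 by (simp add: power_divide field_simps)
  also have "\<dots> \<le> ?R2 * sqrt t + ?R2 * sqrt t + sqrt t"
  proof (intro add_mono)
    have "?R2 * real N \<le> ?R2 * (2 * sqrt t)" by (intro mult_left_mono N) simp
    then show "?R2 * real N / 2 \<le> ?R2 * sqrt t" by simp
    have "t / real N \<le> t / sqrt t" using t0 N by (intro divide_left_mono) auto
    also have "\<dots> = sqrt t" using t0 by (simp add: real_div_sqrt)
    finally show "?R2 * (t / real N) \<le> ?R2 * sqrt t" by (intro mult_left_mono) auto
  qed (use t0 in auto)
  finally have "E (\<lambda>z. g z * g z) \<le> (2 * t) * (?R2 * sqrt t + ?R2 * sqrt t + sqrt t)"
    using t0 by (simp add: field_simps)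
  also have "\<dots> = (4 * ?R2 + 2) * (t * sqrt t)" by (simp add: algebra_simps)
  finally show ?thesis using that g by blast
qed

end

section \<open>Moments of the position\<close>

definition coord :: "'d::finite \<Rightarrow> 'd tagged_state \<Rightarrow> real" where
  "coord i z = real_of_int (fst z $ i)"

lemma coord_measurable [measurable]: "coord i \<in> borel_measurable tagged_space"
  unfolding coord_def[abs_def] by (rule tagged_space_measurable) simp

lemma position_moving_local:
  fixes F :: "int ^ 'd::finite \<Rightarrow> real"
  assumes "\<And>x. \<bar>F x\<bar> \<le> a"
  shows "(\<lambda>z. F (fst z)) \<in> moving_local"
  using assms by (intro moving_localI[of _ a "{}"]) (auto simp: depends_near_def)

text \<open>The coordinate is unbounded and hence outside \<open>moving_local\<close>. Clipping its
  value keeps it 1-Lipschitz, so the generator of the clipped coordinate is bounded independently of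
  \<open>n\<close>.\<close>

definition clip :: "nat \<Rightarrow> real \<Rightarrow> real" where
  "clip n y = max (- real n) (min (real n) y)"

lemma clip_le: "\<bar>clip n y\<bar> \<le> \<bar>y\<bar>" "\<bar>clip n y\<bar> \<le> real n"
  by (auto simp: clip_def)

lemma clip_lipschitz: "\<bar>clip n x - clip n y\<bar> \<le> \<bar>x - y\<bar>"
  by (auto simp: clip_def)

lemma clip_tendsto: "(\<lambda>n. clip n y) \<longlonglongrightarrow> y"
proof -
  obtain m where "\<bar>y\<bar> < real m" using reals_Archimedean2 by blast
  then have "\<forall>\<^sub>F n in sequentially. clip n y = y"
    by (intro eventually_sequentiallyI[of m]) (auto simp: clip_def)
  then show ?thesis by (rule tendsto_eventually)
qed

lemma clip_measurable [measurable]: "clip n \<in> borel_measurable borel"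
  unfolding clip_def[abs_def] by measurable

context tagged_semigroup
begin

text \<open>Exchanges away from the tagged particle leave its position alone: the window is empty,
  and so is its hull.\<close>

lemma generator_position:
  assumes "\<And>x. \<bar>F x\<bar> \<le> a"
  shows "L (\<lambda>z. F (fst z)) z = (\<Sum>k\<in>set_pmf p. pmf p k * (1 - occupied k z) * (F (fst z + k) - F (fst z)))"
proof -
  have "depends_near {} (\<lambda>z. F (fst z))" by (simp add: depends_near_def)
  from tagged_generator_eq[OF finite_range this, of "{}"]
  have "L (\<lambda>z. F (fst z)) z = (\<Sum>k\<in>set_pmf p. jump_term p k (\<lambda>z. F (fst z)) z)"
    by (simp add: generator_hull_def)
  also have "\<dots> = (\<Sum>k\<in>set_pmf p. pmf p k * (1 - occupied k z) * (F (fst z + k) - F (fst z)))"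
    by (intro sum.cong refl) (cases z, simp add: jump_term_def occupied_def)
  finally show ?thesis .
qed

text \<open>The weights are nonnegative with total mass at most 1.\<close>

lemma weighted_rate_bound:
  assumes "\<And>k. k \<in> set_pmf p \<Longrightarrow> \<bar>d k\<bar> \<le> c"
  shows "\<bar>\<Sum>k\<in>set_pmf p. pmf p k * (1 - occupied k z) * d k\<bar> \<le> c"
proof -
  have "\<bar>\<Sum>k\<in>set_pmf p. pmf p k * (1 - occupied k z) * d k\<bar> \<le> (\<Sum>k\<in>set_pmf p. pmf p k * c)"
  proof (rule order_trans[OF sum_abs sum_mono])
    fix k assume "k \<in> set_pmf p"
    have "\<bar>pmf p k * (1 - occupied k z) * d k\<bar> = pmf p k * ((1 - occupied k z) * \<bar>d k\<bar>)"
      using occupied_bounds[of k z] by (simp add: abs_mult)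
    also have "\<dots> \<le> pmf p k * (1 * c)"
      using occupied_bounds[of k z] assms[OF \<open>k \<in> set_pmf p\<close>] by (intro mult_left_mono mult_mono) auto
    finally show "\<bar>pmf p k * (1 - occupied k z) * d k\<bar> \<le> pmf p k * c" by simp
  qed
  also have "\<dots> = c"
    using sum_pmf_eq_1[OF finite_range order_refl] by (simp flip: sum_distrib_right)
  finally show ?thesis .
qed

end

context stationary_semigroup
begin

abbreviation "R \<equiv> range_bound"

lemma R_pos: "0 < R" using range_bound_ge(1) by linarith

lemma coord_jump: "k \<in> set_pmf p \<Longrightarrow> \<bar>real_of_int ((x + k) $ i) - real_of_int (x $ i)\<bar> \<le> R"
  using range_bound_ge(2)[of k i] by simp

definition displacement :: "'d \<Rightarrow> real \<Rightarrow> nat \<Rightarrow> 'd tagged_state \<Rightarrow> real" where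
  "displacement i a n z = clip n \<bar>coord i z - a\<bar>"

lemma displacement_bounds: "0 \<le> displacement i a n z" "displacement i a n z \<le> real n"
  by (auto simp: displacement_def clip_def)

lemma displacement_moving_local: "displacement i a n \<in> moving_local"
  unfolding displacement_def[abs_def] coord_def
  by (rule position_moving_local[where F = "\<lambda>x. clip n \<bar>real_of_int (x $ i) - a\<bar>"]) (rule clip_le(2))

lemma displacement_step:
  assumes "k \<in> set_pmf p"
  shows "\<bar>clip n \<bar>real_of_int ((x + k) $ i) - a\<bar> - clip n \<bar>real_of_int (x $ i) - a\<bar>\<bar> \<le> R"
proof -
  have "\<bar>clip n \<bar>real_of_int ((x + k) $ i) - a\<bar> - clip n \<bar>real_of_int (x $ i) - a\<bar>\<bar>
      \<le> \<bar>\<bar>real_of_int ((x + k) $ i) - a\<bar> - \<bar>real_of_int (x $ i) - a\<bar>\<bar>"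
    by (rule clip_lipschitz)
  also have "\<dots> \<le> R" using coord_jump[OF assms, of x i] by linarith
  finally show ?thesis .
qed

lemma displacement_mean:
  assumes t: "0 \<le> t"
  shows "evolve t (displacement i (coord i z) n) z \<le> R * t"
proof -
  let ?a = "coord i z"
  have "\<bar>L (displacement i ?a n) y\<bar> \<le> R" for y
    unfolding displacement_def[abs_def] coord_def[of _ y] coord_def[abs_def]
    by (subst generator_position[where F = "\<lambda>x. clip n \<bar>real_of_int (x $ i) - real_of_int (fst z $ i)\<bar>", OF clip_le(2)])
      (intro weighted_rate_bound displacement_step)
  from evolve_lipschitz[OF t displacement_moving_local this, of z]
  show ?thesis by (simp add: displacement_def clip_def mult.commute abs_le_iff)
qed

text \<open>A jump changes the squared displacement \<open>d * d\<close> by at most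
  \<open>R * (2 * d + R)\<close>, and the mean of \<open>d\<close> is at most \<open>R * t\<close>.
  The quadratic growth is crude; it serves for integrability and for the fluctuations over a grid
  interval. The bound is uniform in the clipping level.\<close>

lemma displacement_square_mean:
  assumes t: "0 \<le> t"
  shows "evolve t (\<lambda>y. (displacement i (coord i z) n y)\<^sup>2) z \<le> R\<^sup>2 * (2 * t\<^sup>2 + t)"
proof -
  let ?a = "coord i z"
  let ?F = "\<lambda>x. clip n \<bar>real_of_int (x $ i) - ?a\<bar>"
  let ?f = "\<lambda>y. (displacement i ?a n y)\<^sup>2"
  have F: "\<bar>(?F x)\<^sup>2\<bar> \<le> (real n)\<^sup>2" for x
    using power_mono[OF clip_le(2)[of n "\<bar>real_of_int (x $ i) - ?a\<bar>"], of 2] by simp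
  have f: "?f \<in> moving_local" unfolding power2_eq_square by (intro moving_local_mult displacement_moving_local)
  have fF: "?f = (\<lambda>z. (?F (fst z))\<^sup>2)" by (simp add: displacement_def coord_def fun_eq_iff)
  have Lf: "\<bar>L ?f y\<bar> \<le> R * (2 * displacement i ?a n y + R)" for y
    unfolding fF generator_position[of "\<lambda>x. (?F x)\<^sup>2", OF F]
  proof (rule weighted_rate_bound)
    fix k assume k: "k \<in> set_pmf p"
    let ?u = "?F (fst y + k)" and ?v = "?F (fst y)"
    have uv: "\<bar>?u - ?v\<bar> \<le> R" by (rule displacement_step[OF k])
    have pos: "0 \<le> ?u" "0 \<le> ?v" by (auto simp: clip_def)
    have "\<bar>?u\<^sup>2 - ?v\<^sup>2\<bar> = \<bar>?u - ?v\<bar> * (?u + ?v)"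
      using pos by (simp add: power2_eq_square square_diff_square_factored abs_mult mult.commute)
    also have "\<dots> \<le> R * (2 * ?v + R)" using uv pos R_pos by (intro mult_mono) auto
    finally show "\<bar>?u\<^sup>2 - ?v\<^sup>2\<bar> \<le> R * (2 * displacement i ?a n y + R)"
      by (simp add: displacement_def coord_def)
  qed
  have "\<bar>evolve t ?f z - ?f z - t * 0\<bar> \<le> t * (R * (2 * (R * t) + R))"
  proof (rule moving_local_increment[OF f t])
    fix s assume s: "0 \<le> s" "s \<le> t"
    have bd: "L ?f \<in> bounded_fun" "displacement i ?a n \<in> bounded_fun"
      by (intro moving_local_bounded_fun L_moving_local f displacement_moving_local)+
    have rhs: "(\<lambda>y. R * (2 * displacement i ?a n y + R)) \<in> bounded_fun"
      by (intro bounded_fun_cmult bounded_fun_add bounded_fun_const bd)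
    have "evolve s (L ?f) z \<le> evolve s (\<lambda>y. R * (2 * displacement i ?a n y + R)) z"
      by (intro evolve_mono s bd rhs order_trans[OF abs_ge_self Lf])
    moreover have "evolve s (\<lambda>y. (-1) * L ?f y) z \<le> evolve s (\<lambda>y. R * (2 * displacement i ?a n y + R)) z"
    proof (intro evolve_mono s bd rhs bounded_fun_cmult)
      show "(-1) * L ?f y \<le> R * (2 * displacement i ?a n y + R)" for y using Lf[of y] by linarith
    qed
    moreover have "evolve s (\<lambda>y. R * (2 * displacement i ?a n y + R)) z = R * (2 * evolve s (displacement i ?a n) z + R)"
      by (simp add: evolve_cmult evolve_add[OF s(1) bounded_fun_cmult[OF bd(2)]] evolve_const[OF s(1)])
    moreover have "R * (2 * evolve s (displacement i ?a n) z + R) \<le> R * (2 * (R * t) + R)"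
    proof (intro mult_left_mono add_right_mono)
      have "evolve s (displacement i ?a n) z \<le> R * s" by (rule displacement_mean[OF s(1)])
      also have "\<dots> \<le> R * t" using s R_pos by simp
      finally show "evolve s (displacement i ?a n) z \<le> R * t" .
    qed (use R_pos in auto)
    ultimately show "\<bar>evolve s (L ?f) z - 0\<bar> \<le> R * (2 * (R * t) + R)"
      unfolding evolve_cmult[of s "-1"] by linarith
  qed
  moreover have "?f z = 0" by (simp add: displacement_def clip_def)
  moreover have "t * (R * (2 * (R * t) + R)) = R\<^sup>2 * (2 * t\<^sup>2 + t)" by (simp add: power2_eq_square algebra_simps)
  ultimately show ?thesis by simp
qed

lemma coord_kernel_measurable: "0 \<le> t \<Longrightarrow> coord i \<in> borel_measurable (P t z)"
  by (rule kernel_fun_measurable[OF _ coord_measurable])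

lemma nn_integral_square_displacement:
  assumes t: "0 \<le> t"
  shows "(\<integral>\<^sup>+y. ennreal ((coord i y - coord i z)\<^sup>2) \<partial>P t z) \<le> ennreal (R\<^sup>2 * (2 * t\<^sup>2 + t))"
proof -
  note [measurable] = coord_kernel_measurable[OF t]
  let ?d = "\<lambda>n y. displacement i (coord i z) n y"
  have "(\<lambda>n. \<integral>\<^sup>+y. ennreal ((?d n y)\<^sup>2) \<partial>P t z) \<longlonglongrightarrow> (\<integral>\<^sup>+y. ennreal (\<bar>coord i y - coord i z\<bar>\<^sup>2) \<partial>P t z)"
  proof (rule nn_integral_LIMSEQ)
    show "incseq (\<lambda>n y. ennreal ((?d n y)\<^sup>2))"
    proof (rule incseq_SucI, rule le_funI, rule ennreal_leI, rule power_mono)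
      show "?d n y \<le> ?d (Suc n) y" "0 \<le> ?d n y" for n y by (auto simp: displacement_def clip_def)
    qed
    show "(\<lambda>y. ennreal ((?d n y)\<^sup>2)) \<in> borel_measurable (P t z)" for n
      unfolding displacement_def by measurable
    show "(\<lambda>n. ennreal ((?d n y)\<^sup>2)) \<longlonglongrightarrow> ennreal (\<bar>coord i y - coord i z\<bar>\<^sup>2)" for y
      unfolding displacement_def by (intro tendsto_ennrealI tendsto_power clip_tendsto)
  qed
  moreover have "(\<integral>\<^sup>+y. ennreal ((?d n y)\<^sup>2) \<partial>P t z) \<le> ennreal (R\<^sup>2 * (2 * t\<^sup>2 + t))" for n
  proof -
    have "(\<lambda>y. (?d n y)\<^sup>2) \<in> bounded_fun"
      unfolding power2_eq_square by (intro moving_local_bounded_fun moving_local_mult displacement_moving_local)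
    from nn_integral_eq_integral[OF integrable_kernel[OF t this]]
    have "(\<integral>\<^sup>+y. ennreal ((?d n y)\<^sup>2) \<partial>P t z) = ennreal (evolve t (\<lambda>y. (?d n y)\<^sup>2) z)"
      by (simp add: evolve_def)
    then show ?thesis using displacement_square_mean[OF t, of i z n] by (simp add: ennreal_leI)
  qed
  ultimately show ?thesis by (simp add: LIMSEQ_le_const2)
qed

lemma integrable_square_displacement:
  assumes t: "0 \<le> t"
  shows "integrable (P t z) (\<lambda>y. (coord i y - coord i z)\<^sup>2)"
proof (rule integrableI_nonneg)
  note [measurable] = coord_kernel_measurable[OF t]
  show "(\<lambda>y. (coord i y - coord i z)\<^sup>2) \<in> borel_measurable (P t z)" by measurable
  show "(\<integral>\<^sup>+y. ennreal ((coord i y - coord i z)\<^sup>2) \<partial>P t z) < \<infinity>"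
    by (rule le_less_trans[OF nn_integral_square_displacement[OF t]]) simp
qed simp

lemma integral_square_displacement:
  assumes t: "0 \<le> t"
  shows "(\<integral>y. (coord i y - coord i z)\<^sup>2 \<partial>P t z) \<le> R\<^sup>2 * (2 * t\<^sup>2 + t)"
proof -
  have "ennreal (\<integral>y. (coord i y - coord i z)\<^sup>2 \<partial>P t z) \<le> ennreal (R\<^sup>2 * (2 * t\<^sup>2 + t))"
    using nn_integral_square_displacement[OF t, of z i]
      nn_integral_eq_integral[OF integrable_square_displacement[OF t, of z i]] by simp
  then show ?thesis using t by (simp add: ennreal_le_iff)
qed

lemma integrable_displacement:
  assumes t: "0 \<le> t"
  shows "integrable (P t z) (\<lambda>y. coord i y - coord i z)"
proof (rule Bochner_Integration.integrable_bound)
  note [measurable] = coord_kernel_measurable[OF t]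
  interpret prob_space "P t z" by (rule prob_space_kernel[OF t])
  show "integrable (P t z) (\<lambda>y. (coord i y - coord i z)\<^sup>2 + 1)"
    by (intro Bochner_Integration.integrable_add integrable_square_displacement t) simp
  have "\<bar>a\<bar> \<le> a\<^sup>2 + 1" for a :: real
    using sum_squares_bound[of "\<bar>a\<bar>" 1] by (simp add: power2_eq_square)
  then show "AE y in P t z. norm (coord i y - coord i z) \<le> norm ((coord i y - coord i z)\<^sup>2 + 1)"
    by (intro AE_I2) (simp add: abs_of_nonneg)
  show "(\<lambda>y. coord i y - coord i z) \<in> borel_measurable (P t z)"
    by (intro borel_measurable_diff coord_kernel_measurable t borel_measurable_const)
qed

lemma integrable_coord:
  assumes t: "0 \<le> t"
  shows "integrable (P t z) (coord i)"
proof -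
  interpret prob_space "P t z" by (rule prob_space_kernel[OF t])
  have "integrable (P t z) (\<lambda>y. (coord i y - coord i z) + coord i z)"
    by (intro Bochner_Integration.integrable_add integrable_displacement t) simp
  then show ?thesis by simp
qed

section \<open>The mean displacement\<close>

definition mean_coord :: "'d \<Rightarrow> real \<Rightarrow> 'd tagged_state \<Rightarrow> real" where
  "mean_coord i t z = (\<integral>y. coord i y \<partial>P t z)"

text \<open>The conditional mean, given the initial state, of the displacement minus its linear
  prediction. Unlike the coordinate it is bounded for fixed \<open>t\<close>, so the semigroup can
  act on it.\<close>

definition mean_dev :: "'d \<Rightarrow> real \<Rightarrow> 'd tagged_state \<Rightarrow> real" where
  "mean_dev i t z = mean_coord i t z - coord i z - t * speed i"

definition clipped :: "'d \<Rightarrow> nat \<Rightarrow> 'd tagged_state \<Rightarrow> real" where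
  "clipped i n z = clip n (coord i z)"

lemma clipped_moving_local: "clipped i n \<in> moving_local"
  unfolding clipped_def[abs_def] coord_def
  by (rule position_moving_local[where F = "\<lambda>x. clip n (real_of_int (x $ i))"]) (rule clip_le(2))

lemma clipped_tendsto:
  assumes t: "0 \<le> t"
  shows "(\<lambda>n. evolve t (clipped i n) z) \<longlonglongrightarrow> mean_coord i t z"
  unfolding evolve_def mean_coord_def
proof (rule integral_dominated_convergence[where w = "\<lambda>y. \<bar>coord i y\<bar>"])
  note [measurable] = coord_kernel_measurable[OF t]
  show "coord i \<in> borel_measurable (P t z)" by measurable
  show "clipped i n \<in> borel_measurable (P t z)" for n unfolding clipped_def by measurable
  show "integrable (P t z) (\<lambda>y. \<bar>coord i y\<bar>)" by (intro integrable_abs integrable_coord t)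
qed (auto simp: clipped_def clip_le clip_tendsto)

lemma clipped_lipschitz:
  assumes t: "0 \<le> t"
  shows "\<bar>evolve t (clipped i n) z - clipped i n z\<bar> \<le> t * R"
proof (rule evolve_lipschitz[OF t clipped_moving_local])
  fix y
  have "\<bar>L (\<lambda>z. clip n (real_of_int (fst z $ i))) y\<bar> \<le> R"
    by (subst generator_position[where F = "\<lambda>x. clip n (real_of_int (x $ i))", OF clip_le(2)])
      (intro weighted_rate_bound order_trans[OF clip_lipschitz coord_jump])
  then show "\<bar>L (clipped i n) y\<bar> \<le> R" unfolding clipped_def[abs_def] coord_def .
qed

lemma mean_coord_bound: "0 \<le> t \<Longrightarrow> \<bar>mean_coord i t z - coord i z\<bar> \<le> t * R"
proof -
  assume t: "0 \<le> t"
  have "(\<lambda>n. \<bar>evolve t (clipped i n) z - clipped i n z\<bar>) \<longlonglongrightarrow> \<bar>mean_coord i t z - coord i z\<bar>"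
    unfolding clipped_def[of i _ z] by (intro tendsto_intros clipped_tendsto clip_tendsto t)
  then show ?thesis by (rule LIMSEQ_le_const2) (use clipped_lipschitz[OF t] in auto)
qed

lemma mean_coord_measurable:
  assumes t: "0 \<le> t"
  shows "mean_coord i t \<in> borel_measurable tagged_space"
proof (rule borel_measurable_LIMSEQ_real)
  show "(\<lambda>n. evolve t (clipped i n) z) \<longlonglongrightarrow> mean_coord i t z" for z by (rule clipped_tendsto[OF t])
  show "evolve t (clipped i n) \<in> borel_measurable tagged_space" for n
    by (intro bounded_fun_measurable evolve_bounded_fun moving_local_bounded_fun clipped_moving_local t)
qed

lemma mean_dev_bounded_fun: "0 \<le> t \<Longrightarrow> mean_dev i t \<in> bounded_fun"
proof (rule bounded_funI[of _ "t * R + \<bar>t * speed i\<bar>"])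
  assume t: "0 \<le> t"
  note [measurable] = mean_coord_measurable[OF t]
  show "mean_dev i t \<in> borel_measurable tagged_space" unfolding mean_dev_def[abs_def] by measurable
  show "\<bar>mean_dev i t z\<bar> \<le> t * R + \<bar>t * speed i\<bar>" for z
    using mean_coord_bound[OF t, of i z] unfolding mean_dev_def by linarith
qed

lemma mean_coord_add:
  assumes s: "0 \<le> s" and t: "0 \<le> t"
  shows "mean_coord i (s + t) z = (\<integral>y. mean_coord i t y \<partial>P s z)"
proof (rule LIMSEQ_unique)
  show "(\<lambda>n. evolve (s + t) (clipped i n) z) \<longlonglongrightarrow> mean_coord i (s + t) z"
    using s t by (intro clipped_tendsto) simp
  interpret prob_space "P s z" by (rule prob_space_kernel[OF s])
  have "(\<lambda>n. \<integral>y. evolve t (clipped i n) y \<partial>P s z) \<longlonglongrightarrow> (\<integral>y. mean_coord i t y \<partial>P s z)"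
  proof (rule integral_dominated_convergence[where w = "\<lambda>y. \<bar>coord i y\<bar> + t * R"])
    show "mean_coord i t \<in> borel_measurable (P s z)" "evolve t (clipped i n) \<in> borel_measurable (P s z)" for n
      by (intro kernel_fun_measurable[OF s] mean_coord_measurable t bounded_fun_measurable evolve_bounded_fun
          moving_local_bounded_fun clipped_moving_local)+
    show "integrable (P s z) (\<lambda>y. \<bar>coord i y\<bar> + t * R)"
      by (intro Bochner_Integration.integrable_add integrable_abs integrable_coord s) simp
    have "\<bar>evolve t (clipped i n) y\<bar> \<le> \<bar>coord i y\<bar> + t * R" for n y
      using clipped_lipschitz[OF t, of i n y] clip_le(1)[of n "coord i y"] unfolding clipped_def by linarith
    then show "AE y in P s z. norm (evolve t (clipped i n) y) \<le> \<bar>coord i y\<bar> + t * R" for n by simp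
  qed (auto intro: clipped_tendsto[OF t])
  then show "(\<lambda>n. evolve (s + t) (clipped i n) z) \<longlonglongrightarrow> (\<integral>y. mean_coord i t y \<partial>P s z)"
    by (simp add: evolve_semigroup[OF s t moving_local_bounded_fun[OF clipped_moving_local]] evolve_def[of s])
qed

text \<open>The cocycle property behind both the discretisation in time and the doubling of the
  variance.\<close>

lemma mean_dev_add:
  assumes s: "0 \<le> s" and t: "0 \<le> t"
  shows "mean_dev i (s + t) z = mean_dev i s z + evolve s (mean_dev i t) z"
proof -
  interpret prob_space "P s z" by (rule prob_space_kernel[OF s])
  have md: "integrable (P s z) (mean_dev i t)" by (rule integrable_kernel[OF s mean_dev_bounded_fun[OF t]])
  have "(\<integral>y. mean_coord i t y \<partial>P s z) = (\<integral>y. mean_dev i t y + (coord i y + t * speed i) \<partial>P s z)"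
    by (simp add: mean_dev_def)
  also have "\<dots> = evolve s (mean_dev i t) z + (mean_coord i s z + t * speed i)"
    using md integrable_coord[OF s, of z i] by (simp add: evolve_def mean_coord_def prob_space)
  finally show ?thesis unfolding mean_dev_def[of i "s + t"] mean_coord_add[OF s t]
    by (simp add: mean_dev_def[of i s] algebra_simps)
qed

text \<open>The drift is the generator of the coordinate, up to its being unbounded. For the
  coordinate clipped around its starting value, generator and drift differ only at distance about
  \<open>n\<close>, and being there is controlled by the mean displacement divided by
  \<open>n\<close>.\<close>

lemma mean_dev_quadratic:
  assumes c: "\<And>z. \<bar>L (drift i) z\<bar> \<le> c" and t: "0 \<le> t"
  shows "\<bar>mean_dev i t z - t * (drift i z - speed i)\<bar> \<le> t * (t * c)"
proof -
  let ?a = "coord i z"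
  let ?F = "\<lambda>n x. clip n (real_of_int (x $ i) - ?a)"
  let ?f = "\<lambda>n y. ?F n (fst y)"
  have f: "?f n \<in> moving_local" for n by (rule position_moving_local[where F = "?F n"]) (rule clip_le(2))
  have bd: "L (?f n) \<in> bounded_fun" "drift i \<in> bounded_fun" "displacement i ?a n \<in> bounded_fun" for n
    by (intro moving_local_bounded_fun L_moving_local f drift_moving_local displacement_moving_local)+
  \<comment> \<open>Closer than \<open>n - R\<close> a jump does not feel the clipping. Further out
    the error is at most \<open>2 * R\<close>, and there the displacement divided by
    \<open>n - R\<close> is at least 1.\<close>
  have Lf: "\<bar>L (?f n) y - drift i y\<bar> \<le> 2 * R / (real n - R) * displacement i ?a n y" if n: "R < real n" for n y
  proof -
    have "L (?f n) y - drift i y = (\<Sum>k\<in>set_pmf p. pmf p k * (1 - occupied k y) * (?F n (fst y + k) - ?F n (fst y) - real_of_int (k $ i)))"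
      unfolding generator_position[where F = "?F n", OF clip_le(2)] drift_def sum_subtractf[symmetric]
      by (intro sum.cong refl) (simp add: algebra_simps)
    also have "\<bar>\<dots>\<bar> \<le> 2 * R / (real n - R) * displacement i ?a n y"
    proof (rule weighted_rate_bound)
      fix k assume k: "k \<in> set_pmf p"
      let ?y = "real_of_int (fst y $ i) - ?a" and ?k = "real_of_int (k $ i)"
      have kR: "\<bar>?k\<bar> \<le> R" by (rule range_bound_ge(2)[OF k])
      have eq: "?F n (fst y + k) - ?F n (fst y) - ?k = clip n (?y + ?k) - clip n ?y - ?k"
        by (simp add: algebra_simps)
      have d: "displacement i ?a n y = clip n \<bar>?y\<bar>" by (simp add: displacement_def coord_def)
      show "\<bar>?F n (fst y + k) - ?F n (fst y) - ?k\<bar> \<le> 2 * R / (real n - R) * displacement i ?a n y"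
      proof (cases "\<bar>?y\<bar> \<le> real n - R")
        case True
        have "clip n (?y + ?k) = ?y + ?k" "clip n ?y = ?y"
          using True kR R_pos unfolding clip_def by linarith+
        then show ?thesis unfolding eq using displacement_bounds(1)[of i ?a n y] n R_pos by simp
      next
        case False
        have "\<bar>clip n (?y + ?k) - clip n ?y - ?k\<bar> \<le> 2 * R"
          using clip_lipschitz[of n "?y + ?k" ?y] kR by linarith
        also have "\<dots> \<le> 2 * R / (real n - R) * displacement i ?a n y"
        proof -
          have "real n - R \<le> displacement i ?a n y" using False R_pos unfolding d clip_def by linarith
          from mult_left_mono[OF this, of "2 * R / (real n - R)"] show ?thesis using n R_pos by simp
        qed
        finally show ?thesis unfolding eq .
      qed
    qed
    finally show ?thesis .
  qed
  have inc: "\<bar>evolve t (?f n) z - t * drift i z\<bar> \<le> t * (2 * R / (real n - R) * (R * t) + t * c)" if n: "R < real n" for n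
  proof -
    have "\<bar>evolve t (?f n) z - ?f n z - t * drift i z\<bar> \<le> t * (2 * R / (real n - R) * (R * t) + t * c)"
    proof (rule moving_local_increment[OF f t])
      fix s assume s: "0 \<le> s" "s \<le> t"
      have rhs: "(\<lambda>y. 2 * R / (real n - R) * displacement i ?a n y) \<in> bounded_fun" by (rule bounded_fun_cmult[OF bd(3)])
      have "evolve s (\<lambda>y. L (?f n) y - drift i y) z \<le> evolve s (\<lambda>y. 2 * R / (real n - R) * displacement i ?a n y) z"
        by (intro evolve_mono s bounded_fun_diff bd rhs order_trans[OF abs_ge_self Lf[OF n]])
      moreover have "evolve s (\<lambda>y. drift i y - L (?f n) y) z \<le> evolve s (\<lambda>y. 2 * R / (real n - R) * displacement i ?a n y) z"
      proof (intro evolve_mono s bounded_fun_diff bd rhs)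
        show "drift i y - L (?f n) y \<le> 2 * R / (real n - R) * displacement i ?a n y" for y using Lf[OF n, of y] by linarith
      qed
      moreover have "evolve s (\<lambda>y. 2 * R / (real n - R) * displacement i ?a n y) z \<le> 2 * R / (real n - R) * (R * t)"
      proof (unfold evolve_cmult, intro mult_left_mono)
        have "evolve s (displacement i ?a n) z \<le> R * s" by (rule displacement_mean[OF s(1)])
        also have "\<dots> \<le> R * t" using s R_pos by simp
        finally show "evolve s (displacement i ?a n) z \<le> R * t" .
      qed (use n R_pos in auto)
      moreover have "\<bar>evolve s (drift i) z - drift i z\<bar> \<le> s * c"
        by (rule evolve_lipschitz[OF s(1) drift_moving_local c])
      moreover have "s * c \<le> t * c" using s c[of z] by (intro mult_right_mono) auto
      ultimately show "\<bar>evolve s (L (?f n)) z - drift i z\<bar> \<le> 2 * R / (real n - R) * (R * t) + t * c"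
        by (simp add: evolve_diff[OF s(1)] bd)
    qed
    moreover have "?f n z = 0" by (simp add: coord_def clip_def)
    ultimately show ?thesis by simp
  qed
  have lim: "(\<lambda>n. evolve t (?f n) z) \<longlonglongrightarrow> (\<integral>y. coord i y - ?a \<partial>P t z)"
    unfolding evolve_def
  proof (rule integral_dominated_convergence[where w = "\<lambda>y. \<bar>coord i y - ?a\<bar>"])
    note [measurable] = coord_kernel_measurable[OF t]
    show "(\<lambda>y. coord i y - ?a) \<in> borel_measurable (P t z)" by measurable
    show "?f n \<in> borel_measurable (P t z)" for n
      unfolding coord_def[of i, symmetric] by measurable
    show "integrable (P t z) (\<lambda>y. \<bar>coord i y - ?a\<bar>)" by (intro integrable_abs integrable_displacement t)
  qed (auto simp: clip_le clip_tendsto coord_def)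
  interpret prob_space "P t z" by (rule prob_space_kernel[OF t])
  have md: "(\<integral>y. coord i y - ?a \<partial>P t z) = mean_dev i t z + t * speed i"
    using integrable_coord[OF t, of z i] by (simp add: mean_dev_def mean_coord_def prob_space)
  have "\<bar>(mean_dev i t z + t * speed i) - t * drift i z\<bar> \<le> t * (0 * (R * t) + t * c)"
  proof (rule LIMSEQ_le)
    show "(\<lambda>n. \<bar>evolve t (?f n) z - t * drift i z\<bar>) \<longlonglongrightarrow> \<bar>(mean_dev i t z + t * speed i) - t * drift i z\<bar>"
      by (intro tendsto_intros lim[unfolded md])
    have "filterlim (\<lambda>n. - R + real n) at_top sequentially"
      by (rule filterlim_tendsto_add_at_top[OF tendsto_const filterlim_real_sequentially])
    then have "filterlim (\<lambda>n. real n - R) at_infinity sequentially"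
      by (intro filterlim_at_top_imp_at_infinity) simp
    then have "(\<lambda>n. 2 * R / (real n - R)) \<longlonglongrightarrow> 0" by (rule tendsto_divide_0[OF tendsto_const])
    then show "(\<lambda>n. t * (2 * R / (real n - R) * (R * t) + t * c)) \<longlonglongrightarrow> t * (0 * (R * t) + t * c)"
      by (intro tendsto_intros)
    obtain n0 where "R < real n0" using reals_Archimedean2 by blast
    then show "\<exists>N. \<forall>n\<ge>N. \<bar>evolve t (?f n) z - t * drift i z\<bar> \<le> t * (2 * R / (real n - R) * (R * t) + t * c)"
      using inc by (intro exI[of _ n0]) (auto intro: order_less_le_trans)
  qed
  then show ?thesis by (simp add: algebra_simps)
qed

end

section \<open>The variance of the position\<close>

lemma four_squares: "(a + b + c + d)\<^sup>2 \<le> 4 * (a\<^sup>2 + b\<^sup>2 + c\<^sup>2 + (d :: real)\<^sup>2)"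
proof -
  have "0 \<le> (a - b)\<^sup>2 + (a - c)\<^sup>2 + (a - d)\<^sup>2 + (b - c)\<^sup>2 + (b - d)\<^sup>2 + (c - d)\<^sup>2"
    by (intro add_nonneg_nonneg) auto
  then show ?thesis by (simp add: power2_eq_square algebra_simps)
qed

lemma square_diff_le: "(a - b)\<^sup>2 \<le> 2 * a\<^sup>2 + 2 * (b :: real)\<^sup>2"
  using zero_le_power2[of "a + b"] by (simp add: power2_eq_square algebra_simps)

context stationary_semigroup
begin

section \<open>The conditional mean at later times\<close>

text \<open>The mean at time \<open>s\<close> of the process started from the environment measure.
  Estimates uniform in \<open>s\<close> replace stationarity for functions to which
  \<open>env_mean_evolve\<close> does not apply.\<close>

definition later_mean :: "real \<Rightarrow> ('d tagged_state \<Rightarrow> real) \<Rightarrow> real" where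
  "later_mean s f = E (evolve s f)"

lemma later_mean_add:
  assumes "0 \<le> s" "f \<in> bounded_fun" "g \<in> bounded_fun"
  shows "later_mean s (\<lambda>z. f z + g z) = later_mean s f + later_mean s g"
proof -
  have "evolve s (\<lambda>z. f z + g z) = (\<lambda>z. evolve s f z + evolve s g z)"
    by (rule ext) (rule evolve_add[OF assms])
  then show ?thesis
    unfolding later_mean_def by (simp only: env_mean_add evolve_bounded_fun assms)
qed

lemma later_mean_cmult: "later_mean s (\<lambda>z. c * f z) = c * later_mean s f"
  unfolding later_mean_def by (simp only: evolve_cmult[abs_def] env_mean_cmult)

lemma later_mean_const: "0 \<le> s \<Longrightarrow> later_mean s (\<lambda>_. c) = c"
proof -
  assume "0 \<le> s"
  then have "evolve s (\<lambda>_. c) = (\<lambda>_. c)" by (intro ext evolve_const)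
  then show ?thesis unfolding later_mean_def by (simp only: env_mean_const)
qed

lemma later_mean_sum:
  assumes "0 \<le> s" "\<And>i. i \<in> I \<Longrightarrow> f i \<in> bounded_fun"
  shows "later_mean s (\<lambda>z. \<Sum>i\<in>I. f i z) = (\<Sum>i\<in>I. later_mean s (f i))"
proof -
  have "evolve s (\<lambda>z. \<Sum>i\<in>I. f i z) = (\<lambda>z. \<Sum>i\<in>I. evolve s (f i) z)"
    by (rule ext) (rule evolve_sum[OF assms])
  then show ?thesis
    unfolding later_mean_def by (simp only: env_mean_sum evolve_bounded_fun assms)
qed

lemma later_mean_mono: "0 \<le> s \<Longrightarrow> f \<in> bounded_fun \<Longrightarrow> g \<in> bounded_fun \<Longrightarrow> (\<And>z. f z \<le> g z) \<Longrightarrow>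
    later_mean s f \<le> later_mean s g"
  unfolding later_mean_def by (intro env_mean_mono evolve_mono evolve_bounded_fun)

lemma later_mean_evolve: "0 \<le> s \<Longrightarrow> 0 \<le> t \<Longrightarrow> f \<in> bounded_fun \<Longrightarrow>
    later_mean s (evolve t f) = later_mean (s + t) f"
  unfolding later_mean_def env_mean_def by (simp add: evolve_semigroup)

lemma mean_dev_zero: "mean_dev i 0 z = 0"
  using mean_coord_bound[of 0 i z] by (simp add: mean_dev_def)

text \<open>Both \<open>mean_dev\<close> and the increment of \<open>g\<close> under the semigroup
  are additive in time, so their sum over a long interval splits into equal short steps.\<close>

lemma mean_dev_telescope:
  assumes d: "0 \<le> \<delta>" and g: "g \<in> bounded_fun"
  shows "mean_dev i (real m * \<delta>) z + evolve (real m * \<delta>) g z - g z =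
    (\<Sum>j<m. evolve (real j * \<delta>) (\<lambda>z. mean_dev i \<delta> z + evolve \<delta> g z - g z) z)"
proof (induction m)
  case 0
  then show ?case using g by (simp add: mean_dev_zero evolve_zero)
next
  case (Suc m)
  have t: "0 \<le> real m * \<delta>" using d by simp
  have bd: "mean_dev i \<delta> \<in> bounded_fun" "evolve \<delta> g \<in> bounded_fun"
    by (intro mean_dev_bounded_fun evolve_bounded_fun d g)+
  have Sm: "real (Suc m) * \<delta> = real m * \<delta> + \<delta>" by (simp add: algebra_simps)
  have "evolve (real m * \<delta>) (\<lambda>z. mean_dev i \<delta> z + evolve \<delta> g z - g z) z =
      evolve (real m * \<delta>) (mean_dev i \<delta>) z + evolve (real m * \<delta>) (evolve \<delta> g) z - evolve (real m * \<delta>) g z"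
    by (simp add: evolve_diff[OF t bounded_fun_add[OF bd] g] evolve_add[OF t bd])
  then show ?case
    using Suc.IH unfolding Sm mean_dev_add[OF t d] evolve_semigroup[OF t d g] by simp
qed

text \<open>Each short step is its length times \<open>drift i z - speed i + L g z\<close> up to a
  quadratic error, so the telescope is a Riemann sum in place of a time integral. The four squares
  are the two boundary terms, this sum after the Cauchy-Schwarz inequality, and the discretisation
  error.\<close>

lemma mean_dev_pointwise:
  assumes g: "g \<in> moving_local" and T: "0 \<le> T" and n: "0 < n"
    and c: "\<And>z. \<bar>L (drift i) z\<bar> \<le> c" "\<And>z. \<bar>L (L g) z\<bar> \<le> c'"
  shows "(mean_dev i T z)\<^sup>2 \<le> 4 * ((g z)\<^sup>2 + (evolve T g z)\<^sup>2 +
    T\<^sup>2 / real n * (\<Sum>j<n. (evolve (real j * (T / real n)) (\<lambda>z. drift i z - speed i + L g z) z)\<^sup>2) +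
    (T\<^sup>2 * (c + c') / real n)\<^sup>2)"
proof -
  define \<delta> where "\<delta> = T / real n"
  have d: "0 \<le> \<delta>" "real n * \<delta> = T" using T n by (auto simp: \<delta>_def)
  let ?r = "\<lambda>z. drift i z - speed i + L g z" and ?u = "\<lambda>z. mean_dev i \<delta> z + evolve \<delta> g z - g z"
  have bg: "g \<in> bounded_fun" by (rule moving_local_bounded_fun[OF g])
  have br: "?r \<in> bounded_fun"
    by (intro bounded_fun_add bounded_fun_diff moving_local_bounded_fun drift_moving_local bounded_fun_const L_moving_local g)
  have bu: "?u \<in> bounded_fun"
    by (intro bounded_fun_add bounded_fun_diff mean_dev_bounded_fun evolve_bounded_fun d bg)
  have ur: "\<bar>?u z - \<delta> * ?r z\<bar> \<le> \<delta> * (\<delta> * (c + c'))" for z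
    using mean_dev_quadratic[OF c(1) d(1), of z] evolve_quadratic[OF d(1) g c(2), of z]
    by (simp add: algebra_simps)
  have evu: "\<bar>evolve (real j * \<delta>) ?u z - \<delta> * evolve (real j * \<delta>) ?r z\<bar> \<le> \<delta> * (\<delta> * (c + c'))" for j
  proof -
    have t: "0 \<le> real j * \<delta>" using d by simp
    have "\<bar>evolve (real j * \<delta>) (\<lambda>z. ?u z - \<delta> * ?r z) z\<bar> \<le> \<delta> * (\<delta> * (c + c'))"
      by (intro evolve_bound t bounded_fun_diff[OF bu bounded_fun_cmult[OF br]] ur)
    then show ?thesis by (simp only: evolve_diff[OF t bu bounded_fun_cmult[OF br]] evolve_cmult)
  qed
  define A where "A = \<delta> * (\<Sum>j<n. evolve (real j * \<delta>) ?r z)"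
  define B where "B = (\<Sum>j<n. evolve (real j * \<delta>) ?u z) - A"
  have "\<bar>B\<bar> \<le> (\<Sum>j<n. \<delta> * (\<delta> * (c + c')))"
    unfolding B_def A_def sum_distrib_left sum_subtractf[symmetric] by (rule order_trans[OF sum_abs sum_mono]) (rule evu)
  also have "\<dots> = T\<^sup>2 * (c + c') / real n" using n by (simp add: \<delta>_def power2_eq_square)
  finally have B: "B\<^sup>2 \<le> (T\<^sup>2 * (c + c') / real n)\<^sup>2"
    by (intro power2_le_iff_abs_le[THEN iffD2]) (auto intro: order_trans[OF abs_ge_zero])
  have "A\<^sup>2 = \<delta>\<^sup>2 * (\<Sum>j<n. evolve (real j * \<delta>) ?r z)\<^sup>2" by (simp add: A_def power_mult_distrib)
  also have "\<dots> \<le> \<delta>\<^sup>2 * ((\<Sum>j<n. (evolve (real j * \<delta>) ?r z)\<^sup>2) * real (card {..<n}))"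
    by (intro mult_left_mono sum_squared_le_sum_of_squares) auto
  also have "\<dots> = T\<^sup>2 / real n * (\<Sum>j<n. (evolve (real j * \<delta>) ?r z)\<^sup>2)"
    using n by (simp add: \<delta>_def power_divide power2_eq_square)
  finally have A: "A\<^sup>2 \<le> T\<^sup>2 / real n * (\<Sum>j<n. (evolve (real j * \<delta>) ?r z)\<^sup>2)" .
  have "mean_dev i T z = g z + (- evolve T g z) + A + B"
    using mean_dev_telescope[OF d(1) bg, of i n z] unfolding d(2) B_def by simp
  then have "(mean_dev i T z)\<^sup>2 \<le> 4 * ((g z)\<^sup>2 + (- evolve T g z)\<^sup>2 + A\<^sup>2 + B\<^sup>2)"
    using four_squares by presburger
  with A B show ?thesis unfolding \<delta>_def[symmetric] by simp
qed

text \<open>For the corrector \<open>g\<close> with parameter \<open>1 / T\<close> the integrand of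
  the Riemann sum equals \<open>g / T\<close> up to the tolerance. Boundary terms and sum are then
  all of the order of the squared norm of \<open>g\<close>, plus a multiple of
  \<open>T\<close>.\<close>

lemma mean_dev_energy:
  assumes T: "1 \<le> T" and s: "0 \<le> s"
  shows "later_mean s (\<lambda>z. (mean_dev i T z)\<^sup>2) \<le> (64 * R\<^sup>2 + 40) * (T * sqrt T)"
proof -
  obtain g where g: "g \<in> moving_local" "environment_fun g"
    "\<And>z. \<bar>1 / T * g z - L g z - (drift i z - speed i)\<bar> \<le> 1 / sqrt T"
    "E (\<lambda>z. g z * g z) \<le> (4 * R\<^sup>2 + 2) * (T * sqrt T)" using corrector[OF T] by blast
  have T0: "0 \<le> T" "0 < T" "1 \<le> sqrt T" using T by auto
  obtain c where c: "\<And>z. \<bar>L (drift i) z\<bar> \<le> c"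
    using bounded_funE[OF moving_local_bounded_fun[OF L_moving_local[OF drift_moving_local]]] by blast
  obtain c' where c': "\<And>z. \<bar>L (L g) z\<bar> \<le> c'"
    using bounded_funE[OF moving_local_bounded_fun[OF L_moving_local[OF L_moving_local[OF g(1)]]]] by blast
  let ?r = "\<lambda>z. drift i z - speed i + L g z"
  have r: "?r \<in> moving_local" "environment_fun ?r"
    by (intro moving_local_add moving_local_diff environment_fun_add environment_fun_diff drift_moving_local
        drift_environment_fun moving_local_const environment_fun_const L_moving_local L_environment_fun g)+
  define G where "G = E (\<lambda>z. g z * g z)"
  have bg: "g \<in> bounded_fun" "?r \<in> bounded_fun" using g r by (auto intro: moving_local_bounded_fun)
  have bgg: "(\<lambda>z. g z * g z) \<in> bounded_fun" "(\<lambda>z. ?r z * ?r z) \<in> bounded_fun" by (intro bounded_fun_mult bg)+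
  have Er: "E (\<lambda>z. ?r z * ?r z) \<le> 2 / T\<^sup>2 * G + 2 / T"
  proof -
    have "?r z * ?r z \<le> 2 / T\<^sup>2 * (g z * g z) + 2 / T" for z
    proof -
      define b where "b = 1 / T * g z - ?r z"
      have "\<bar>b\<bar> \<le> 1 / sqrt T" using g(3)[of z] unfolding b_def by (simp add: algebra_simps)
      then have b: "b\<^sup>2 \<le> (1 / sqrt T)\<^sup>2" using T0 by (intro power2_le_iff_abs_le[THEN iffD2]) auto
      have "1 / T * g z - b = ?r z" by (simp add: b_def)
      then have "?r z * ?r z = (1 / T * g z - b)\<^sup>2" by (simp only: power2_eq_square)
      also have "\<dots> \<le> 2 * (1 / T * g z)\<^sup>2 + 2 * b\<^sup>2"
        by (rule square_diff_le)
      also have "\<dots> \<le> 2 * (1 / T * g z)\<^sup>2 + 2 * (1 / sqrt T)\<^sup>2" using b by simp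
      also have "\<dots> = 2 / T\<^sup>2 * (g z * g z) + 2 / T"
        using T0 by (simp add: power_divide power_mult_distrib) (simp add: power2_eq_square)
      finally show ?thesis .
    qed
    then have "E (\<lambda>z. ?r z * ?r z) \<le> E (\<lambda>z. 2 / T\<^sup>2 * (g z * g z) + 2 / T)"
      by (intro env_mean_mono bgg bounded_fun_add bounded_fun_cmult bounded_fun_const)
    also have "\<dots> = 2 / T\<^sup>2 * G + 2 / T"
      unfolding G_def using bgg by (simp only: env_mean_add bounded_fun_cmult bounded_fun_const env_mean_cmult env_mean_const)
    finally show ?thesis .
  qed
  \<comment> \<open>The bound holds for every number of steps; the discretisation error, which
    involves the uncontrolled constants \<open>c\<close> and \<open>c'\<close>, disappears as
    \<open>m\<close> grows.\<close>
  have key: "later_mean s (\<lambda>z. (mean_dev i T z)\<^sup>2) \<le> 4 * (4 * G + 2 * T) + 4 * (T\<^sup>2 * (c + c') / real (Suc m))\<^sup>2" for m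
  proof -
    let ?n = "Suc m"
    let ?e = "\<lambda>j z. (evolve (real j * (T / real ?n)) ?r z)\<^sup>2"
    have e: "?e j \<in> bounded_fun" for j
      unfolding power2_eq_square using T0 by (intro bounded_fun_mult evolve_bounded_fun bg) auto
    have sq: "(\<lambda>z. (g z)\<^sup>2) \<in> bounded_fun" "(\<lambda>z. (evolve T g z)\<^sup>2) \<in> bounded_fun" "(\<lambda>z. (mean_dev i T z)\<^sup>2) \<in> bounded_fun"
      unfolding power2_eq_square by (intro bounded_fun_mult evolve_bounded_fun mean_dev_bounded_fun T0 bg)+
    have se: "(\<lambda>z. T\<^sup>2 / real ?n * (\<Sum>j<?n. ?e j z)) \<in> bounded_fun"
      by (intro bounded_fun_cmult bounded_fun_sum e)
    have "later_mean s (\<lambda>z. (mean_dev i T z)\<^sup>2) \<le> later_mean s (\<lambda>z. 4 * ((g z)\<^sup>2 + (evolve T g z)\<^sup>2 +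
        T\<^sup>2 / real ?n * (\<Sum>j<?n. ?e j z) + (T\<^sup>2 * (c + c') / real ?n)\<^sup>2))"
      by (intro later_mean_mono s sq bounded_fun_cmult bounded_fun_add se bounded_fun_const
          mean_dev_pointwise g T0 c c' zero_less_Suc)
    also have "\<dots> = 4 * (later_mean s (\<lambda>z. (g z)\<^sup>2) + later_mean s (\<lambda>z. (evolve T g z)\<^sup>2) +
        T\<^sup>2 / real ?n * (\<Sum>j<?n. later_mean s (?e j)) + (T\<^sup>2 * (c + c') / real ?n)\<^sup>2)"
      by (simp only: later_mean_cmult later_mean_const[OF s] later_mean_sum[OF s e]
          later_mean_add[OF s bounded_fun_add[OF bounded_fun_add[OF sq(1,2)] se] bounded_fun_const]
          later_mean_add[OF s bounded_fun_add[OF sq(1,2)] se] later_mean_add[OF s sq(1,2)])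
    also have "\<dots> \<le> 4 * (G + G + T\<^sup>2 / real ?n * (\<Sum>j<?n. 2 / T\<^sup>2 * G + 2 / T) + (T\<^sup>2 * (c + c') / real ?n)\<^sup>2)"
    proof (intro mult_left_mono add_mono order_refl sum_mono)
      show "later_mean s (\<lambda>z. (g z)\<^sup>2) \<le> G"
        unfolding later_mean_def G_def power2_eq_square using g by (subst env_mean_evolve[OF s]) auto
      show "later_mean s (\<lambda>z. (evolve T g z)\<^sup>2) \<le> G"
        unfolding later_mean_def G_def by (rule env_mean_evolve_square_le[OF T0(1) s g(1,2)])
      fix j
      have "later_mean s (?e j) \<le> E (\<lambda>z. ?r z * ?r z)"
        unfolding later_mean_def by (rule env_mean_evolve_square_le[OF _ s r]) (use T0 in simp)
      then show "later_mean s (?e j) \<le> 2 / T\<^sup>2 * G + 2 / T" using Er by linarith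
    qed auto
    also have "T\<^sup>2 / real ?n * (\<Sum>j<?n. 2 / T\<^sup>2 * G + 2 / T) = 2 * G + 2 * T"
      using T0 by (simp add: power2_eq_square field_simps del: of_nat_Suc)
    finally show ?thesis by simp
  qed
  have "(\<lambda>m. 4 * (4 * G + 2 * T) + 4 * (T\<^sup>2 * (c + c') / real (Suc m))\<^sup>2) \<longlonglongrightarrow> 4 * (4 * G + 2 * T) + 4 * 0\<^sup>2"
    by (intro tendsto_intros lim_const_over_Suc)
  then have "later_mean s (\<lambda>z. (mean_dev i T z)\<^sup>2) \<le> 4 * (4 * G + 2 * T) + 4 * 0\<^sup>2"
    by (rule LIMSEQ_le_const) (use key in blast)
  also have "\<dots> = 16 * G + 8 * T" by simp
  also have "\<dots> \<le> 16 * ((4 * R\<^sup>2 + 2) * (T * sqrt T)) + 8 * (T * sqrt T)"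
    using g(4) T0 unfolding G_def by (intro add_mono mult_left_mono) auto
  finally show ?thesis by (simp add: algebra_simps)
qed

section \<open>The second moment and its doubling\<close>

text \<open>Centred at the linear prediction rather than at the mean, so that the second moment of
  \<open>x\<^sub>t - v t\<close> is exactly the mean of this function over the initial
  environment.\<close>

definition var_dev :: "'d \<Rightarrow> real \<Rightarrow> 'd tagged_state \<Rightarrow> real" where
  "var_dev i t z = (\<integral>y. (coord i y - coord i z - t * speed i)\<^sup>2 \<partial>P t z)"

lemma integrable_affine_square:
  assumes t: "0 \<le> t"
  shows "integrable (P t z) (\<lambda>y. (coord i y - a)\<^sup>2)"
proof -
  interpret prob_space "P t z" by (rule prob_space_kernel[OF t])
  have "(\<lambda>y. (coord i y - a)\<^sup>2) = (\<lambda>y. (coord i y - coord i z)\<^sup>2 + (2 * (coord i z - a)) * (coord i y - coord i z) + (coord i z - a)\<^sup>2)"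
    by (simp add: fun_eq_iff power2_eq_square algebra_simps)
  then show ?thesis
    using integrable_square_displacement[OF t, of z i] integrable_displacement[OF t, of z i] by simp
qed

lemma integral_affine_square:
  assumes t: "0 \<le> t"
  shows "(\<integral>y. (coord i y - a)\<^sup>2 \<partial>P t z) =
    var_dev i t z + 2 * (coord i z + t * speed i - a) * mean_dev i t z + (coord i z + t * speed i - a)\<^sup>2"
proof -
  interpret prob_space "P t z" by (rule prob_space_kernel[OF t])
  let ?A = "coord i z + t * speed i - a"
  have i1: "integrable (P t z) (\<lambda>y. coord i y - coord i z - t * speed i)"
    using integrable_displacement[OF t, of z i] by simp
  have i2: "integrable (P t z) (\<lambda>y. (coord i y - coord i z - t * speed i)\<^sup>2)"
    using integrable_affine_square[OF t, of z i "coord i z + t * speed i"] by (simp add: diff_diff_eq)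
  have "(\<lambda>y. (coord i y - a)\<^sup>2) = (\<lambda>y. (coord i y - coord i z - t * speed i)\<^sup>2 + (2 * ?A) * (coord i y - coord i z - t * speed i) + ?A\<^sup>2)"
    by (simp add: fun_eq_iff power2_eq_square algebra_simps)
  then have "(\<integral>y. (coord i y - a)\<^sup>2 \<partial>P t z) = var_dev i t z + (2 * ?A) * (\<integral>y. coord i y - coord i z - t * speed i \<partial>P t z) + ?A\<^sup>2"
    using i1 i2 by (simp add: var_dev_def prob_space)
  also have "(\<integral>y. coord i y - coord i z - t * speed i \<partial>P t z) = mean_dev i t z"
    using integrable_coord[OF t, of z i] by (simp add: mean_dev_def mean_coord_def prob_space)
  finally show ?thesis .
qed

lemma var_dev_nonneg: "0 \<le> var_dev i t z"
  unfolding var_dev_def by (intro integral_nonneg_AE AE_I2) simp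

lemma var_dev_bound:
  assumes t: "0 \<le> t"
  shows "var_dev i t z \<le> 2 * (R\<^sup>2 * (2 * t\<^sup>2 + t)) + 2 * (t * speed i)\<^sup>2"
proof -
  interpret prob_space "P t z" by (rule prob_space_kernel[OF t])
  have "var_dev i t z \<le> (\<integral>y. 2 * (coord i y - coord i z)\<^sup>2 + 2 * (t * speed i)\<^sup>2 \<partial>P t z)"
    unfolding var_dev_def
  proof (rule integral_mono)
    show "integrable (P t z) (\<lambda>y. (coord i y - coord i z - t * speed i)\<^sup>2)"
      using integrable_affine_square[OF t, of z i "coord i z + t * speed i"] by (simp add: diff_diff_eq)
    show "integrable (P t z) (\<lambda>y. 2 * (coord i y - coord i z)\<^sup>2 + 2 * (t * speed i)\<^sup>2)"
      using integrable_square_displacement[OF t, of z i] by simp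
    show "(coord i y - coord i z - t * speed i)\<^sup>2 \<le> 2 * (coord i y - coord i z)\<^sup>2 + 2 * (t * speed i)\<^sup>2" for y
      by (rule square_diff_le)
  qed
  also have "\<dots> = 2 * (\<integral>y. (coord i y - coord i z)\<^sup>2 \<partial>P t z) + 2 * (t * speed i)\<^sup>2"
    using integrable_square_displacement[OF t, of z i] by (simp add: prob_space)
  finally show ?thesis using integral_square_displacement[OF t, of z i] by linarith
qed

lemma var_dev_bounded_fun:
  assumes t: "0 \<le> t"
  shows "var_dev i t \<in> bounded_fun"
proof (rule bounded_funI)
  show "\<bar>var_dev i t z\<bar> \<le> 2 * (R\<^sup>2 * (2 * t\<^sup>2 + t)) + 2 * (t * speed i)\<^sup>2" for z
    using var_dev_nonneg[of i t z] var_dev_bound[OF t, of i z] by simp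
  \<comment> \<open>In \<open>var_dev\<close> the starting point occurs inside the integrand.
    Recentred at 0 the integrand no longer depends on it, and measurability of the kernel
    applies.\<close>
  have "(\<lambda>z. \<integral>y. (coord i y - 0)\<^sup>2 \<partial>P t z) \<in> borel_measurable tagged_space"
    by (rule measurable_compose[OF kernel_measurable[OF t] integral_measurable_subprob_algebra]) measurable
  moreover have "var_dev i t = (\<lambda>z. (\<integral>y. (coord i y - 0)\<^sup>2 \<partial>P t z) - 2 * (coord i z + t * speed i) * mean_dev i t z - (coord i z + t * speed i)\<^sup>2)"
    unfolding integral_affine_square[OF t] by (simp add: fun_eq_iff)
  moreover note [measurable] = bounded_fun_measurable[OF mean_dev_bounded_fun[OF t]]
  ultimately show "var_dev i t \<in> borel_measurable tagged_space" by simp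
qed

text \<open>By the Markov property at time \<open>s\<close> the second part of the path enters the
  cross term only through its conditional mean. Thus the variance is driven by
  \<open>mean_dev\<close>, which has been estimated.\<close>

lemma var_dev_add:
  assumes s: "0 \<le> s" and t: "0 \<le> t"
  shows "var_dev i (s + t) z \<le>
    5 / 4 * var_dev i s z + 4 * evolve s (\<lambda>z. (mean_dev i t z)\<^sup>2) z + evolve s (var_dev i t) z"
proof -
  let ?a = "coord i z + (s + t) * speed i" and ?b = "coord i z + s * speed i"
  let ?Q = "\<lambda>y. 5 / 4 * (coord i y - ?b)\<^sup>2 + 4 * (mean_dev i t y)\<^sup>2 + var_dev i t y"
  have st: "0 \<le> s + t" using s t by simp
  have bd: "(\<lambda>y. (mean_dev i t y)\<^sup>2) \<in> bounded_fun" "var_dev i t \<in> bounded_fun"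
    unfolding power2_eq_square by (intro bounded_fun_mult mean_dev_bounded_fun var_dev_bounded_fun t)+
  have m: "(\<lambda>y. ennreal ((coord i y - ?a)\<^sup>2)) \<in> borel_measurable tagged_space" by measurable
  have "ennreal (var_dev i (s + t) z) = (\<integral>\<^sup>+y. ennreal ((coord i y - ?a)\<^sup>2) \<partial>P (s + t) z)"
    using nn_integral_eq_integral[OF integrable_affine_square[OF st, of z i ?a]]
    by (simp add: var_dev_def diff_diff_eq)
  also have "\<dots> = (\<integral>\<^sup>+x. \<integral>\<^sup>+y. ennreal ((coord i y - ?a)\<^sup>2) \<partial>P t x \<partial>P s z)"
    unfolding kernel_semigroup[OF s t]
    by (rule nn_integral_bind[OF m]) (rule kernel_fun_measurable[OF s kernel_measurable[OF t]])
  also have "\<dots> \<le> (\<integral>\<^sup>+x. ennreal (?Q x) \<partial>P s z)"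
  proof (rule nn_integral_mono)
    fix x
    let ?A = "coord i x - ?b"
    have "(\<integral>\<^sup>+y. ennreal ((coord i y - ?a)\<^sup>2) \<partial>P t x) = ennreal (\<integral>y. (coord i y - ?a)\<^sup>2 \<partial>P t x)"
      by (intro nn_integral_eq_integral integrable_affine_square t) simp
    also have "(\<integral>y. (coord i y - ?a)\<^sup>2 \<partial>P t x) = var_dev i t x + 2 * ?A * mean_dev i t x + ?A\<^sup>2"
      unfolding integral_affine_square[OF t] by (simp add: algebra_simps)
    also have "\<dots> \<le> ?Q x"
    proof -
      \<comment> \<open>The weights are uneven so that the variance of the first part is multiplied
        by 5/4 only.\<close>
      have "2 * a * w \<le> 1 / 4 * a\<^sup>2 + 4 * w\<^sup>2" for a w :: real
        using zero_le_power2[of "a / 2 - 2 * w"] by (simp add: power2_eq_square algebra_simps)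
      from this[of ?A "mean_dev i t x"] show ?thesis by linarith
    qed
    finally show "(\<integral>\<^sup>+y. ennreal ((coord i y - ?a)\<^sup>2) \<partial>P t x) \<le> ennreal (?Q x)"
      by (simp add: ennreal_leI)
  qed
  also have "\<dots> = ennreal (\<integral>x. ?Q x \<partial>P s z)"
    using integrable_affine_square[OF s, of z i ?b] integrable_kernel[OF s bd(1), of z] integrable_kernel[OF s bd(2), of z]
    by (intro nn_integral_eq_integral) (auto simp: var_dev_nonneg)
  also have "(\<integral>x. ?Q x \<partial>P s z) = 5 / 4 * var_dev i s z + 4 * evolve s (\<lambda>z. (mean_dev i t z)\<^sup>2) z + evolve s (var_dev i t) z"
    using integrable_affine_square[OF s, of z i ?b] integrable_kernel[OF s bd(1), of z] integrable_kernel[OF s bd(2), of z]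
    by (simp add: evolve_def var_dev_def[of i s] diff_diff_eq)
  finally show ?thesis
  proof (subst (asm) ennreal_le_iff)
    have "0 \<le> evolve s (\<lambda>z. (mean_dev i t z)\<^sup>2) z" "0 \<le> evolve s (var_dev i t) z"
      unfolding evolve_def by (auto intro!: integral_nonneg_AE simp: var_dev_nonneg)
    then show "0 \<le> 5 / 4 * var_dev i s z + 4 * evolve s (\<lambda>z. (mean_dev i t z)\<^sup>2) z + evolve s (var_dev i t) z"
      using var_dev_nonneg[of i s z] by simp
  qed
qed

lemma variance_doubling:
  assumes s: "0 \<le> s" and t: "1 \<le> t"
  shows "later_mean s (var_dev i (2 * t)) \<le>
    5 / 4 * later_mean s (var_dev i t) + 4 * ((64 * R\<^sup>2 + 40) * (t * sqrt t)) + later_mean (s + t) (var_dev i t)"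
proof -
  have t0: "0 \<le> t" using t by simp
  have bd: "(\<lambda>y. (mean_dev i t y)\<^sup>2) \<in> bounded_fun" "var_dev i t \<in> bounded_fun" "var_dev i (2 * t) \<in> bounded_fun"
    unfolding power2_eq_square using t0 by (intro bounded_fun_mult mean_dev_bounded_fun var_dev_bounded_fun; simp)+
  have ev: "evolve t (\<lambda>y. (mean_dev i t y)\<^sup>2) \<in> bounded_fun" "evolve t (var_dev i t) \<in> bounded_fun"
    by (intro evolve_bounded_fun t0 bd)+
  have "later_mean s (var_dev i (2 * t)) \<le> later_mean s (\<lambda>z. 5 / 4 * var_dev i t z + 4 * evolve t (\<lambda>z. (mean_dev i t z)\<^sup>2) z + evolve t (var_dev i t) z)"
    using var_dev_add[OF t0 t0, of i] by (intro later_mean_mono s bd bounded_fun_add bounded_fun_cmult ev) simp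
  also have "\<dots> = 5 / 4 * later_mean s (var_dev i t) + 4 * later_mean (s + t) (\<lambda>z. (mean_dev i t z)\<^sup>2) + later_mean (s + t) (var_dev i t)"
    by (simp only: later_mean_add[OF s bounded_fun_add[OF bounded_fun_cmult[OF bd(2)] bounded_fun_cmult[OF ev(1)]] ev(2)]
        later_mean_add[OF s bounded_fun_cmult[OF bd(2)] bounded_fun_cmult[OF ev(1)]] later_mean_cmult
        later_mean_evolve[OF s t0 bd(1)] later_mean_evolve[OF s t0 bd(2)])
  finally show ?thesis using mean_dev_energy[OF t, of "s + t" i] s t0 by simp
qed

text \<open>Induction over dyadic scales, for all \<open>s\<close> at once because the second half
  of an interval starts at a later time. Doubling \<open>t\<close> multiplies the claimed bound by 2
  sqrt 2, which exceeds the factor 9/4 in front of the variance; the surplus absorbs the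
  contribution of the conditional mean.\<close>

lemma variance_bound:
  obtains K where "0 \<le> K" "\<And>t. 1 \<le> t \<Longrightarrow> E (var_dev i t) \<le> K * (t * sqrt t)"
proof -
  define C where "C = 64 * R\<^sup>2 + 40"
  define c0 where "c0 = 2 * (R\<^sup>2 * (2 * 2\<^sup>2 + 2)) + 2 * (2 * \<bar>speed i\<bar>)\<^sup>2"
  \<comment> \<open>The summand \<open>c0\<close> covers the scale from 1 to 2; \<open>8 * C\<close>
    makes \<open>4 * C\<close> at most half of \<open>K\<close>.\<close>
  define K where "K = c0 + 8 * C"
  have C: "0 \<le> C" "0 \<le> c0" by (auto simp: C_def c0_def)
  then have K: "0 \<le> K" by (simp add: K_def)
  have small: "later_mean s (var_dev i t) \<le> K * (t * sqrt t)" if s: "0 \<le> s" and t: "1 \<le> t" "t \<le> 2" for s t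
  proof -
    have "var_dev i t z \<le> c0" for z
    proof -
      have "var_dev i t z \<le> 2 * (R\<^sup>2 * (2 * t\<^sup>2 + t)) + 2 * (t * speed i)\<^sup>2" using t by (intro var_dev_bound) simp
      also have "\<dots> \<le> c0"
      proof -
        have t2: "t\<^sup>2 \<le> 2\<^sup>2" using t by (intro power_mono) auto
        have "(t * speed i)\<^sup>2 = (t * \<bar>speed i\<bar>)\<^sup>2" by (simp add: power_mult_distrib)
        also have "\<dots> \<le> (2 * \<bar>speed i\<bar>)\<^sup>2" using t by (intro power_mono mult_right_mono) auto
        finally show ?thesis unfolding c0_def using t t2 by (intro add_mono mult_left_mono) auto
      qed
      finally show ?thesis .
    qed
    then have "later_mean s (var_dev i t) \<le> later_mean s (\<lambda>_. c0)"
      using t by (intro later_mean_mono s var_dev_bounded_fun bounded_fun_const) auto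
    also have "\<dots> = c0" by (rule later_mean_const[OF s])
    also have "\<dots> \<le> K * 1" using C by (simp add: K_def)
    also have "\<dots> \<le> K * (t * sqrt t)" using t K mult_mono[of 1 t 1 "sqrt t"] by (intro mult_left_mono) auto
    finally show ?thesis .
  qed
  have all: "later_mean s (var_dev i t) \<le> K * (t * sqrt t)" if "0 \<le> s" "1 \<le> t" "t \<le> 2 ^ Suc n" for s t n
    using that
  proof (induction n arbitrary: s t)
    case 0
    then show ?case by (intro small) auto
  next
    case (Suc n)
    show ?case
    proof (cases "t \<le> 2")
      case True
      then show ?thesis using Suc.prems by (intro small) auto
    next
      case False
      define u where "u = t / 2"
      have u: "1 \<le> u" "u \<le> 2 ^ Suc n" "t = 2 * u" using False Suc.prems by (auto simp: u_def)
      have su: "0 \<le> s + u" using u Suc.prems by simp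
      define y where "y = u * sqrt u"
      have y: "0 \<le> y" using u by (simp add: y_def)
      have "later_mean s (var_dev i t) \<le> 5 / 4 * (K * y) + 4 * (C * y) + K * y"
        using variance_doubling[OF Suc.prems(1) u(1), of i] Suc.IH[OF Suc.prems(1) u(1,2)] Suc.IH[OF su u(1,2)]
        unfolding u(3) C_def y_def by linarith
      also have "\<dots> = (9 / 4 * K + 4 * C) * y" by (simp add: algebra_simps)
      \<comment> \<open>Here 9/4 + 1/2 = 11/4 is below 14/5, and 7/5 is a rational lower bound for
        sqrt 2.\<close>
      also have "\<dots> \<le> (2 * (7 / 5) * K) * y"
        using C y by (intro mult_right_mono) (auto simp: K_def)
      also have "\<dots> \<le> (2 * sqrt 2 * K) * y"
      proof (intro mult_right_mono mult_left_mono K y)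
        show "7 / 5 \<le> sqrt 2" by (rule real_le_rsqrt) (simp add: power2_eq_square)
      qed auto
      also have "\<dots> = K * (t * sqrt t)" by (simp add: u(3) y_def real_sqrt_mult)
      finally show ?thesis .
    qed
  qed
  have "E (var_dev i t) \<le> K * (t * sqrt t)" if t: "1 \<le> t" for t
  proof -
    obtain n where "t < 2 ^ n" using real_arch_pow[of 2 t] by auto
    moreover have "(2 :: real) ^ n \<le> 2 ^ Suc n" by simp
    ultimately have "t \<le> 2 ^ Suc n" by linarith
    from all[OF order_refl t this] have "later_mean 0 (var_dev i t) \<le> K * (t * sqrt t)" .
    moreover have "evolve 0 (var_dev i t) = var_dev i t"
      using t by (simp add: fun_eq_iff evolve_zero var_dev_bounded_fun)
    ultimately show ?thesis by (simp add: later_mean_def)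
  qed
  with K that show ?thesis by blast
qed

end

section \<open>Path properties\<close>

text \<open>Fourth powers make the variance of \<open>x\<^sub>t / t\<close>, of order
  \<open>1 / sqrt t\<close>, summable along the grid, while consecutive points still have ratio
  tending to 1. The shift by one keeps the grid at or above 1, where the variance bound
  holds.\<close>

definition grid :: "nat \<Rightarrow> real" where "grid n = real (Suc n) ^ 4"

lemma grid_ge_1: "1 \<le> grid n"
  unfolding grid_def by (rule one_le_power) simp

lemma grid_mono: "m \<le> n \<Longrightarrow> grid m \<le> grid n"
  unfolding grid_def by (rule power_mono) auto

lemma grid_sqrt: "sqrt (grid n) = real (Suc n) ^ 2"
  unfolding grid_def by (rule real_sqrt_unique) (simp_all add: power_mult[symmetric])

lemma summable_inverse_square: "summable (\<lambda>n. c / real (Suc n) ^ 2)"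
proof -
  have "summable (\<lambda>n. inverse (real n ^ 2))"
    using inverse_power_summable[of 2, where 'a = real] by simp
  then have "summable (\<lambda>n. inverse (real (Suc n) ^ 2))"
    by (subst summable_Suc_iff[where f = "\<lambda>n. inverse (real n ^ 2)"])
  from summable_mult[OF this, of c] show ?thesis by (simp add: divide_inverse)
qed

lemma fourth_power_increment:
  assumes "1 \<le> (m :: real)"
  shows "1 \<le> (m + 1) ^ 4 - m ^ 4" "(m + 1) ^ 4 - m ^ 4 \<le> 15 * m ^ 3"
proof -
  have eq: "(m + 1) ^ 4 - m ^ 4 = 4 * m ^ 3 + 6 * m ^ 2 + 4 * m + 1"
    by (simp add: eval_nat_numeral algebra_simps)
  have "m ^ 2 \<le> m ^ 3" "m ^ 1 \<le> m ^ 3" "1 \<le> m ^ 3"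
    using assms by (intro power_increasing one_le_power; simp)+
  then show "(m + 1) ^ 4 - m ^ 4 \<le> 15 * m ^ 3" unfolding eq by simp
  show "1 \<le> (m + 1) ^ 4 - m ^ 4" unfolding eq using assms by simp
qed

lemma grid_increment: "1 \<le> grid (Suc n) - grid n" "grid (Suc n) - grid n \<le> 15 / real (Suc n) * grid n"
proof -
  have eq: "grid (Suc n) = (real (Suc n) + 1) ^ 4" by (simp add: grid_def add.commute)
  show "1 \<le> grid (Suc n) - grid n"
    unfolding eq unfolding grid_def by (rule fourth_power_increment) simp
  have "grid (Suc n) - grid n \<le> 15 * real (Suc n) ^ 3"
    unfolding eq unfolding grid_def by (rule fourth_power_increment) simp
  also have "\<dots> = 15 / real (Suc n) * grid n"
    by (simp add: grid_def eval_nat_numeral del: of_nat_Suc)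
  finally show "grid (Suc n) - grid n \<le> 15 / real (Suc n) * grid n" .
qed

text \<open>Purely deterministic. The tolerances are of the form \<open>1 / real (Suc m)\<close> so
  that the almost sure events behind the hypothesis form a countable family.\<close>

lemma interpolate_grid:
  fixes x :: "real \<Rightarrow> real"
  assumes lim: "(\<lambda>n. x (grid n) / grid n) \<longlonglongrightarrow> v"
    and fluct: "\<And>m. \<forall>\<^sub>F n in sequentially. \<forall>t. grid n \<le> t \<and> t < grid (Suc n) \<longrightarrow>
      \<bar>x t - x (grid n)\<bar> \<le> 2 * (1 / real (Suc m) * grid n)"
  shows "((\<lambda>t. x t / t) \<longlongrightarrow> v) at_top"
proof (rule tendstoI)
  fix e :: real assume e: "0 < e"
  \<comment> \<open>The three errors below add up to \<open>3 + \<bar>v\<bar>\<close> times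
    \<open>\<epsilon> * grid n\<close>; one further unit makes the final inequality strict.\<close>
  define \<epsilon> where "\<epsilon> = e / (4 + \<bar>v\<bar>)"
  have \<epsilon>: "0 < \<epsilon>" using e by (simp add: \<epsilon>_def)
  obtain m where m: "1 / real (Suc m) < \<epsilon>" using nat_approx_posE[OF \<epsilon>] by auto
  have "\<forall>\<^sub>F n in sequentially. dist (x (grid n) / grid n) v < \<epsilon>" by (rule tendstoD[OF lim \<epsilon>])
  moreover have "\<forall>\<^sub>F n in sequentially. 15 / real (Suc n) < \<epsilon>"
    using order_tendstoD(2)[OF lim_const_over_Suc \<epsilon>] .
  ultimately have "\<forall>\<^sub>F n in sequentially. \<forall>t. grid n \<le> t \<and> t < grid (Suc n) \<longrightarrow> \<bar>x t - t * v\<bar> \<le> (3 + \<bar>v\<bar>) * (\<epsilon> * grid n)"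
    using fluct[of m]
  proof eventually_elim
    fix n assume n: "dist (x (grid n) / grid n) v < \<epsilon>" "15 / real (Suc n) < \<epsilon>"
      "\<forall>t. grid n \<le> t \<and> t < grid (Suc n) \<longrightarrow> \<bar>x t - x (grid n)\<bar> \<le> 2 * (1 / real (Suc m) * grid n)"
    have g: "0 < grid n" using grid_ge_1[of n] by simp
    show "\<forall>t. grid n \<le> t \<and> t < grid (Suc n) \<longrightarrow> \<bar>x t - t * v\<bar> \<le> (3 + \<bar>v\<bar>) * (\<epsilon> * grid n)"
    proof (intro allI impI)
      fix t assume t: "grid n \<le> t \<and> t < grid (Suc n)"
      have "x (grid n) - grid n * v = (x (grid n) / grid n - v) * grid n" using g by (simp add: field_simps)
      then have 1: "\<bar>x (grid n) - grid n * v\<bar> \<le> \<epsilon> * grid n"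
        using n(1) g by (simp add: abs_mult dist_real_def mult_right_mono)
      have "2 * (1 / real (Suc m) * grid n) \<le> 2 * (\<epsilon> * grid n)"
        using m g by (intro mult_left_mono mult_right_mono) auto
      then have 2: "\<bar>x t - x (grid n)\<bar> \<le> 2 * (\<epsilon> * grid n)" using n(3) t by fastforce
      have "15 / real (Suc n) * grid n \<le> \<epsilon> * grid n" using n(2) g by (intro mult_right_mono) auto
      then have "\<bar>t - grid n\<bar> \<le> \<epsilon> * grid n" using t grid_increment(2)[of n] by linarith
      from mult_right_mono[OF this, of "\<bar>v\<bar>"]
      have 3: "\<bar>t * v - grid n * v\<bar> \<le> \<epsilon> * grid n * \<bar>v\<bar>" by (simp add: abs_mult[symmetric] left_diff_distrib)
      have "(3 + \<bar>v\<bar>) * (\<epsilon> * grid n) = 3 * (\<epsilon> * grid n) + \<epsilon> * grid n * \<bar>v\<bar>" by (simp add: algebra_simps)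
      with 1 2 3 show "\<bar>x t - t * v\<bar> \<le> (3 + \<bar>v\<bar>) * (\<epsilon> * grid n)" by linarith
    qed
  qed
  then obtain n0 where n0: "\<And>n t. n0 \<le> n \<Longrightarrow> grid n \<le> t \<Longrightarrow> t < grid (Suc n) \<Longrightarrow> \<bar>x t - t * v\<bar> \<le> (3 + \<bar>v\<bar>) * (\<epsilon> * grid n)"
    by (auto simp: eventually_sequentially)
  have "dist (x t / t) v < e" if t: "grid n0 \<le> t" for t
  proof -
    have t0: "0 < t" using t grid_ge_1[of n0] by linarith
    obtain k where "t < real k" using reals_Archimedean2 by blast
    also have "real k \<le> real (Suc (Suc k)) ^ 1" by simp
    also have "\<dots> \<le> grid (Suc k)" unfolding grid_def by (rule power_increasing) auto
    finally have ex: "t < grid (Suc k)" .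
    \<comment> \<open>The least such index also satisfies \<open>grid n \<le> t\<close>, by
      minimality or, for index 0, because \<open>t\<close> is beyond \<open>grid n0\<close>.\<close>
    define n where "n = (LEAST n. t < grid (Suc n))"
    have n: "t < grid (Suc n)" unfolding n_def by (rule LeastI[of _ k]) (rule ex)
    have "n0 \<le> n"
    proof (rule ccontr)
      assume "\<not> n0 \<le> n"
      then have "grid (Suc n) \<le> grid n0" by (intro grid_mono) simp
      with n t show False by linarith
    qed
    moreover have "grid n \<le> t"
    proof (cases n)
      case 0
      then show ?thesis using t grid_mono[of 0 n0] by simp
    next
      case (Suc j)
      have "\<not> t < grid (Suc j)" using not_less_Least[of j "\<lambda>n. t < grid (Suc n)"] Suc unfolding n_def by simp
      then show ?thesis using Suc by simp
    qed
    ultimately have "\<bar>x t - t * v\<bar> \<le> (3 + \<bar>v\<bar>) * (\<epsilon> * grid n)" using n n0 by blast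
    also have "\<dots> \<le> (3 + \<bar>v\<bar>) * (\<epsilon> * t)" using \<open>grid n \<le> t\<close> \<epsilon> by (intro mult_left_mono) auto
    also have "\<dots> < (4 + \<bar>v\<bar>) * (\<epsilon> * t)" using \<epsilon> t0 by (intro mult_strict_right_mono) auto
    also have "\<dots> = e * t" by (simp add: \<epsilon>_def)
    finally have "\<bar>x t - t * v\<bar> < e * t" .
    moreover have "x t / t - v = (x t - t * v) / t" using t0 by (simp add: field_simps)
    ultimately show ?thesis using t0 by (simp add: dist_real_def pos_divide_less_eq)
  qed
  then show "\<forall>\<^sub>F t in at_top. dist (x t / t) v < e"
    unfolding eventually_at_top_linorder by blast
qed

section \<open>The Markov property and convergence along the grid\<close>

locale tagged_process = stationary_semigroup p P \<rho>
  for p :: "(int ^ 'd::finite) pmf" and P and \<rho> :: real +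
  fixes M :: "'w measure" and X :: "real \<Rightarrow> 'w \<Rightarrow> 'd tagged_state"
  assumes markov: "markov_process M tagged_space P X"
    and paths: "\<And>\<omega>. \<omega> \<in> space M \<Longrightarrow> cadlag (\<lambda>t. X t \<omega>)"
    and initial: "distr M tagged_space (X 0) = return (count_space UNIV) 0 \<Otimes>\<^sub>M bernoulli_tagged \<rho>"
begin

sublocale prob_space M
  using markov unfolding markov_process_def by blast

lemma X_measurable: "0 \<le> t \<Longrightarrow> X t \<in> M \<rightarrow>\<^sub>M tagged_space"
  using markov unfolding markov_process_def by blast

abbreviation "H \<equiv> history M tagged_space X"

definition pos :: "'d \<Rightarrow> real \<Rightarrow> 'w \<Rightarrow> real" where
  "pos i t \<omega> = coord i (X t \<omega>)"

lemma pos_measurable: "0 \<le> t \<Longrightarrow> pos i t \<in> borel_measurable M"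
  unfolding pos_def[abs_def] by (rule measurable_compose[OF X_measurable coord_measurable])

lemma sets_history: "sets (H s) = sigma_sets (space M) {X u -` A \<inter> space M |u A. 0 \<le> u \<and> u \<le> s \<and> A \<in> sets tagged_space}"
  unfolding history_def by (rule sets_measure_of) auto

lemma space_history: "space (H s) = space M"
  unfolding history_def by (rule space_measure_of) auto

lemma history_le: "sets (H s) \<subseteq> sets M"
  unfolding sets_history
  by (rule sets.sigma_sets_subset) (auto intro: measurable_sets[OF X_measurable])

lemma X_history_measurable: "0 \<le> u \<Longrightarrow> u \<le> s \<Longrightarrow> X u \<in> H s \<rightarrow>\<^sub>M tagged_space"
  by (rule measurableI) (auto simp: space_history sets_history)

lemma pos_history_measurable: "0 \<le> u \<Longrightarrow> u \<le> s \<Longrightarrow> pos i u \<in> borel_measurable (H s)"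
  unfolding pos_def[abs_def] by (rule measurable_compose[OF X_history_measurable coord_measurable])

text \<open>The conditional expectation in the definition of the process, integrated over an event
  of the history; this form is free of exceptional null sets.\<close>

lemma emeasure_markov:
  assumes s: "0 \<le> s" and t: "0 \<le> t" and A: "A \<in> sets (H s)" and B: "B \<in> sets tagged_space"
  shows "emeasure M (A \<inter> {\<omega>\<in>space M. X (s + t) \<omega> \<in> B}) = (\<integral>\<^sup>+\<omega>. emeasure (P t (X s \<omega>)) B * indicator A \<omega> \<partial>M)"
proof -
  have "finite_measure_subalgebra M (H s)"
    by unfold_locales (simp add: subalgebra_def space_history history_le)
  then interpret F: finite_measure_subalgebra M "H s" .
  have AM: "A \<in> sets M" using A history_le by blast
  have [measurable]: "X (s + t) \<in> M \<rightarrow>\<^sub>M tagged_space" "X s \<in> M \<rightarrow>\<^sub>M tagged_space"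
    using s t by (auto intro: X_measurable)
  note [measurable] = B AM kernel_measurable[OF t]
  let ?f = "\<lambda>\<omega>. indicator B (X (s + t) \<omega>) :: real"
  let ?g = "\<lambda>\<omega>. measure (P t (X s \<omega>)) B"
  have f: "integrable M ?f" by (rule integrable_const_bound[of _ 1]) (auto intro!: AE_I2)
  have gm: "?g \<in> borel_measurable M" by measurable
  have g1: "\<bar>?g \<omega>\<bar> \<le> 1" for \<omega> using prob_space.prob_le_1[OF prob_space_kernel[OF t]] by simp
  have g: "integrable M ?g" by (rule integrable_const_bound[of _ 1]) (use gm g1 in auto)
  have gA: "integrable M (\<lambda>\<omega>. indicator A \<omega> * ?g \<omega>)" using integrable_mult_indicator[OF AM g] by simp
  have "AE \<omega> in M. real_cond_exp M (H s) ?f \<omega> = ?g \<omega>"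
    using markov s t B unfolding markov_process_def by blast
  then have "(\<integral>\<omega>\<in>A. real_cond_exp M (H s) ?f \<omega> \<partial>M) = (\<integral>\<omega>\<in>A. ?g \<omega> \<partial>M)"
    unfolding set_lebesgue_integral_def using AM gm
    by (intro integral_cong_AE) (auto intro!: measurable_from_subalg[OF F.subalg] borel_measurable_scaleR borel_measurable_indicator)
  moreover have "(\<integral>\<omega>\<in>A. ?f \<omega> \<partial>M) = (\<integral>\<omega>\<in>A. real_cond_exp M (H s) ?f \<omega> \<partial>M)"
    by (rule F.real_cond_exp_intA[OF f A])
  ultimately have "(\<integral>\<omega>. indicator A \<omega> * ?f \<omega> \<partial>M) = (\<integral>\<omega>. indicator A \<omega> * ?g \<omega> \<partial>M)"
    by (simp add: set_lebesgue_integral_def)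
  moreover have "(\<integral>\<omega>. indicator A \<omega> * ?f \<omega> \<partial>M) = measure M (A \<inter> {\<omega>\<in>space M. X (s + t) \<omega> \<in> B})"
  proof -
    have "(\<integral>\<omega>. indicator A \<omega> * ?f \<omega> \<partial>M) = (\<integral>\<omega>. indicator (A \<inter> {\<omega>\<in>space M. X (s + t) \<omega> \<in> B}) \<omega> \<partial>M)"
      by (intro Bochner_Integration.integral_cong refl) (auto simp: indicator_def)
    also have "\<dots> = measure M ((A \<inter> {\<omega>\<in>space M. X (s + t) \<omega> \<in> B}) \<inter> space M)" by simp
    also have "(A \<inter> {\<omega>\<in>space M. X (s + t) \<omega> \<in> B}) \<inter> space M = A \<inter> {\<omega>\<in>space M. X (s + t) \<omega> \<in> B}" by auto
    finally show ?thesis .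
  qed
  ultimately have "emeasure M (A \<inter> {\<omega>\<in>space M. X (s + t) \<omega> \<in> B}) = ennreal (\<integral>\<omega>. indicator A \<omega> * ?g \<omega> \<partial>M)"
    by (simp add: emeasure_eq_measure)
  also have "\<dots> = (\<integral>\<^sup>+\<omega>. ennreal (indicator A \<omega> * ?g \<omega>) \<partial>M)"
    by (rule nn_integral_eq_integral[symmetric, OF gA]) simp
  also have "\<dots> = (\<integral>\<^sup>+\<omega>. emeasure (P t (X s \<omega>)) B * indicator A \<omega> \<partial>M)"
    by (intro nn_integral_cong)
      (auto simp: indicator_def finite_measure.emeasure_eq_measure[OF prob_space.finite_measure[OF prob_space_kernel[OF t]]])
  finally show ?thesis .
qed

text \<open>The case \<open>s = 0\<close> with the sure event: the one-dimensional laws are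
  determined by the initial law and the kernel.\<close>

lemma distr_X:
  assumes t: "0 \<le> t"
  shows "distr M tagged_space (X t) = bind (distr M tagged_space (X 0)) (P t)"
proof (rule measure_eqI)
  have K: "P t \<in> distr M tagged_space (X 0) \<rightarrow>\<^sub>M subprob_algebra tagged_space"
    using kernel_measurable[OF t] by simp
  have ne: "space (distr M tagged_space (X 0)) \<noteq> {}" by simp
  show "sets (distr M tagged_space (X t)) = sets (bind (distr M tagged_space (X 0)) (P t))"
    by (subst sets_bind[OF _ ne]) (auto simp: sets_kernel_eq[OF t])
  fix B assume "B \<in> sets (distr M tagged_space (X t))"
  then have B: "B \<in> sets tagged_space" by simp
  note [measurable] = X_measurable[OF order_refl]
  have "emeasure (distr M tagged_space (X t)) B = emeasure M (space M \<inter> {\<omega>\<in>space M. X (0 + t) \<omega> \<in> B})"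
    by (subst emeasure_distr[OF X_measurable[OF t] B]) (auto intro!: arg_cong[of _ _ "emeasure M"])
  also have "\<dots> = (\<integral>\<^sup>+\<omega>. emeasure (P t (X 0 \<omega>)) B * indicator (space M) \<omega> \<partial>M)"
    using sets.top[of "H 0"] by (intro emeasure_markov order_refl t B) (simp add: space_history)
  also have "\<dots> = (\<integral>\<^sup>+\<omega>. emeasure (P t (X 0 \<omega>)) B \<partial>M)"
    by (intro nn_integral_cong) simp
  also have "\<dots> = (\<integral>\<^sup>+z. emeasure (P t z) B \<partial>distr M tagged_space (X 0))"
    by (rule nn_integral_distr[symmetric, OF X_measurable[OF order_refl]])
      (use measurable_emeasure_kernel[OF kernel_measurable[OF t] B] in simp)
  also have "\<dots> = emeasure (bind (distr M tagged_space (X 0)) (P t)) B"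
    by (rule emeasure_bind[symmetric, OF ne K B])
  finally show "emeasure (distr M tagged_space (X t)) B = emeasure (bind (distr M tagged_space (X 0)) (P t)) B" .
qed

lemma sets_initial: "sets (return (count_space UNIV) 0 \<Otimes>\<^sub>M bernoulli_tagged \<rho>) = sets tagged_space"
  unfolding tagged_space_def by (intro sets_pair_measure_cong sets_bernoulli_tagged) simp

lemma nn_integral_X:
  assumes t: "0 \<le> t" and f: "f \<in> borel_measurable tagged_space"
  shows "(\<integral>\<^sup>+\<omega>. f (X t \<omega>) \<partial>M) = (\<integral>\<^sup>+\<xi>. \<integral>\<^sup>+y. f y \<partial>P t (0, \<xi>) \<partial>bernoulli_tagged \<rho>)"
proof -
  let ?N = "bernoulli_tagged \<rho> :: 'd config measure" and ?D = "return (count_space UNIV) 0 :: (int ^ 'd) measure"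
  interpret N: prob_space ?N by (rule prob_space_bernoulli_tagged)
  have m: "(\<lambda>z. \<integral>\<^sup>+y. f y \<partial>P t z) \<in> borel_measurable tagged_space"
    by (rule measurable_compose[OF kernel_measurable[OF t] nn_integral_measurable_subprob_algebra[OF f]])
  have m': "(\<lambda>z. \<integral>\<^sup>+y. f y \<partial>P t z) \<in> borel_measurable (?D \<Otimes>\<^sub>M ?N)"
    using m by (simp add: measurable_cong_sets[OF sets_initial refl])
  have "(\<integral>\<^sup>+\<omega>. f (X t \<omega>) \<partial>M) = (\<integral>\<^sup>+y. f y \<partial>distr M tagged_space (X t))"
    by (rule nn_integral_distr[symmetric, OF X_measurable[OF t]]) (use f in simp)
  also have "\<dots> = (\<integral>\<^sup>+z. \<integral>\<^sup>+y. f y \<partial>P t z \<partial>distr M tagged_space (X 0))"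
    unfolding distr_X[OF t] by (rule nn_integral_bind[OF f]) (use kernel_measurable[OF t] in simp)
  also have "\<dots> = (\<integral>\<^sup>+x. \<integral>\<^sup>+\<xi>. \<integral>\<^sup>+y. f y \<partial>P t (x, \<xi>) \<partial>?N \<partial>?D)"
    unfolding initial by (rule N.nn_integral_fst[symmetric, OF m'])
  also have "\<dots> = (\<integral>\<^sup>+\<xi>. \<integral>\<^sup>+y. f y \<partial>P t (0, \<xi>) \<partial>?N)"
    by (rule nn_integral_return) auto
  finally show ?thesis .
qed

lemma second_moment:
  assumes t: "0 \<le> t"
  shows "(\<integral>\<^sup>+\<omega>. ennreal ((pos i t \<omega> - t * speed i)\<^sup>2) \<partial>M) = ennreal (E (var_dev i t))"
proof -
  have m: "(\<lambda>y. ennreal ((coord i y - t * speed i)\<^sup>2)) \<in> borel_measurable tagged_space" by measurable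
  have "(\<integral>\<^sup>+y. ennreal ((coord i y - t * speed i)\<^sup>2) \<partial>P t (0, \<xi>)) = ennreal (var_dev i t (0, \<xi>))" for \<xi>
    using nn_integral_eq_integral[OF integrable_affine_square[OF t, of "(0, \<xi>)" i "t * speed i"]]
    by (simp add: var_dev_def coord_def)
  then have "(\<integral>\<^sup>+\<omega>. ennreal ((pos i t \<omega> - t * speed i)\<^sup>2) \<partial>M) = (\<integral>\<^sup>+\<xi>. ennreal (var_dev i t (0, \<xi>)) \<partial>bernoulli_tagged \<rho>)"
    using nn_integral_X[OF t m] by (simp add: pos_def)
  also have "\<dots> = ennreal (E (var_dev i t))"
    unfolding env_mean_def
    by (intro nn_integral_eq_integral integrable_origin var_dev_bounded_fun t AE_I2 var_dev_nonneg)
  finally show ?thesis .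
qed

text \<open>Along the grid the squared errors have summable means. Their sum is therefore almost
  surely finite, and its terms tend to zero.\<close>

lemma converges_along_grid: "AE \<omega> in M. (\<lambda>n. pos i (grid n) \<omega> / grid n) \<longlonglongrightarrow> speed i"
proof -
  obtain K where K: "0 \<le> K" "\<And>t. 1 \<le> t \<Longrightarrow> E (var_dev i t) \<le> K * (t * sqrt t)"
    using variance_bound by blast
  let ?f = "\<lambda>n \<omega>. (pos i (grid n) \<omega> / grid n - speed i)\<^sup>2"
  have g: "0 < grid n" "0 \<le> grid n" for n using grid_ge_1[of n] by linarith+
  note [measurable] = pos_measurable[OF g(2)]
  have bound: "(\<integral>\<^sup>+\<omega>. ennreal (?f n \<omega>) \<partial>M) \<le> ennreal (K / real (Suc n) ^ 2)" for n
  proof -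
    have eq: "?f n \<omega> = 1 / (grid n)\<^sup>2 * (pos i (grid n) \<omega> - grid n * speed i)\<^sup>2" for \<omega>
      using g(1)[of n] by (simp add: power2_eq_square field_simps)
    have "(\<integral>\<^sup>+\<omega>. ennreal (?f n \<omega>) \<partial>M) = ennreal (1 / (grid n)\<^sup>2) * (\<integral>\<^sup>+\<omega>. ennreal ((pos i (grid n) \<omega> - grid n * speed i)\<^sup>2) \<partial>M)"
    proof (subst nn_integral_cmult[symmetric])
      show "(\<lambda>\<omega>. ennreal ((pos i (grid n) \<omega> - grid n * speed i)\<^sup>2)) \<in> borel_measurable M" by measurable
      show "(\<integral>\<^sup>+\<omega>. ennreal (?f n \<omega>) \<partial>M) =
          (\<integral>\<^sup>+\<omega>. ennreal (1 / (grid n)\<^sup>2) * ennreal ((pos i (grid n) \<omega> - grid n * speed i)\<^sup>2) \<partial>M)"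
        unfolding eq by (intro nn_integral_cong ennreal_mult) auto
    qed
    also have "\<dots> = ennreal (1 / (grid n)\<^sup>2 * E (var_dev i (grid n)))"
      unfolding second_moment[OF g(2)] by (rule ennreal_mult''[symmetric])
        (simp add: env_mean_def var_dev_nonneg)
    also have "\<dots> \<le> ennreal (1 / (grid n)\<^sup>2 * (K * (grid n * sqrt (grid n))))"
      by (intro ennreal_leI mult_left_mono K grid_ge_1) simp
    also have "1 / (grid n)\<^sup>2 * (K * (grid n * sqrt (grid n))) = K / real (Suc n) ^ 2"
      unfolding grid_sqrt unfolding grid_def by (simp add: field_simps power2_eq_square power4_eq_xxxx del: of_nat_Suc)
    finally show ?thesis .
  qed
  have "(\<integral>\<^sup>+\<omega>. (\<Sum>n. ennreal (?f n \<omega>)) \<partial>M) = (\<Sum>n. \<integral>\<^sup>+\<omega>. ennreal (?f n \<omega>) \<partial>M)"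
    by (rule nn_integral_suminf) measurable
  also have "\<dots> \<le> (\<Sum>n. ennreal (K / real (Suc n) ^ 2))"
    by (intro suminf_le bound) auto
  also have "\<dots> = ennreal (\<Sum>n. K / real (Suc n) ^ 2)"
    using K by (intro suminf_ennreal_eq summable_sums summable_inverse_square) auto
  finally have "(\<integral>\<^sup>+\<omega>. (\<Sum>n. ennreal (?f n \<omega>)) \<partial>M) \<noteq> \<infinity>"
    using ennreal_less_top le_less_trans by (metis infinity_ennreal_def less_irrefl)
  then have "AE \<omega> in M. (\<Sum>n. ennreal (?f n \<omega>)) \<noteq> \<infinity>"
    by (intro nn_integral_PInf_AE) measurable
  then show ?thesis
  proof eventually_elim
    fix \<omega> assume "(\<Sum>n. ennreal (?f n \<omega>)) \<noteq> \<infinity>"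
    then have "summable (\<lambda>n. ?f n \<omega>)" by (intro summable_suminf_not_top) auto
    then have "(\<lambda>n. ?f n \<omega>) \<longlonglongrightarrow> 0" by (rule summable_LIMSEQ_zero)
    then have "(\<lambda>n. pos i (grid n) \<omega> / grid n - speed i) \<longlonglongrightarrow> 0"
      by (subst (asm) power_tendsto_0_iff) simp_all
    then show "(\<lambda>n. pos i (grid n) \<omega> / grid n) \<longlonglongrightarrow> speed i" by (rule LIM_zero_cancel)
  qed
qed

section \<open>Fluctuations between grid points\<close>

definition spread :: "real \<Rightarrow> real" where "spread t = R\<^sup>2 * (2 * t\<^sup>2 + t)"

lemma spread_mono: "0 \<le> s \<Longrightarrow> s \<le> t \<Longrightarrow> spread s \<le> spread t"
  unfolding spread_def by (intro mult_left_mono add_mono power_mono) auto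

lemma kernel_far:
  assumes t: "0 \<le> t" and d: "0 < d"
  shows "emeasure (P t z) {y. d \<le> \<bar>coord i y - coord i z\<bar>} \<le> ennreal (spread t / d\<^sup>2)"
proof -
  have "space (P t z) = UNIV" using sets_eq_imp_space_eq[OF sets_kernel_eq[OF t, of z]] by simp
  then have "{y. d \<le> \<bar>coord i y - coord i z\<bar>} = {y\<in>space (P t z). d\<^sup>2 \<le> (coord i y - coord i z)\<^sup>2}"
    using d by (auto simp: abs_le_square_iff[symmetric])
  then have "emeasure (P t z) {y. d \<le> \<bar>coord i y - coord i z\<bar>} \<le> ennreal (1 / d\<^sup>2 * (\<integral>y. (coord i y - coord i z)\<^sup>2 \<partial>P t z))"
    using integral_Markov_inequality[OF integrable_square_displacement[OF t, of z i], of "d\<^sup>2"] d by simp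
  also have "\<dots> \<le> ennreal (1 / d\<^sup>2 * spread t)"
    unfolding spread_def by (intro ennreal_leI mult_left_mono integral_square_displacement t) simp
  finally show ?thesis by simp
qed

text \<open>The target set depends on the position at time \<open>s\<close>, whereas
  \<open>emeasure_markov\<close> needs a fixed one. The coordinate being an integer,
  \<open>A\<close> is split into countably many events on which it is constant, and Chebyshev's
  inequality for the kernel is used on each.\<close>

lemma markov_far:
  assumes s: "0 \<le> s" and t: "0 \<le> t" and d: "0 < d" and A: "A \<in> sets (H s)"
  shows "measure M (A \<inter> {\<omega>\<in>space M. d \<le> \<bar>pos i (s + t) \<omega> - pos i s \<omega>\<bar>}) \<le> spread t / d\<^sup>2 * measure M A"
proof -
  have AM: "A \<in> sets M" using A history_le by blast
  have As: "A \<subseteq> space M" using sets.sets_into_space[OF AM] .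
  have sp: "0 \<le> spread t / d\<^sup>2" unfolding spread_def using t by simp
  define C where "C = (\<lambda>m :: int. A \<inter> {\<omega>\<in>space M. pos i s \<omega> = real_of_int m})"
  define F where "F = (\<lambda>m :: int. {y :: 'd tagged_state. d \<le> \<bar>coord i y - real_of_int m\<bar>})"
  have C: "C m \<in> sets (H s)" for m
  proof -
    have "pos i s -` {real_of_int m} \<inter> space (H s) \<in> sets (H s)"
      by (rule measurable_sets[OF pos_history_measurable[OF s order_refl]]) simp
    moreover have "C m = A \<inter> (pos i s -` {real_of_int m} \<inter> space (H s))" by (auto simp: C_def space_history)
    ultimately show ?thesis using A by simp
  qed
  have F: "F m \<in> sets tagged_space" for m
  proof -
    have "{y\<in>space tagged_space. d \<le> \<bar>coord i y - real_of_int m\<bar>} \<in> sets tagged_space" by measurable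
    then show ?thesis by (simp add: F_def)
  qed
  have st: "0 \<le> s + t" using s t by simp
  have Xs: "{\<omega>\<in>space M. X (s + t) \<omega> \<in> F m} \<in> sets M" for m
    using measurable_sets[OF X_measurable[OF st] F[of m]] by (simp add: vimage_def Int_def conj_commute)
  have CM: "C m \<in> sets M" for m using C history_le by blast
  have coord_int: "\<exists>m. coord i y = real_of_int m" for y :: "'d tagged_state" by (auto simp: coord_def)
  have "A \<inter> {\<omega>\<in>space M. d \<le> \<bar>pos i (s + t) \<omega> - pos i s \<omega>\<bar>} = (\<Union>m. C m \<inter> {\<omega>\<in>space M. X (s + t) \<omega> \<in> F m})"
    using coord_int by (fastforce simp: C_def F_def pos_def)
  then have "emeasure M (A \<inter> {\<omega>\<in>space M. d \<le> \<bar>pos i (s + t) \<omega> - pos i s \<omega>\<bar>}) =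
      (\<integral>\<^sup>+m. emeasure M (C m \<inter> {\<omega>\<in>space M. X (s + t) \<omega> \<in> F m}) \<partial>count_space UNIV)"
    by (simp only:) (rule emeasure_UN_countable; use CM Xs in \<open>auto simp: disjoint_family_on_def C_def\<close>)
  also have "\<dots> \<le> (\<integral>\<^sup>+m. ennreal (spread t / d\<^sup>2) * emeasure M (C m) \<partial>count_space UNIV)"
  proof (rule nn_integral_mono)
    fix m
    have "emeasure M (C m \<inter> {\<omega>\<in>space M. X (s + t) \<omega> \<in> F m}) = (\<integral>\<^sup>+\<omega>. emeasure (P t (X s \<omega>)) (F m) * indicator (C m) \<omega> \<partial>M)"
      by (rule emeasure_markov[OF s t C F])
    also have "\<dots> \<le> (\<integral>\<^sup>+\<omega>. ennreal (spread t / d\<^sup>2) * indicator (C m) \<omega> \<partial>M)"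
    proof (rule nn_integral_mono)
      fix \<omega>
      show "emeasure (P t (X s \<omega>)) (F m) * indicator (C m) \<omega> \<le> ennreal (spread t / d\<^sup>2) * indicator (C m) \<omega>"
      proof (cases "\<omega> \<in> C m")
        case True
        then have "coord i (X s \<omega>) = real_of_int m" by (simp add: C_def pos_def)
        then show ?thesis using kernel_far[OF t d, of "X s \<omega>" i] by (simp add: F_def True)
      qed simp
    qed
    also have "\<dots> = ennreal (spread t / d\<^sup>2) * emeasure M (C m)" using CM by (rule nn_integral_cmult_indicator)
    finally show "emeasure M (C m \<inter> {\<omega>\<in>space M. X (s + t) \<omega> \<in> F m}) \<le> ennreal (spread t / d\<^sup>2) * emeasure M (C m)" .
  qed
  also have "\<dots> = ennreal (spread t / d\<^sup>2) * (\<integral>\<^sup>+m. emeasure M (C m) \<partial>count_space UNIV)"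
    by (rule nn_integral_cmult) simp
  also have "(\<integral>\<^sup>+m. emeasure M (C m) \<partial>count_space UNIV) = emeasure M (\<Union>m. C m)"
    by (rule emeasure_UN_countable[symmetric]) (use CM in \<open>auto simp: disjoint_family_on_def C_def\<close>)
  also have "(\<Union>m. C m) = A" using As coord_int by (fastforce simp: C_def pos_def)
  also have "ennreal (spread t / d\<^sup>2) * emeasure M A = ennreal (spread t / d\<^sup>2 * measure M A)"
    unfolding emeasure_eq_measure by (rule ennreal_mult[symmetric]) (use sp in auto)
  finally have "ennreal (measure M (A \<inter> {\<omega>\<in>space M. d \<le> \<bar>pos i (s + t) \<omega> - pos i s \<omega>\<bar>})) \<le> ennreal (spread t / d\<^sup>2 * measure M A)"
    by (simp add: emeasure_eq_measure)
  moreover have "0 \<le> spread t / d\<^sup>2 * measure M A" using sp by (intro mult_nonneg_nonneg) auto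
  ultimately show ?thesis by (simp only: ennreal_le_iff)
qed

text \<open>Ottaviani's inequality, via the first time in \<open>Q\<close> at which the particle is far away.\<close>

lemma maximal_inequality_finite:
  assumes a: "0 \<le> a" "a \<le> b" and Q: "finite Q" "Q \<subseteq> {a..b}" and d: "0 < d"
    and half: "spread (b - a) / d\<^sup>2 \<le> 1 / 2"
  shows "measure M {\<omega>\<in>space M. \<exists>q\<in>Q. 2 * d < \<bar>pos i q \<omega> - pos i a \<omega>\<bar>} \<le> 2 * (spread (b - a) / d\<^sup>2)"
proof -
  define A where "A = (\<lambda>q. {\<omega>\<in>space M. 2 * d < \<bar>pos i q \<omega> - pos i a \<omega>\<bar> \<and> (\<forall>r\<in>{r\<in>Q. r < q}. \<bar>pos i r \<omega> - pos i a \<omega>\<bar> \<le> 2 * d)})"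
  define B where "B = {\<omega>\<in>space M. d \<le> \<bar>pos i b \<omega> - pos i a \<omega>\<bar>}"
  define N where "N = (\<lambda>q. {\<omega>\<in>space M. d \<le> \<bar>pos i b \<omega> - pos i q \<omega>\<bar>})"
  have nonneg: "0 \<le> q" "a \<le> q" "q \<le> b" if "q \<in> Q" for q using Q that a by auto
  have posM: "pos i q \<in> borel_measurable M" if "q \<in> insert a (insert b Q)" for q
    by (rule pos_measurable) (use that nonneg a in auto)
  have AH: "A q \<in> sets (H q)" if q: "q \<in> Q" for q
  proof -
    have m: "pos i r \<in> borel_measurable (H q)" if "r \<in> insert a {r\<in>Q. r < q} \<union> {q}" for r
      using that q nonneg a by (intro pos_history_measurable) auto
    note [measurable] = m
    have "finite {r\<in>Q. r < q}" using Q by simp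
    moreover have "Measurable.pred (H q) (\<lambda>\<omega>. \<bar>pos i r \<omega> - pos i a \<omega>\<bar> \<le> 2 * d)" if "r \<in> {r\<in>Q. r < q}" for r
      using m[of r] m[of a] that by simp measurable
    ultimately have "Measurable.pred (H q) (\<lambda>\<omega>. \<forall>r\<in>{r\<in>Q. r < q}. \<bar>pos i r \<omega> - pos i a \<omega>\<bar> \<le> 2 * d)"
      by (intro pred_intros_finite) auto
    moreover have "Measurable.pred (H q) (\<lambda>\<omega>. 2 * d < \<bar>pos i q \<omega> - pos i a \<omega>\<bar>)"
      using m[of q] m[of a] by simp measurable
    ultimately have "{\<omega>\<in>space (H q). 2 * d < \<bar>pos i q \<omega> - pos i a \<omega>\<bar> \<and> (\<forall>r\<in>{r\<in>Q. r < q}. \<bar>pos i r \<omega> - pos i a \<omega>\<bar> \<le> 2 * d)} \<in> sets (H q)"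
      by measurable
    then show ?thesis unfolding A_def by (simp only: space_history)
  qed
  have AM: "A q \<in> sets M" if "q \<in> Q" for q using AH[OF that] history_le by blast
  have BM: "B \<in> sets M" using posM[of a] posM[of b] unfolding B_def by simp measurable
  have NM: "N q \<in> sets M" if "q \<in> Q" for q using posM[of q] posM[of b] that unfolding N_def by simp measurable
  have disj: "disjoint_family_on A Q"
    unfolding disjoint_family_on_def
  proof (intro ballI impI)
    fix q r assume qr: "q \<in> Q" "r \<in> Q" "q \<noteq> r"
    then consider "q < r" | "r < q" by linarith
    then show "A q \<inter> A r = {}" using qr by cases (fastforce simp: A_def)+
  qed
  have W: "{\<omega>\<in>space M. \<exists>q\<in>Q. 2 * d < \<bar>pos i q \<omega> - pos i a \<omega>\<bar>} = (\<Union>q\<in>Q. A q)"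
  proof safe
    fix \<omega> q assume w: "\<omega> \<in> space M" "q \<in> Q" "2 * d < \<bar>pos i q \<omega> - pos i a \<omega>\<bar>"
    define Z where "Z = {q\<in>Q. 2 * d < \<bar>pos i q \<omega> - pos i a \<omega>\<bar>}"
    have Z: "finite Z" "Z \<noteq> {}" using Q w by (auto simp: Z_def)
    have "Min Z \<in> Z" "\<And>r. r \<in> Z \<Longrightarrow> Min Z \<le> r" using Z by auto
    moreover have "\<bar>pos i r \<omega> - pos i a \<omega>\<bar> \<le> 2 * d" if "r \<in> Q" "r < Min Z" for r
    proof (rule ccontr)
      assume "\<not> \<bar>pos i r \<omega> - pos i a \<omega>\<bar> \<le> 2 * d"
      then have "Min Z \<le> r" using \<open>r \<in> Q\<close> Z(1) by (intro Min_le) (auto simp: Z_def)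
      with that show False by simp
    qed
    ultimately have "\<omega> \<in> A (Min Z)" "Min Z \<in> Q"
      using w(1) unfolding A_def Z_def by blast+
    then show "\<omega> \<in> (\<Union>q\<in>Q. A q)" by blast
  qed (auto simp: A_def)
  \<comment> \<open>Given the first exceedance at \<open>q\<close>, the later displacement up to
    \<open>b\<close> reaches \<open>d\<close> with probability at most one half.\<close>
  have half_mass: "measure M (A q) \<le> 2 * measure M (A q - N q)" if q: "q \<in> Q" for q
  proof -
    have bq: "0 \<le> b - q" "q + (b - q) = b" using nonneg[OF q] by auto
    have "measure M (A q \<inter> N q) \<le> spread (b - q) / d\<^sup>2 * measure M (A q)"
      using markov_far[OF nonneg(1)[OF q] bq(1) d AH[OF q], of i] unfolding bq(2) N_def .
    also have "\<dots> \<le> 1 / 2 * measure M (A q)"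
    proof (intro mult_right_mono)
      have "spread (b - q) / d\<^sup>2 \<le> spread (b - a) / d\<^sup>2"
        using nonneg[OF q] by (intro divide_right_mono spread_mono) auto
      then show "spread (b - q) / d\<^sup>2 \<le> 1 / 2" using half by linarith
    qed simp
    finally show ?thesis using finite_measure_Diff'[OF AM[OF q] NM[OF q]] by linarith
  qed
  have "measure M (\<Union>q\<in>Q. A q) = (\<Sum>q\<in>Q. measure M (A q))"
    using Q AM disj by (intro finite_measure_finite_Union) auto
  also have "\<dots> \<le> (\<Sum>q\<in>Q. 2 * measure M (A q - N q))" by (intro sum_mono half_mass)
  also have "\<dots> = 2 * (\<Sum>q\<in>Q. measure M (A q - N q))" by (simp add: sum_distrib_left)
  also have "(\<Sum>q\<in>Q. measure M (A q - N q)) = measure M (\<Union>q\<in>Q. A q - N q)"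
  proof (rule finite_measure_finite_Union[symmetric])
    show "disjoint_family_on (\<lambda>q. A q - N q) Q" using disj by (auto simp: disjoint_family_on_def)
  qed (use Q AM NM in auto)
  \<comment> \<open>More than \<open>2 * d\<close> away at time \<open>q\<close> and moving less
    than \<open>d\<close> afterwards leaves the particle more than \<open>d\<close> away at time
    \<open>b\<close>.\<close>
  also have "\<dots> \<le> measure M B"
    by (rule finite_measure_mono[OF _ BM]) (auto simp: A_def N_def B_def)
  also have "measure M B \<le> spread (b - a) / d\<^sup>2"
  proof -
    have "space M \<in> sets (H a)" using sets.top[of "H a"] by (simp add: space_history)
    have ab: "0 \<le> b - a" "a + (b - a) = b" using a by auto
    have "measure M (space M \<inter> B) \<le> spread (b - a) / d\<^sup>2 * measure M (space M)"
      using markov_far[OF a(1) ab(1) d \<open>space M \<in> sets (H a)\<close>, of i] unfolding ab(2) B_def .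
    moreover have "space M \<inter> B = B" using sets.sets_into_space[OF BM] by blast
    ultimately show ?thesis by (simp only: prob_space mult_1_right)
  qed
  finally show ?thesis unfolding W by simp
qed

text \<open>The finite bound does not depend on the number of times, so it passes to the rationals
  along an increasing exhaustion by finite sets.\<close>

lemma maximal_inequality:
  fixes i
  assumes a: "0 \<le> a" "a \<le> b" and d: "0 < d" and half: "spread (b - a) / d\<^sup>2 \<le> 1 / 2"
  defines "W \<equiv> {\<omega>\<in>space M. \<exists>q\<in>\<rat> \<inter> {a..b}. 2 * d < \<bar>pos i q \<omega> - pos i a \<omega>\<bar>}"
  shows "W \<in> sets M" "measure M W \<le> 2 * (spread (b - a) / d\<^sup>2)"
proof -
  let ?Q = "\<rat> \<inter> {a..b}"
  define V where "V = (\<lambda>Q. {\<omega>\<in>space M. \<exists>q\<in>Q. 2 * d < \<bar>pos i q \<omega> - pos i a \<omega>\<bar>})"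
  have cQ: "countable ?Q" by (rule countable_subset[OF _ countable_rat]) auto
  have V1: "{\<omega>\<in>space M. 2 * d < \<bar>pos i q \<omega> - pos i a \<omega>\<bar>} \<in> sets M" if "q \<in> ?Q" for q
  proof -
    have [measurable]: "pos i q \<in> borel_measurable M" "pos i a \<in> borel_measurable M"
      using that a by (auto intro!: pos_measurable)
    show ?thesis by measurable
  qed
  have VM: "V Q \<in> sets M" if "Q \<subseteq> ?Q" for Q
  proof -
    have "V Q = (\<Union>q\<in>Q. {\<omega>\<in>space M. 2 * d < \<bar>pos i q \<omega> - pos i a \<omega>\<bar>})" by (auto simp: V_def)
    also have "\<dots> \<in> sets M"
      using that V1 by (intro sets.countable_UN' countable_subset[OF that cQ]) blast
    finally show ?thesis .
  qed
  show "W \<in> sets M" using VM[of ?Q] by (simp add: W_def V_def)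
  define Qn where "Qn = (\<lambda>n. from_nat_into ?Q ` {..n} \<inter> ?Q)"
  have "(\<lambda>n. measure M (V (Qn n))) \<longlonglongrightarrow> measure M (\<Union>n. V (Qn n))"
  proof (rule finite_Lim_measure_incseq)
    show "range (\<lambda>n. V (Qn n)) \<subseteq> sets M" by (rule image_subsetI, rule VM, unfold Qn_def, rule Int_lower2)
    show "incseq (\<lambda>n. V (Qn n))" by (auto simp: incseq_def V_def Qn_def)
  qed
  moreover have "(\<Union>n. V (Qn n)) = W"
  proof -
    have "\<exists>n. q \<in> Qn n" if "q \<in> ?Q" for q
    proof -
      obtain n where "from_nat_into ?Q n = q" using from_nat_into_surj[OF cQ \<open>q \<in> ?Q\<close>] by blast
      then show ?thesis using that by (intro exI[of _ n]) (auto simp: Qn_def)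
    qed
    moreover have "q \<in> ?Q" if "q \<in> Qn n" for q n using that unfolding Qn_def by (rule IntD2)
    ultimately have "(\<exists>n. \<exists>q\<in>Qn n. \<phi> q) \<longleftrightarrow> (\<exists>q\<in>?Q. \<phi> q)" for \<phi> by meson
    then have "\<omega> \<in> (\<Union>n. V (Qn n)) \<longleftrightarrow> \<omega> \<in> W" for \<omega>
      unfolding V_def W_def by simp
    then show ?thesis by (intro set_eqI)
  qed
  moreover have "measure M (V (Qn n)) \<le> 2 * (spread (b - a) / d\<^sup>2)" for n
  proof -
    have "finite (Qn n)" by (simp add: Qn_def)
    moreover have "Qn n \<subseteq> {a..b}" unfolding Qn_def by (rule order_trans[OF Int_lower2 Int_lower2])
    ultimately show ?thesis unfolding V_def by (intro maximal_inequality_finite a d half)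
  qed
  ultimately show "measure M W \<le> 2 * (spread (b - a) / d\<^sup>2)"
    by (intro LIMSEQ_le_const2[where X = "\<lambda>n. measure M (V (Qn n))"]) auto
qed

text \<open>The lattice is discrete, so a right-continuous coordinate is constant for a short time
  after \<open>t\<close>, and a rational time can be found there. This is how the rationals control
  all times.\<close>

lemma right_constant:
  assumes w: "\<omega> \<in> space M" and t: "0 \<le> t" "t < b"
  obtains q where "q \<in> \<rat>" "t < q" "q < b" "pos i q \<omega> = pos i t \<omega>"
proof -
  have "((\<lambda>s. X s \<omega>) \<longlongrightarrow> X t \<omega>) (at_right t)" using paths[OF w] t unfolding cadlag_def by blast
  then have lim: "((\<lambda>s. fst (X s \<omega>) $ i) \<longlongrightarrow> fst (X t \<omega>) $ i) (at_right t)"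
    by (intro tendsto_vec_nth tendsto_fst)
  have "\<forall>\<^sub>F s in at_right t. fst (X s \<omega>) $ i \<in> {fst (X t \<omega>) $ i}"
    by (rule topological_tendstoD[OF lim]) (rule discrete_topology_class.open_discrete, simp)
  then obtain c where c: "t < c" "\<And>s. t < s \<Longrightarrow> s < c \<Longrightarrow> fst (X s \<omega>) $ i = fst (X t \<omega>) $ i"
    unfolding eventually_at_right_field by auto
  obtain q where q: "q \<in> \<rat>" "t < q" "q < min b c" using Rats_dense_in_real[of t "min b c"] t c by auto
  show ?thesis by (rule that[of q]) (use q c in \<open>auto simp: pos_def coord_def\<close>)
qed

text \<open>A grid interval has length \<open>l\<close> at least 1, so the spread is at most
  \<open>3 * R\<^sup>2 * l\<^sup>2\<close>; with \<open>l\<close> at most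
  \<open>15 * grid n / Suc n\<close> this gives the constant 675 = 3 * 15 * 15.\<close>

lemma grid_spread:
  assumes c: "0 < c"
  shows "spread (grid (Suc n) - grid n) / (c * grid n)\<^sup>2 \<le> (675 * R\<^sup>2 / c\<^sup>2) / real (Suc n) ^ 2"
proof -
  let ?l = "grid (Suc n) - grid n" and ?m = "real (Suc n)"
  have g: "0 < grid n" using grid_ge_1[of n] by simp
  have l: "1 \<le> ?l" "?l \<le> 15 / ?m * grid n" by (rule grid_increment)+
  have "?l \<le> ?l\<^sup>2" using mult_left_mono[OF l(1), of ?l] l(1) by (simp add: power2_eq_square)
  then have "spread ?l \<le> R\<^sup>2 * (3 * ?l\<^sup>2)"
    unfolding spread_def by (intro mult_left_mono) auto
  also have "\<dots> \<le> R\<^sup>2 * (3 * (15 / ?m * grid n)\<^sup>2)"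
    using l by (intro mult_left_mono power_mono) auto
  finally have "spread ?l / (c * grid n)\<^sup>2 \<le> R\<^sup>2 * (3 * (15 / ?m * grid n)\<^sup>2) / (c * grid n)\<^sup>2"
    by (rule divide_right_mono) simp
  also have "\<dots> = (675 * R\<^sup>2 / c\<^sup>2) / ?m ^ 2"
    using g c by (simp add: power_mult_distrib power_divide field_simps del: of_nat_Suc)
  finally show ?thesis .
qed

text \<open>The maximal inequality gives exceedance probabilities of order \<open>1 / n ^ 2\<close>,
  so the Borel-Cantelli lemma leaves only finitely many bad intervals.\<close>

lemma fluctuations_between_grid_points:
  assumes c: "0 < c"
  shows "AE \<omega> in M. \<forall>\<^sub>F n in sequentially. \<forall>t. grid n \<le> t \<and> t < grid (Suc n) \<longrightarrow>
    \<bar>pos i t \<omega> - pos i (grid n) \<omega>\<bar> \<le> 2 * (c * grid n)"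
proof -
  define D where "D = 675 * R\<^sup>2 / c\<^sup>2"
  define \<kappa> where "\<kappa> = (\<lambda>n. spread (grid (Suc n) - grid n) / (c * grid n)\<^sup>2)"
  define W where "W = (\<lambda>n. {\<omega>\<in>space M. \<exists>q\<in>\<rat> \<inter> {grid n..grid (Suc n)}. 2 * (c * grid n) < \<bar>pos i q \<omega> - pos i (grid n) \<omega>\<bar>})"
  \<comment> \<open>The maximal inequality requires \<open>\<kappa> n \<le> 1 / 2\<close>, which
    holds for all large \<open>n\<close>; replacing the other events by the empty set makes the
    bound valid for every index.\<close>
  define V where "V = (\<lambda>n. if \<kappa> n \<le> 1 / 2 then W n else {})"
  have g: "0 \<le> grid n" "grid n \<le> grid (Suc n)" "0 < c * grid n" for n
    using grid_ge_1[of n] grid_mono[of n "Suc n"] c by auto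
  have \<kappa>D: "\<kappa> n \<le> D / real (Suc n) ^ 2" for n unfolding \<kappa>_def D_def by (rule grid_spread[OF c])
  have D: "0 \<le> D" by (simp add: D_def)
  have V: "V n \<in> sets M" "measure M (V n) \<le> 2 * D / real (Suc n) ^ 2" for n
  proof -
    have "V n \<in> sets M \<and> measure M (V n) \<le> 2 * (D / real (Suc n) ^ 2)"
    proof (cases "\<kappa> n \<le> 1 / 2")
      case True
      have "W n \<in> sets M" "measure M (W n) \<le> 2 * \<kappa> n"
        unfolding W_def \<kappa>_def
        by (rule maximal_inequality[OF g(1)[of n] g(2)[of n] g(3)[of n] True[unfolded \<kappa>_def], of i])+
      then show ?thesis using \<kappa>D[of n] True unfolding V_def by auto
    qed (use D in \<open>simp add: V_def\<close>)
    then show "V n \<in> sets M" "measure M (V n) \<le> 2 * D / real (Suc n) ^ 2" by auto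
  qed
  have "summable (\<lambda>n. measure M (V n))"
    by (rule summable_comparison_test'[OF summable_inverse_square[of "2 * D"], of 0]) (use V in auto)
  then have ae: "AE \<omega> in M. \<forall>\<^sub>F n in sequentially. \<omega> \<in> space M - V n"
    by (intro borel_cantelli_AE1 V) (auto simp: emeasure_eq_measure)
  have small: "\<forall>\<^sub>F n in sequentially. \<kappa> n \<le> 1 / 2"
  proof -
    have "(\<lambda>n. D / real (Suc n) ^ 2) \<longlonglongrightarrow> 0" by (rule summable_LIMSEQ_zero[OF summable_inverse_square])
    then have "\<forall>\<^sub>F n in sequentially. D / real (Suc n) ^ 2 < 1 / 2" by (rule order_tendstoD) simp
    then show ?thesis by (rule eventually_mono) (rule order_trans[OF \<kappa>D less_imp_le])
  qed
  from AE_space ae show ?thesis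
  proof eventually_elim
    fix \<omega> assume w: "\<omega> \<in> space M" and ev: "\<forall>\<^sub>F n in sequentially. \<omega> \<in> space M - V n"
    from small ev show "\<forall>\<^sub>F n in sequentially. \<forall>t. grid n \<le> t \<and> t < grid (Suc n) \<longrightarrow>
      \<bar>pos i t \<omega> - pos i (grid n) \<omega>\<bar> \<le> 2 * (c * grid n)"
    proof eventually_elim
      fix n assume n: "\<kappa> n \<le> 1 / 2" "\<omega> \<in> space M - V n"
      then have nW: "\<omega> \<notin> W n" by (simp add: V_def)
      show "\<forall>t. grid n \<le> t \<and> t < grid (Suc n) \<longrightarrow> \<bar>pos i t \<omega> - pos i (grid n) \<omega>\<bar> \<le> 2 * (c * grid n)"
      proof (intro allI impI)
        fix t assume t: "grid n \<le> t \<and> t < grid (Suc n)"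
        have t0: "0 \<le> t" using t g(1)[of n] by linarith
        obtain q where q: "q \<in> \<rat>" "t < q" "q < grid (Suc n)" "pos i q \<omega> = pos i t \<omega>"
          using right_constant[OF w t0, of "grid (Suc n)" i] t by blast
        have "q \<in> \<rat> \<inter> {grid n..grid (Suc n)}" using q t by auto
        then have "\<not> 2 * (c * grid n) < \<bar>pos i q \<omega> - pos i (grid n) \<omega>\<bar>"
          using nW w unfolding W_def by blast
        then show "\<bar>pos i t \<omega> - pos i (grid n) \<omega>\<bar> \<le> 2 * (c * grid n)" using q(4) by simp
      qed
    qed
  qed
qed

lemma coordinate_converges: "AE \<omega> in M. ((\<lambda>t. pos i t \<omega> / t) \<longlongrightarrow> speed i) at_top"
proof -
  have "AE \<omega> in M. \<forall>m. \<forall>\<^sub>F n in sequentially. \<forall>t. grid n \<le> t \<and> t < grid (Suc n) \<longrightarrow>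
      \<bar>pos i t \<omega> - pos i (grid n) \<omega>\<bar> \<le> 2 * (1 / real (Suc m) * grid n)"
    unfolding AE_all_countable by (intro allI fluctuations_between_grid_points) simp
  with converges_along_grid[of i] show ?thesis
  proof eventually_elim
    fix \<omega> assume "(\<lambda>n. pos i (grid n) \<omega> / grid n) \<longlonglongrightarrow> speed i"
      "\<forall>m. \<forall>\<^sub>F n in sequentially. \<forall>t. grid n \<le> t \<and> t < grid (Suc n) \<longrightarrow>
        \<bar>pos i t \<omega> - pos i (grid n) \<omega>\<bar> \<le> 2 * (1 / real (Suc m) * grid n)"
    then show "((\<lambda>t. pos i t \<omega> / t) \<longlongrightarrow> speed i) at_top" by (intro interpolate_grid) auto
  qed
qed

section \<open>Convergence in mean and the conclusion\<close>

lemma coordinate_L1_bound: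
  obtains K where "0 \<le> K" "\<And>t. 1 \<le> t \<Longrightarrow> (\<integral>\<^sup>+\<omega>. ennreal \<bar>pos i t \<omega> / t - speed i\<bar> \<partial>M) \<le> ennreal (K / sqrt (sqrt t))"
proof -
  obtain K where K: "0 \<le> K" "\<And>t. 1 \<le> t \<Longrightarrow> E (var_dev i t) \<le> K * (t * sqrt t)"
    using variance_bound by blast
  have "(\<integral>\<^sup>+\<omega>. ennreal \<bar>pos i t \<omega> / t - speed i\<bar> \<partial>M) \<le> ennreal ((K / 2 + 1 / 2) / sqrt (sqrt t))" if t: "1 \<le> t" for t
  proof -
    \<comment> \<open>With the weight t^(1/4) in the inequality \<open>*\<close>, the second moment
      term and the constant term are both of order t^(-1/4).\<close>
    define s where "s = sqrt (sqrt t)"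
    have t0: "0 < t" "0 \<le> t" using t by auto
    have s: "0 < s" "s * s = sqrt t" using t by (auto simp: s_def)
    note [measurable] = pos_measurable[OF t0(2)]
    have *: "\<bar>pos i t \<omega> / t - speed i\<bar> \<le> s / (2 * t\<^sup>2) * (pos i t \<omega> - t * speed i)\<^sup>2 + 1 / (2 * s)" for \<omega>
    proof -
      have "pos i t \<omega> / t - speed i = (pos i t \<omega> - t * speed i) / t" using t0 by (simp add: field_simps)
      then show ?thesis
        using weighted_am_gm[OF s(1), of "pos i t \<omega> / t - speed i" 1] by (simp add: power_divide)
    qed
    have lin: "ennreal a * ennreal b + ennreal c = ennreal (a * b + c)" if "0 \<le> a" "0 \<le> b" "0 \<le> c" for a b c
      using that by (simp only: ennreal_mult ennreal_plus mult_nonneg_nonneg)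
    have "(\<integral>\<^sup>+\<omega>. ennreal \<bar>pos i t \<omega> / t - speed i\<bar> \<partial>M) \<le>
        (\<integral>\<^sup>+\<omega>. ennreal (s / (2 * t\<^sup>2)) * ennreal ((pos i t \<omega> - t * speed i)\<^sup>2) + ennreal (1 / (2 * s)) \<partial>M)"
    proof (rule nn_integral_mono)
      fix \<omega>
      have "ennreal \<bar>pos i t \<omega> / t - speed i\<bar> \<le> ennreal (s / (2 * t\<^sup>2) * (pos i t \<omega> - t * speed i)\<^sup>2 + 1 / (2 * s))"
        by (rule ennreal_leI[OF *])
      also have "\<dots> = ennreal (s / (2 * t\<^sup>2)) * ennreal ((pos i t \<omega> - t * speed i)\<^sup>2) + ennreal (1 / (2 * s))"
        using s by (intro lin[symmetric]) auto
      finally show "ennreal \<bar>pos i t \<omega> / t - speed i\<bar> \<le>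
        ennreal (s / (2 * t\<^sup>2)) * ennreal ((pos i t \<omega> - t * speed i)\<^sup>2) + ennreal (1 / (2 * s))" .
    qed
    also have "\<dots> = ennreal (s / (2 * t\<^sup>2)) * (\<integral>\<^sup>+\<omega>. ennreal ((pos i t \<omega> - t * speed i)\<^sup>2) \<partial>M) + ennreal (1 / (2 * s))"
      by (subst nn_integral_add) (auto simp: nn_integral_cmult emeasure_space_1)
    also have "\<dots> \<le> ennreal (s / (2 * t\<^sup>2)) * ennreal (K * (t * sqrt t)) + ennreal (1 / (2 * s))"
      unfolding second_moment[OF t0(2)] by (intro add_right_mono mult_left_mono ennreal_leI K t) simp
    also have "\<dots> = ennreal (s / (2 * t\<^sup>2) * (K * (t * sqrt t)) + 1 / (2 * s))"
      using s K(1) t0 by (intro lin) auto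
    also have "s / (2 * t\<^sup>2) * (K * (t * sqrt t)) + 1 / (2 * s) = (K / 2 + 1 / 2) / s"
    proof -
      have "t = sqrt t * sqrt t" using t0 by simp
      also have "\<dots> = s * (s * sqrt t)" unfolding s(2)[symmetric] by simp
      finally have "s * sqrt t / t = 1 / s"
        using s(1) t0 by (simp add: eq_divide_eq divide_eq_eq mult.commute)
      moreover have "s / (2 * t\<^sup>2) * (K * (t * sqrt t)) = K / 2 * (s * sqrt t / t)"
        using t0 by (simp add: power2_eq_square)
      ultimately show ?thesis by (simp add: add_divide_distrib)
    qed
    finally show ?thesis unfolding s_def .
  qed
  then show ?thesis using K by (intro that[of "K / 2 + 1 / 2"]) auto
qed

lemma law_of_large_numbers:
  assumes v: "\<And>i. velocity $ i = speed i"
  shows "AE \<omega> in M. ((\<lambda>t. (1 / t) *\<^sub>R real_vec (fst (X t \<omega>))) \<longlongrightarrow> velocity) at_top"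
    and "((\<lambda>t. \<integral>\<^sup>+\<omega>. ennreal (norm ((1 / t) *\<^sub>R real_vec (fst (X t \<omega>)) - velocity)) \<partial>M) \<longlongrightarrow> 0) at_top"
proof -
  have comp: "((1 / t) *\<^sub>R real_vec (fst (X t \<omega>))) $ i = pos i t \<omega> / t" for t \<omega> i
    by (simp add: real_vec_def pos_def coord_def)
  have "AE \<omega> in M. \<forall>i\<in>UNIV. ((\<lambda>t. pos i t \<omega> / t) \<longlongrightarrow> speed i) at_top"
    by (rule AE_finite_allI) (auto intro: coordinate_converges)
  then show "AE \<omega> in M. ((\<lambda>t. (1 / t) *\<^sub>R real_vec (fst (X t \<omega>))) \<longlongrightarrow> velocity) at_top"
  proof eventually_elim
    fix \<omega> assume "\<forall>i\<in>UNIV. ((\<lambda>t. pos i t \<omega> / t) \<longlongrightarrow> speed i) at_top"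
    then show "((\<lambda>t. (1 / t) *\<^sub>R real_vec (fst (X t \<omega>))) \<longlongrightarrow> velocity) at_top"
      by (intro vec_tendstoI) (simp only: comp v, blast)
  qed
  have "\<forall>i. \<exists>K\<ge>0. \<forall>t\<ge>1. (\<integral>\<^sup>+\<omega>. ennreal \<bar>pos i t \<omega> / t - speed i\<bar> \<partial>M) \<le> ennreal (K / sqrt (sqrt t))"
  proof
    fix i
    obtain K where "0 \<le> K" "\<And>t. 1 \<le> t \<Longrightarrow> (\<integral>\<^sup>+\<omega>. ennreal \<bar>pos i t \<omega> / t - speed i\<bar> \<partial>M) \<le> ennreal (K / sqrt (sqrt t))"
      using coordinate_L1_bound by blast
    then show "\<exists>K\<ge>0. \<forall>t\<ge>1. (\<integral>\<^sup>+\<omega>. ennreal \<bar>pos i t \<omega> / t - speed i\<bar> \<partial>M) \<le> ennreal (K / sqrt (sqrt t))" by blast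
  qed
  then obtain K where K: "\<And>i. 0 \<le> K i"
    "\<And>i t. 1 \<le> t \<Longrightarrow> (\<integral>\<^sup>+\<omega>. ennreal \<bar>pos i t \<omega> / t - speed i\<bar> \<partial>M) \<le> ennreal (K i / sqrt (sqrt t))"
    by metis
  have bound: "(\<integral>\<^sup>+\<omega>. ennreal (norm ((1 / t) *\<^sub>R real_vec (fst (X t \<omega>)) - velocity)) \<partial>M) \<le> ennreal (\<Sum>i\<in>UNIV. K i / sqrt (sqrt t))"
    if t: "1 \<le> t" for t
  proof -
    have t0: "0 \<le> t" using t by simp
    note [measurable] = pos_measurable[OF t0]
    have "(\<integral>\<^sup>+\<omega>. ennreal (norm ((1 / t) *\<^sub>R real_vec (fst (X t \<omega>)) - velocity)) \<partial>M) \<le>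
        (\<integral>\<^sup>+\<omega>. (\<Sum>i\<in>UNIV. ennreal \<bar>pos i t \<omega> / t - speed i\<bar>) \<partial>M)"
    proof (rule nn_integral_mono)
      fix \<omega>
      have "norm ((1 / t) *\<^sub>R real_vec (fst (X t \<omega>)) - velocity) \<le> (\<Sum>i\<in>UNIV. \<bar>((1 / t) *\<^sub>R real_vec (fst (X t \<omega>)) - velocity) $ i\<bar>)"
        by (rule norm_le_l1_cart)
      also have "\<dots> = (\<Sum>i\<in>UNIV. \<bar>pos i t \<omega> / t - speed i\<bar>)"
        by (simp only: vector_minus_component comp v)
      finally show "ennreal (norm ((1 / t) *\<^sub>R real_vec (fst (X t \<omega>)) - velocity)) \<le> (\<Sum>i\<in>UNIV. ennreal \<bar>pos i t \<omega> / t - speed i\<bar>)"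
        by (subst sum_ennreal) (auto intro: ennreal_leI)
    qed
    also have "\<dots> = (\<Sum>i\<in>UNIV. \<integral>\<^sup>+\<omega>. ennreal \<bar>pos i t \<omega> / t - speed i\<bar> \<partial>M)"
      by (rule nn_integral_sum) measurable
    also have "\<dots> \<le> (\<Sum>i\<in>UNIV. ennreal (K i / sqrt (sqrt t)))" by (intro sum_mono K t)
    also have "\<dots> = ennreal (\<Sum>i\<in>UNIV. K i / sqrt (sqrt t))" using K t by (intro sum_ennreal) auto
    finally show ?thesis .
  qed
  have "filterlim (\<lambda>t. sqrt (sqrt t)) at_infinity at_top"
    by (intro filterlim_at_top_imp_at_infinity filterlim_compose[OF sqrt_at_top sqrt_at_top])
  then have "((\<lambda>t. K i / sqrt (sqrt t)) \<longlongrightarrow> 0) at_top" for i by (rule tendsto_divide_0[OF tendsto_const])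
  then have "((\<lambda>t. \<Sum>i\<in>UNIV. K i / sqrt (sqrt t)) \<longlongrightarrow> (\<Sum>i\<in>(UNIV :: 'd set). 0)) at_top" by (rule tendsto_sum)
  then have upper: "((\<lambda>t. ennreal (\<Sum>i\<in>UNIV. K i / sqrt (sqrt t))) \<longlongrightarrow> 0) at_top"
    using tendsto_ennrealI by fastforce
  show "((\<lambda>t. \<integral>\<^sup>+\<omega>. ennreal (norm ((1 / t) *\<^sub>R real_vec (fst (X t \<omega>)) - velocity)) \<partial>M) \<longlongrightarrow> 0) at_top"
  proof (rule tendsto_sandwich[OF _ _ tendsto_const upper])
    show "\<forall>\<^sub>F t in at_top. (\<integral>\<^sup>+\<omega>. ennreal (norm ((1 / t) *\<^sub>R real_vec (fst (X t \<omega>)) - velocity)) \<partial>M) \<le> ennreal (\<Sum>i\<in>UNIV. K i / sqrt (sqrt t))"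
      using eventually_ge_at_top[of 1] by (rule eventually_mono) (rule bound)
  qed simp
qed

end

theorem theorem10p2p1:
  fixes p :: "(int ^ 'd::finite) pmf"
    and \<rho> :: real
    and M :: "'w measure"
    and X :: "real \<Rightarrow> 'w \<Rightarrow> 'd tagged_state"
  defines "velocity \<equiv> (1 - \<rho>) *\<^sub>R (\<Sum>v\<in>set_pmf p. pmf p v *\<^sub>R real_vec v)"
  assumes finite_range: "finite (set_pmf p)"
    and irreducible: "irreducible_jumps (symmetrization p)"
    and density: "0 \<le> \<rho>" "\<rho> \<le> 1"
    and tagged_process: "tagged_exclusion_process p (bernoulli_tagged \<rho>) M X"
  shows "(AE \<omega> in M. ((\<lambda>t. (1 / t) *\<^sub>R real_vec (fst (X t \<omega>))) \<longlongrightarrow> velocity) at_top) \<and>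
         ((\<lambda>t. \<integral>\<^sup>+\<omega>. ennreal (norm ((1 / t) *\<^sub>R real_vec (fst (X t \<omega>)) - velocity)) \<partial>M)
            \<longlongrightarrow> 0) at_top"
proof -
  obtain P where P: "markov_semigroup tagged_space P"
    "has_generator_on tagged_space P local_functions (tagged_generator p)"
    "markov_process M tagged_space P X"
    using tagged_process unfolding tagged_exclusion_process_def by blast
  have "\<forall>\<omega>\<in>space M. cadlag (\<lambda>t. X t \<omega>)"
    "distr M tagged_space (X 0) = return (count_space UNIV) 0 \<Otimes>\<^sub>M bernoulli_tagged \<rho>"
    using tagged_process unfolding tagged_exclusion_process_def by blast+
  then interpret tagged_process p P \<rho> M X
    using finite_range density P by unfold_locales auto
  have "velocity $ i = speed i" for i
    unfolding velocity_def speed_def by (simp add: real_vec_def)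
  from law_of_large_numbers[OF this] show ?thesis by blast
qed

end
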